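(* Let $\widehat{s}_{H}(s)$ and $\widehat{c}_{H}(s)$ denote the Dirichlet generating functions of the sequences $s_{H,\mathcal{G}_6}(n)$ and $c_{H,\mathcal{G}_6}(n)$, $n\ge1$. Then: for $H=\pi_1(\mathcal{G}_1)$: $$\widehat{s}_H(s)=4^{-s}\zeta(s)\zeta(s-1)\zeta(s-2),\qquad \widehat{c}_H(s)=4^{-s-1}\zeta(s)\zeta(s-1)\big(\zeta(s-2)+3(1+3\cdot2^{-s})\zeta(s)\big);$$ for $H=\pi_1(\mathcal{G}_2)$: $$\widehat{s}_H(s)=3\cdot2^{-s}(1-2^{-s})\zeta(s)\zeta(s-1)\zeta(s-2),$$ $$\widehat{c}_H(s)=3\cdot2^{-s-1}(1-2^{-s})\zeta^2(s)\big((1+3\cdot2^{-s})\zeta(s-1)+(1-2^{-s})^2(1+2^{-s+1})\zeta(s)\big);$$ for $H=\pi_1(\mathcal{G}_6)$: $$\widehat{s}_H(s)=(1-2^{-s+1})^3\zeta^3(s-1),\qquad \widehat{c}_H(s)=(1-2^{-s})^3\zeta^3(s).$$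
   Context: The groups are given by presentations (with $u^v$ denoting $vuv^{-1}$): $\pi_1(\mathcal{G}_1)=\mathbb{Z}^3$; $\pi_1(\mathcal{G}_2)=\langle x,y,z : xyx^{-1}y^{-1}=1,\ x^z=x^{-1},\ y^z=y^{-1}\rangle$; $\pi_1(\mathcal{G}_6)=\langle x,y,z : xy^2x^{-1}y^2=yx^2y^{-1}x^2=xyz=1\rangle$. For a group $H$, $s_{H,\mathcal{G}_6}(n)$ is the number of subgroups of index $n$ in $\pi_1(\mathcal{G}_6)$ isomorphic to $H$, and $c_{H,\mathcal{G}_6}(n)$ is the number of conjugacy classes of such subgroups in $\pi_1(\mathcal{G}_6)$. The Dirichlet generating function of a sequence $\{f(n)\}_{n\ge1}$ is the formal series $\widehat f(s)=\sum_{n=1}^\infty f(n)n^{-s}$, and $\zeta(s)=\sum_{n=1}^\infty n^{-s}$ (so $\zeta(s-j)=\sum_{n\ge1} n^{j}n^{-s}$). The identities are between formal Dirichlet series. *)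

theory Defs
  imports Complex_Main "HOL-Algebra.Elementary_Groups"
begin

section \<open>Group presentations\<close>

text \<open>A word is a list of letters; the letter \<open>(g, True)\<close> stands for the generator \<open>g\<close> and
  \<open>(g, False)\<close> for its formal inverse.\<close>

type_synonym 'g word = "('g \<times> bool) list"

definition gen :: "'g \<Rightarrow> 'g word" where
  "gen g = [(g, True)]"

definition word_inv :: "'g word \<Rightarrow> 'g word" where
  "word_inv w = rev (map (\<lambda>(g, b). (g, \<not> b)) w)"

text \<open>A set \<open>R\<close> of relations \<open>l = r\<close> is a set of pairs \<open>(l, r)\<close> of words. \<open>word_eq R\<close> is the least
  congruence on words that contains \<open>R\<close> and makes \<open>(g, b)\<close> and \<open>(g, \<not> b)\<close> mutually inverse.\<close>

inductive word_eq :: "('g word \<times> 'g word) set \<Rightarrow> 'g word \<Rightarrow> 'g word \<Rightarrow> bool" for R where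
  refl: "word_eq R w w"
| sym: "word_eq R v w \<Longrightarrow> word_eq R w v"
| trans: "word_eq R u v \<Longrightarrow> word_eq R v w \<Longrightarrow> word_eq R u w"
| cancel: "word_eq R (u @ [(g, b), (g, \<not> b)] @ v) (u @ v)"
| rel: "(l, r) \<in> R \<Longrightarrow> word_eq R (u @ l @ v) (u @ r @ v)"

definition word_class :: "('g word \<times> 'g word) set \<Rightarrow> 'g word \<Rightarrow> 'g word set" where
  "word_class R w = {v. word_eq R w v}"

text \<open>The group generated by all elements of the type \<open>'g\<close> subject to the relations \<open>R\<close>. Its elements
  are congruence classes of words, so the product may be computed on any representatives.\<close>

definition presented_group :: "('g word \<times> 'g word) set \<Rightarrow> 'g word set monoid" where
  "presented_group R =
    \<lparr>carrier = range (word_class R),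
     monoid.mult = (\<lambda>A B. word_class R ((SOME v. v \<in> A) @ (SOME w. w \<in> B))),
     one = word_class R []\<rparr>"

lemma word_eq_append_left: "word_eq R v w \<Longrightarrow> word_eq R (u @ v) (u @ w)"
proof (induction rule: word_eq.induct)
  case (cancel u' g b v)
  show ?case using word_eq.cancel[of R "u @ u'" g b v] by simp
next
  case (rel l r u' v)
  then show ?case using word_eq.rel[of l r R "u @ u'" v] by simp
qed (auto intro: word_eq.intros(1-3))

lemma word_eq_append_right: "word_eq R v w \<Longrightarrow> word_eq R (v @ u) (w @ u)"
proof (induction rule: word_eq.induct)
  case (cancel u' g b v)
  show ?case using word_eq.cancel[of R u' g b "v @ u"] by simp
next
  case (rel l r u' v)
  then show ?case using word_eq.rel[of l r R u' "v @ u"] by simp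
qed (auto intro: word_eq.intros(1-3))

lemma word_eq_append:
  "word_eq R u u' \<Longrightarrow> word_eq R v v' \<Longrightarrow> word_eq R (u @ v) (u' @ v')"
  by (meson word_eq.trans word_eq_append_left word_eq_append_right)

lemma word_class_eq_iff: "word_class R v = word_class R w \<longleftrightarrow> word_eq R v w"
  unfolding word_class_def by (auto intro: word_eq.intros(1-3))

lemma word_inv_left: "word_eq R (word_inv w @ w) []"
proof (induction w)
  case (Cons a w)
  obtain g b where a: "a = (g, b)" by (cases a)
  have "word_eq R (word_inv w @ [(g, \<not> b), (g, \<not> \<not> b)] @ w) (word_inv w @ w)"
    by (rule word_eq.cancel)
  then show ?case using Cons a by (auto simp: word_inv_def intro: word_eq.trans)
qed (auto simp: word_inv_def intro: word_eq.refl)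

lemma presented_group_mult:
  "word_class R v \<otimes>\<^bsub>presented_group R\<^esub> word_class R w = word_class R (v @ w)"
proof -
  have *: "word_eq R u (SOME x. x \<in> word_class R u)" for u
    using someI[of "\<lambda>x. x \<in> word_class R u" u] by (simp add: word_class_def word_eq.refl)
  show ?thesis
    by (simp add: presented_group_def word_class_eq_iff word_eq.sym[OF word_eq_append[OF * *]])
qed

lemma carrier_presented_group: "carrier (presented_group R) = range (word_class R)"
  by (simp add: presented_group_def)

lemma one_presented_group: "\<one>\<^bsub>presented_group R\<^esub> = word_class R []"
  by (simp add: presented_group_def)

lemma group_presented_group: "group (presented_group R)"
proof (rule groupI)
  fix x assume "x \<in> carrier (presented_group R)"
  then obtain w where w: "x = word_class R w" by (auto simp: carrier_presented_group)
  then show "\<one>\<^bsub>presented_group R\<^esub> \<otimes>\<^bsub>presented_group R\<^esub> x = x"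
    by (simp add: one_presented_group presented_group_mult)
  have "word_class R (word_inv w) \<otimes>\<^bsub>presented_group R\<^esub> x = \<one>\<^bsub>presented_group R\<^esub>"
    by (simp add: w one_presented_group presented_group_mult word_class_eq_iff word_inv_left)
  then show "\<exists>y\<in>carrier (presented_group R). y \<otimes>\<^bsub>presented_group R\<^esub> x = \<one>\<^bsub>presented_group R\<^esub>"
    by (auto simp: carrier_presented_group)
qed (auto simp: presented_group_mult carrier_presented_group one_presented_group)

section \<open>The fundamental groups\<close>

datatype gen3 = X | Y | Z

definition pi1_G1 :: "(int \<times> int \<times> int) monoid" where
  "pi1_G1 = integer_group \<times>\<times> (integer_group \<times>\<times> integer_group)"

text \<open>Here \<open>u\<^sup>v\<close> means \<open>v u v\<^sup>-\<^sup>1\<close>.\<close>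

definition word_conj :: "'g word \<Rightarrow> 'g word \<Rightarrow> 'g word" where
  "word_conj u v = v @ u @ word_inv v"

definition pi1_G2 :: "gen3 word set monoid" where
  "pi1_G2 = (let x = gen X; y = gen Y; z = gen Z in
    presented_group
     {(x @ y @ word_inv x @ word_inv y, []),
      (word_conj x z, word_inv x),
      (word_conj y z, word_inv y)})"

definition pi1_G6 :: "gen3 word set monoid" where
  "pi1_G6 = (let x = gen X; y = gen Y; z = gen Z in
    presented_group
     {(x @ y @ y @ word_inv x @ y @ y, []),
      (y @ x @ x @ word_inv y @ x @ x, []),
      (x @ y @ z, [])})"

section \<open>Counting subgroups\<close>

text \<open>For \<open>n \<ge> 1\<close> the condition on \<open>card\<close> forces the set of cosets to be finite. The group \<open>pi1_G6\<close> is
  finitely generated, so it has finitely many subgroups of each finite index and the two cardinalities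
  below are genuine.\<close>

definition subgroups_iso :: "('h, 'c) monoid_scheme \<Rightarrow> ('a, 'b) monoid_scheme \<Rightarrow> nat \<Rightarrow> 'a set set" where
  "subgroups_iso H G n =
    {K. subgroup K G \<and> card (rcosets\<^bsub>G\<^esub> K) = n \<and> G\<lparr>carrier := K\<rparr> \<cong> H}"

definition subgroup_count :: "('h, 'c) monoid_scheme \<Rightarrow> ('a, 'b) monoid_scheme \<Rightarrow> nat \<Rightarrow> nat" where
  "subgroup_count H G n = card (subgroups_iso H G n)"

definition conjugacy_class :: "('a, 'b) monoid_scheme \<Rightarrow> 'a set \<Rightarrow> 'a set set" where
  "conjugacy_class G K = {g <#\<^bsub>G\<^esub> K #>\<^bsub>G\<^esub> inv\<^bsub>G\<^esub> g | g. g \<in> carrier G}"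

definition conj_class_count :: "('h, 'c) monoid_scheme \<Rightarrow> ('a, 'b) monoid_scheme \<Rightarrow> nat \<Rightarrow> nat" where
  "conj_class_count H G n = card (conjugacy_class G ` subgroups_iso H G n)"

section \<open>Formal Dirichlet series\<close>

text \<open>A formal Dirichlet series \<open>\<Sum>n\<ge>1. f n * n\<^sup>-\<^sup>s\<close> is represented by its coefficients; there is no
  coefficient at index \<open>0\<close>, which is normalised to \<open>0\<close>. Multiplication is Dirichlet convolution.\<close>

typedef (overloaded) 'a dirichlet_series = "{f :: nat \<Rightarrow> 'a::zero. f 0 = 0}"
  morphisms ds_coeff Abs_ds
  by auto

setup_lifting type_definition_dirichlet_series

lift_definition dirichlet :: "(nat \<Rightarrow> 'a) \<Rightarrow> 'a::zero dirichlet_series" is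
  "\<lambda>f n. if n = 0 then 0 else f n"
  by simp

lemma ds_coeff_0 [simp]: "ds_coeff A 0 = 0"
  using ds_coeff[of A] by simp

lemma ds_coeff_dirichlet: "ds_coeff (dirichlet f) n = (if n = 0 then 0 else f n)"
  by transfer simp

lemma ds_eqI: "(\<And>n. n > 0 \<Longrightarrow> ds_coeff A n = ds_coeff B n) \<Longrightarrow> A = B"
  by (metis ds_coeff_0 ds_coeff_inject ext gr0I)

instantiation dirichlet_series :: (comm_ring_1) comm_ring_1
begin

definition "0 = dirichlet (\<lambda>n. 0)"

definition "1 = dirichlet (\<lambda>n. if n = 1 then 1 else 0)"

definition "A + B = dirichlet (\<lambda>n. ds_coeff A n + ds_coeff B n)"

definition "- A = dirichlet (\<lambda>n. - ds_coeff A n)"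

definition "A - B = dirichlet (\<lambda>n. ds_coeff A n - ds_coeff B n)"

definition "A * B = dirichlet (\<lambda>n. \<Sum>d | d dvd n. ds_coeff A d * ds_coeff B (n div d))"

lemmas ds_coeff_simps =
  zero_dirichlet_series_def one_dirichlet_series_def plus_dirichlet_series_def
  uminus_dirichlet_series_def minus_dirichlet_series_def times_dirichlet_series_def
  ds_coeff_dirichlet

lemma ds_coeff_mult_pairs:
  assumes "n > 0"
  shows "ds_coeff (A * B) n = (\<Sum>(d, e) | d * e = n. ds_coeff A d * ds_coeff B e)"
  unfolding ds_coeff_simps using assms
  by (auto intro!: sum.reindex_bij_witness[of _ fst "\<lambda>d. (d, n div d)"])

lemma finite_divisor_pairs: "n > 0 \<Longrightarrow> finite {(d, e). d * e = (n :: nat)}"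
  by (rule finite_subset[of _ "{..n} \<times> {..n}"]) auto

instance
proof
  fix A B C :: "'a dirichlet_series"
  show "A * B = B * A"
    by (rule ds_eqI, simp only: ds_coeff_mult_pairs)
      (rule sum.reindex_bij_witness[of _ prod.swap prod.swap]; auto simp: mult.commute)
  show "(A * B) * C = A * (B * C)"
  proof (rule ds_eqI)
    fix n :: nat assume n: "n > 0"
    let ?P = "\<lambda>n. {(d, e). d * e = (n :: nat)}"
    have "ds_coeff ((A * B) * C) n =
        (\<Sum>p\<in>?P n. \<Sum>q\<in>?P (fst p). ds_coeff A (fst q) * ds_coeff B (snd q) * ds_coeff C (snd p))"
      unfolding ds_coeff_mult_pairs[OF n]
    proof (rule sum.cong)
      fix p assume "p \<in> ?P n"
      then have p: "fst p > 0" using n by (auto intro!: Nat.gr0I)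
      show "(case p of (d, e) \<Rightarrow> ds_coeff (A * B) d * ds_coeff C e) =
        (\<Sum>q\<in>?P (fst p). ds_coeff A (fst q) * ds_coeff B (snd q) * ds_coeff C (snd p))"
        using ds_coeff_mult_pairs[OF p, of A B]
        by (simp add: case_prod_unfold sum_distrib_right)
    qed simp
    also have "\<dots> = (\<Sum>(p, q)\<in>(SIGMA p:?P n. ?P (fst p)).
        ds_coeff A (fst q) * ds_coeff B (snd q) * ds_coeff C (snd p))"
      using n by (subst sum.Sigma) (auto simp: finite_divisor_pairs intro!: finite_divisor_pairs Nat.gr0I)
    also have "\<dots> = (\<Sum>(p, q)\<in>(SIGMA p:?P n. ?P (snd p)).
        ds_coeff A (fst p) * ds_coeff B (fst q) * ds_coeff C (snd q))"
      by (rule sum.reindex_bij_witness[of _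
            "\<lambda>((a, m), (b, c)). ((a * b, c), (a, b))" "\<lambda>((m, c), (a, b)). ((a, b * c), (b, c))"])
        (auto simp: mult.assoc)
    also have "\<dots> = (\<Sum>p\<in>?P n. \<Sum>q\<in>?P (snd p).
        ds_coeff A (fst p) * ds_coeff B (fst q) * ds_coeff C (snd q))"
      using n by (subst sum.Sigma) (auto simp: finite_divisor_pairs intro!: finite_divisor_pairs Nat.gr0I)
    also have "\<dots> = ds_coeff (A * (B * C)) n"
      unfolding ds_coeff_mult_pairs[OF n]
    proof (rule sum.cong)
      fix p assume "p \<in> ?P n"
      then have p: "snd p > 0" using n by (auto intro!: Nat.gr0I)
      show "(\<Sum>q\<in>?P (snd p). ds_coeff A (fst p) * ds_coeff B (fst q) * ds_coeff C (snd q)) =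
        (case p of (d, e) \<Rightarrow> ds_coeff A d * ds_coeff (B * C) e)"
        using ds_coeff_mult_pairs[OF p, of B C]
        by (simp add: case_prod_unfold sum_distrib_left mult.assoc)
    qed simp
    finally show "ds_coeff ((A * B) * C) n = ds_coeff (A * (B * C)) n" .
  qed
  show "1 * A = A"
  proof (rule ds_eqI)
    fix n :: nat assume n: "n > 0"
    have "ds_coeff (1 * A) n = (\<Sum>d | d dvd n. if d = 1 then ds_coeff A n else 0)"
    proof -
      have "ds_coeff (1 * A) n = (\<Sum>d | d dvd n. ds_coeff 1 d * ds_coeff A (n div d))"
        using n by (simp add: times_dirichlet_series_def ds_coeff_dirichlet)
      also have "\<dots> = (\<Sum>d | d dvd n. if d = 1 then ds_coeff A n else 0)"
        by (rule sum.cong) (auto simp: one_dirichlet_series_def ds_coeff_dirichlet)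
      finally show ?thesis .
    qed
    also have "\<dots> = ds_coeff A n" using n by (subst sum.delta) auto
    finally show "ds_coeff (1 * A) n = ds_coeff A n" .
  qed
  show "(A + B) * C = A * C + B * C"
    by (rule ds_eqI, simp add: ds_coeff_simps flip: sum.distrib)
      (rule sum.cong, auto simp: algebra_simps)
  show "(0 :: 'a dirichlet_series) \<noteq> 1"
  proof
    assume "(0 :: 'a dirichlet_series) = 1"
    then have "ds_coeff (0 :: 'a dirichlet_series) 1 = ds_coeff 1 1" by simp
    then show False by (simp add: ds_coeff_simps)
  qed
qed (rule ds_eqI; simp add: ds_coeff_simps algebra_simps)+

end

text \<open>\<open>ds_const c\<close> is the constant \<open>c\<close>, \<open>ds_pow m\<close> is \<open>m\<^sup>-\<^sup>s\<close>, and \<open>ds_zeta j\<close> is \<open>\<zeta>(s - j)\<close>.\<close>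

definition ds_const :: "'a \<Rightarrow> 'a::zero dirichlet_series" where
  "ds_const c = dirichlet (\<lambda>n. if n = 1 then c else 0)"

definition ds_pow :: "nat \<Rightarrow> 'a::zero_neq_one dirichlet_series" where
  "ds_pow m = dirichlet (\<lambda>n. if n = m then 1 else 0)"

definition ds_zeta :: "nat \<Rightarrow> 'a::semiring_1 dirichlet_series" where
  "ds_zeta j = dirichlet (\<lambda>n. of_nat n ^ j)"

definition dgf :: "(nat \<Rightarrow> nat) \<Rightarrow> complex dirichlet_series" where
  "dgf f = dirichlet (\<lambda>n. of_nat (f n))"

end

theory Submission
  imports Defs
begin

(*
  The map sending an isometry to its translation part identifies pi1(G6) with the triples
  (a, b, c) of integers with even sum: the holonomy Z/2 x Z/2 can be read off the parities of the
  triple. A finite-index subgroup is isomorphic to pi1(G1), pi1(G2) or pi1(G6) according to the size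
  1, 2 or 4 of its holonomy.

  Holonomy 1: sublattices of the translation lattice Z^3, counted by Hermite normal forms
  (a, b, c; x, y, z). Conjugation acts through the three half turns, which are permuted by the cyclic
  symmetry of the coordinates, so the classes are counted with Burnside's lemma.

  Holonomy 2, generated by a rotation about the first axis: the first coordinate is a homomorphism to
  Z with image kZ, k odd. Its kernel is a plane lattice M, and the subgroup is determined by k, M and
  a coset of M. Conjugation only remembers the coset modulo M + 2Z^2, up to one involution, whose
  fixed points are again counted by normal forms.

  Holonomy 4: such a subgroup meets the translations in 2kZ x 2lZ x 2mZ with k, l, m odd, and is
  conjugate to the image of the endomorphism (a, b, c) -> (ka, lb, mc).
*)

section \<open>Groups given by a presentation\<close>

text \<open>All linear parts are diagonal and commute. Hence conjugating an element with linear part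
  R and translation part t by one with linear part S and translation part u gives the translation
  part S t + (1 - R) u. If R = 1, only S acts, and classes are orbits of the Klein four-group of
  linear parts. If R is a half turn, (1 - R) u is twice u on the two negated axes: with holonomy of
  order two the offset of the half turns survives only modulo 2, and with full holonomy it
  disappears, because all moduli are odd and 4 is invertible modulo them. The factors 1/4 and 1/2 in
  the class series are the reciprocal orders of the groups left acting: the four linear parts,
  respectively the involution \<open>twist\<close>. The weight
  \<open>c * (1 + of_bool (even c) + of_bool (even b))\<close> appears for holonomy 1 and 2 for one
  reason: with A = Z^2/M the first count meets the 2-torsion of A, the second A/2A, and these have
  the same order. Every count is brought into the form of a sum over ordered factorisations into
  three factors, the shape of a coefficient of a threefold Dirichlet product. The three isomorphism
  types are told apart by commutativity and by the centre.\<close>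

definition eval_word :: "('a, 'b) monoid_scheme \<Rightarrow> ('g \<Rightarrow> 'a) \<Rightarrow> 'g word \<Rightarrow> 'a" where
  "eval_word G f w =
    foldr (\<lambda>(g, b) a. (if b then f g else inv\<^bsub>G\<^esub> f g) \<otimes>\<^bsub>G\<^esub> a) w \<one>\<^bsub>G\<^esub>"

lemma eval_word_Nil [simp]: "eval_word G f [] = \<one>\<^bsub>G\<^esub>"
  by (simp add: eval_word_def)

lemma eval_word_Cons [simp]:
  "eval_word G f ((g, b) # w) = (if b then f g else inv\<^bsub>G\<^esub> f g) \<otimes>\<^bsub>G\<^esub> eval_word G f w"
  by (simp add: eval_word_def)

context group
begin

lemma eval_word_closed: "(\<And>g. f g \<in> carrier G) \<Longrightarrow> eval_word G f w \<in> carrier G"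
  by (induction w) auto

lemma eval_word_append:
  assumes "\<And>g. f g \<in> carrier G"
  shows "eval_word G f (v @ w) = eval_word G f v \<otimes> eval_word G f w"
  by (induction v) (auto simp: assms eval_word_closed m_assoc)

lemma eval_word_eq:
  assumes f: "\<And>g. f g \<in> carrier G"
    and R: "\<And>l r. (l, r) \<in> R \<Longrightarrow> eval_word G f l = eval_word G f r"
  shows "word_eq R v w \<Longrightarrow> eval_word G f v = eval_word G f w"
proof (induction rule: word_eq.induct)
  case (cancel u g b v)
  have "(if b then f g else inv f g) \<otimes> ((if \<not> b then f g else inv f g) \<otimes> eval_word G f v) =
      eval_word G f v"
    using f by (simp add: eval_word_closed flip: m_assoc)
  then show ?case
    by (simp add: eval_word_append f)
next
  case (rel l r u v)
  then show ?case by (simp add: eval_word_append f R)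
qed auto

lemma inv_absorb:
  assumes "x \<in> carrier G" "a \<in> carrier G" "b \<in> carrier G" "a \<otimes> x = b"
  shows "a = b \<otimes> inv x"
  using assms inv_solve_right by blast

text \<open>A map \<open>s\<close> compatible with right multiplication by the generators is inverse to the evaluation
  of words, so \<open>s\<close> describes a normal form in the presented group.\<close>

lemma presented_group_iso:
  assumes f: "\<And>g. f g \<in> carrier G"
    and R: "\<And>l r. (l, r) \<in> R \<Longrightarrow> eval_word G f l = eval_word G f r"
    and s: "\<And>v. v \<in> carrier G \<Longrightarrow> s v \<in> carrier (presented_group R)"
    and s1: "s \<one> = word_class R []"
    and step: "\<And>v g. v \<in> carrier G \<Longrightarrow>
      s (v \<otimes> f g) = s v \<otimes>\<^bsub>presented_group R\<^esub> word_class R (gen g)"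
    and surj: "\<And>S. subgroup S G \<Longrightarrow> range f \<subseteq> S \<Longrightarrow> carrier G \<subseteq> S"
  shows "presented_group R \<cong> G"
proof -
  let ?P = "presented_group R"
  interpret P: group ?P by (rule group_presented_group)
  note ev = eval_word_closed[of f, OF f]
  have cl: "word_class R w \<in> carrier ?P" for w by (simp add: carrier_presented_group)
  have inv_cl: "word_class R [(g, False)] = inv\<^bsub>?P\<^esub> word_class R (gen g)" for g
    by (rule P.inv_equality[symmetric])
      (use word_eq.cancel[of R "[]" g False "[]"] in
        \<open>auto simp: cl presented_group_mult one_presented_group word_class_eq_iff gen_def\<close>)
  \<comment> \<open>For an inverse letter, \<open>step\<close> is applied to
    \<open>v \<otimes> inv f g\<close> and the generator is cancelled on both sides.\<close>
  have step': "s (v \<otimes> (if b then f g else inv f g)) = s v \<otimes>\<^bsub>?P\<^esub> word_class R [(g, b)]"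
    if v: "v \<in> carrier G" for v g b
  proof (cases b)
    case False
    have "s ((v \<otimes> inv f g) \<otimes> f g) = s (v \<otimes> inv f g) \<otimes>\<^bsub>?P\<^esub> word_class R (gen g)"
      by (rule step) (simp add: v f)
    moreover have "(v \<otimes> inv f g) \<otimes> f g = v"
      using v f by (simp add: m_assoc)
    ultimately have "s (v \<otimes> inv f g) = s v \<otimes>\<^bsub>?P\<^esub> inv\<^bsub>?P\<^esub> word_class R (gen g)"
      by (intro P.inv_absorb) (simp_all add: v f s cl)
    then show ?thesis using False by (simp add: inv_cl)
  qed (simp add: step v gen_def)
  have s_eval: "v \<in> carrier G \<Longrightarrow> s (v \<otimes> eval_word G f w) = s v \<otimes>\<^bsub>?P\<^esub> word_class R w" for v w
  proof (induction w arbitrary: v)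
    case Nil
    then show ?case by (simp add: s flip: one_presented_group)
  next
    case (Cons a w)
    obtain g b where a: "a = (g, b)" by (cases a)
    let ?u = "if b then f g else inv f g"
    have u: "?u \<in> carrier G" by (simp add: f)
    have "s (v \<otimes> eval_word G f (a # w)) = s ((v \<otimes> ?u) \<otimes> eval_word G f w)"
      using Cons.prems u ev[of w] by (simp add: a m_assoc del: if_split)
    also have "\<dots> = s (v \<otimes> ?u) \<otimes>\<^bsub>?P\<^esub> word_class R w"
      using Cons.prems u by (intro Cons.IH) simp
    also have "\<dots> = s v \<otimes>\<^bsub>?P\<^esub> (word_class R [(g, b)] \<otimes>\<^bsub>?P\<^esub> word_class R w)"
      using Cons.prems by (simp only: step' P.m_assoc s cl)
    finally show ?case by (simp add: presented_group_mult a)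
  qed
  have sec: "s (eval_word G f w) = word_class R w" for w
    using s_eval[of \<one> w] ev[of w] s1
    by (simp add: cl P.l_one[unfolded one_presented_group])
  \<comment> \<open>\<open>h\<close> evaluates some representative word; as the relations hold in
    \<open>G\<close>, the choice does not matter. By \<open>sec\<close>, \<open>s\<close> is a left
    inverse of \<open>h\<close>, which gives injectivity.\<close>
  define h where "h c = eval_word G f (SOME w. w \<in> c)" for c
  have h: "h (word_class R w) = eval_word G f w" for w
  proof -
    have "(SOME v. v \<in> word_class R w) \<in> word_class R w"
      by (rule someI[of _ w]) (simp add: word_class_def word_eq.refl)
    then have "word_eq R w (SOME v. v \<in> word_class R w)" by (simp add: word_class_def)
    then show ?thesis using eval_word_eq[of f R] f R unfolding h_def by metis
  qed
  have hom: "h \<in> hom ?P G"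
    by (rule homI) (auto simp: carrier_presented_group h ev presented_group_mult eval_word_append f)
  have "inj_on h (carrier ?P)"
    by (rule inj_onI) (metis (no_types, lifting) carrier_presented_group h imageE sec)
  moreover have "h ` carrier ?P = carrier G"
  proof
    show "h ` carrier ?P \<subseteq> carrier G" using hom by (auto simp: hom_def)
    have "h (word_class R (gen g)) = f g" for g
      by (simp add: h gen_def f)
    then show "carrier G \<subseteq> h ` carrier ?P"
      using group_hom.img_is_subgroup[of ?P G h] hom cl
      by (intro surj) (auto simp: group_hom_def group_hom_axioms_def P.is_group is_group image_iff, metis)
  qed
  ultimately show ?thesis
    using hom by (intro is_isoI) (auto simp: iso_def bij_betw_def)
qed

end

section \<open>Invariance of the counts under isomorphism\<close>

lemma subgroups_iso_cong:
  assumes "H \<cong> H'" "group H" "group H'" "group G"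
  shows "subgroups_iso H G n = subgroups_iso H' G n"
proof -
  have "group (G\<lparr>carrier := K\<rparr>)" if "subgroup K G" for K
    using that assms(4) by (simp add: subgroup.subgroup_is_group)
  then have "G\<lparr>carrier := K\<rparr> \<cong> H \<longleftrightarrow> G\<lparr>carrier := K\<rparr> \<cong> H'" if "subgroup K G" for K
    using that assms by (meson iso_trans group.iso_sym)
  then show ?thesis unfolding subgroups_iso_def by blast
qed

context group_hom
begin

lemma image_r_coset:
  "K \<subseteq> carrier G \<Longrightarrow> a \<in> carrier G \<Longrightarrow> h ` (K #>\<^bsub>G\<^esub> a) = (h ` K) #>\<^bsub>H\<^esub> h a"
  unfolding r_coset_def by (force simp: subset_iff)

lemma image_l_coset:
  "K \<subseteq> carrier G \<Longrightarrow> a \<in> carrier G \<Longrightarrow> h ` (a <#\<^bsub>G\<^esub> K) = h a <#\<^bsub>H\<^esub> h ` K"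
  unfolding l_coset_def by (force simp: subset_iff)

lemma image_rcosets:
  assumes "h ` carrier G = carrier H" "K \<subseteq> carrier G"
  shows "rcosets\<^bsub>H\<^esub> (h ` K) = image h ` (rcosets\<^bsub>G\<^esub> K)"
  using assms(2) unfolding RCOSETS_def assms(1)[symmetric]
  by (simp add: image_UN image_r_coset cong: SUP_cong_simp)

lemma image_conjugacy_class:
  assumes "h ` carrier G = carrier H" "K \<subseteq> carrier G"
  shows "conjugacy_class H (h ` K) = image h ` conjugacy_class G K"
proof -
  have "h ` (g <#\<^bsub>G\<^esub> K #>\<^bsub>G\<^esub> inv\<^bsub>G\<^esub> g) = h g <#\<^bsub>H\<^esub> h ` K #>\<^bsub>H\<^esub> inv\<^bsub>H\<^esub> h g"
    if "g \<in> carrier G" for g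
    using that assms(2) G.l_coset_subset_G[of K g] by (simp add: image_r_coset image_l_coset)
  then show ?thesis
    unfolding conjugacy_class_def by (auto simp: image_iff simp flip: assms(1))
qed

end

lemma image_subgroup_iso:
  assumes G: "group G" and G': "group G'" and h: "h \<in> iso G G'" and K: "subgroup K G"
  shows "subgroup (h ` K) G'" and "card (rcosets\<^bsub>G'\<^esub> (h ` K)) = card (rcosets\<^bsub>G\<^esub> K)"
    and "G\<lparr>carrier := K\<rparr> \<cong> G'\<lparr>carrier := h ` K\<rparr>"
proof -
  interpret h: group_hom G G' h
    using h G G' by (simp add: group_hom_def group_hom_axioms_def iso_def)
  have bij: "bij_betw h (carrier G) (carrier G')" using h by (simp add: iso_def)
  have Ks: "K \<subseteq> carrier G" using K by (simp add: subgroup.subset)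
  show "subgroup (h ` K) G'" using K by (rule h.subgroup_img_is_subgroup)
  have "inj_on (image h) (rcosets\<^bsub>G\<^esub> K)"
    using bij Ks by (intro inj_onI)
      (metis (no_types, lifting) G K bij_betw_def inj_on_image_eq_iff subgroup.rcosets_carrier)
  then show "card (rcosets\<^bsub>G'\<^esub> (h ` K)) = card (rcosets\<^bsub>G\<^esub> K)"
    using bij Ks by (subst h.image_rcosets) (auto simp: bij_betw_def card_image)
  have "h \<in> iso (G\<lparr>carrier := K\<rparr>) (G'\<lparr>carrier := h ` K\<rparr>)"
    using bij Ks by (auto simp: iso_def hom_def bij_betw_def subset_iff intro: inj_on_subset)
  then show "G\<lparr>carrier := K\<rparr> \<cong> G'\<lparr>carrier := h ` K\<rparr>" by (rule is_isoI)
qed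

lemma image_subgroups_iso:
  assumes G: "group G" and G': "group G'" and h: "h \<in> iso G G'"
  shows "image h ` subgroups_iso H G n \<subseteq> subgroups_iso H G' n"
proof
  fix K' assume "K' \<in> image h ` subgroups_iso H G n"
  then obtain K where K: "K' = h ` K" "subgroup K G" "card (rcosets\<^bsub>G\<^esub> K) = n" "G\<lparr>carrier := K\<rparr> \<cong> H"
    by (auto simp: subgroups_iso_def)
  have "group (G\<lparr>carrier := K\<rparr>)" using K(2) G by (simp add: subgroup.subgroup_is_group)
  then show "K' \<in> subgroups_iso H G' n"
    using image_subgroup_iso[OF G G' h K(2)] K(1,3,4)
    by (auto simp: subgroups_iso_def intro: iso_trans group.iso_sym)
qed

text \<open>This moves the whole problem into coordinates. Taking images under an isomorphism is
  injective on subsets of the carrier, and taking images once more is injective on families of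
  subsets, which settles the conjugacy classes.\<close>

lemma counts_iso_transfer:
  assumes G: "group G" and G': "group G'" and iso: "G \<cong> G'"
  shows "subgroup_count H G n = subgroup_count H G' n"
    and "conj_class_count H G n = conj_class_count H G' n"
proof -
  obtain h where h: "h \<in> iso G G'" using iso by (auto simp: is_iso_def)
  interpret h: group_hom G G' h
    using h G G' by (simp add: group_hom_def group_hom_axioms_def iso_def)
  have bij: "bij_betw h (carrier G) (carrier G')" using h by (simp add: iso_def)
  then have inj: "inj_on (image h) (Pow (carrier G))"
    by (simp add: bij_betw_def inj_on_image_Pow)
  have sub: "subgroups_iso H G n \<subseteq> Pow (carrier G)"
    by (auto simp: subgroups_iso_def dest: subgroup.subset)
  have img: "image h ` subgroups_iso H G n = subgroups_iso H G' n"
  proof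
    show "image h ` subgroups_iso H G n \<subseteq> subgroups_iso H G' n"
      by (rule image_subgroups_iso[OF G G' h])
    define h' where "h' = inv_into (carrier G) h"
    have h': "h' \<in> iso G' G" unfolding h'_def using G h by (rule group.iso_set_sym)
    show "subgroups_iso H G' n \<subseteq> image h ` subgroups_iso H G n"
    proof
      fix K assume K: "K \<in> subgroups_iso H G' n"
      then have "K \<subseteq> carrier G'" by (auto simp: subgroups_iso_def dest: subgroup.subset)
      then have "h ` h' ` K = K"
        using bij unfolding h'_def by (auto simp: bij_betw_def image_inv_into_cancel)
      moreover have "h' ` K \<in> subgroups_iso H G n"
        using image_subgroups_iso[OF G' G h'] K by blast
      ultimately show "K \<in> image h ` subgroups_iso H G n" by (metis imageI)
    qed
  qed
  show "subgroup_count H G n = subgroup_count H G' n"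
    unfolding subgroup_count_def img[symmetric]
    by (rule card_image[symmetric]) (rule inj_on_subset[OF inj sub])
  have "conjugacy_class G' ` subgroups_iso H G' n =
      image (image h) ` conjugacy_class G ` subgroups_iso H G n"
    unfolding img[symmetric] image_image using bij sub
    by (intro image_cong refl) (auto simp: h.image_conjugacy_class bij_betw_def)
  moreover have "inj_on (image (image h)) (conjugacy_class G ` subgroups_iso H G n)"
  proof (rule inj_on_subset[of _ "Pow (Pow (carrier G))"])
    show "inj_on (image (image h)) (Pow (Pow (carrier G)))"
      using inj by (simp add: inj_on_image_Pow)
    show "conjugacy_class G ` subgroups_iso H G n \<subseteq> Pow (Pow (carrier G))"
    proof -
      have "g <#\<^bsub>G\<^esub> K #>\<^bsub>G\<^esub> inv\<^bsub>G\<^esub> g \<subseteq> carrier G" if "K \<subseteq> carrier G" "g \<in> carrier G" for g K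
        using that h.G.l_coset_subset_G h.G.r_coset_subset_G by simp
      then show ?thesis using sub unfolding conjugacy_class_def by (auto; blast)
    qed
  qed
  ultimately show "conj_class_count H G n = conj_class_count H G' n"
    by (simp add: conj_class_count_def card_image)
qed

section \<open>Coordinates\<close>

definition psgn :: "int \<Rightarrow> int" where
  "psgn n = (if even n then 1 else - 1)"

lemma psgn_simps [simp]: "even n \<Longrightarrow> psgn n = 1" "odd n \<Longrightarrow> psgn n = - 1"
  by (auto simp: psgn_def)

text \<open>The isometry of \<open>\<real>\<^sup>3\<close> attached to \<open>(a, b, c)\<close> is
  \<open>v \<mapsto> (a + (-1)\<^sup>c v\<^sub>1, b + (-1)\<^sup>a v\<^sub>2, c + (-1)\<^sup>b v\<^sub>3)\<close>, so the linear part can be read off the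
  parities of the translation part. The generators are \<open>x = (1, 1, 0)\<close>, \<open>y = (0, 1, 1)\<close> and
  \<open>z = (1, 0, 1)\<close>.\<close>

definition didicosm :: "(int \<times> int \<times> int) monoid" where
  "didicosm = \<lparr>carrier = {(a, b, c). even (a + b + c)},
     monoid.mult = (\<lambda>(a, b, c) (a', b', c'). (a + psgn c * a', b + psgn a * b', c + psgn b * c')),
     one = (0, 0, 0)\<rparr>"

text \<open>Here \<open>(a, b, c)\<close> stands for \<open>x\<^sup>b y\<^sup>c z\<^sup>a\<close>.\<close>

definition dicosm :: "(int \<times> int \<times> int) monoid" where
  "dicosm = \<lparr>carrier = UNIV,
     monoid.mult = (\<lambda>(a, b, c) (a', b', c'). (a + a', b + psgn a * b', c + psgn a * c')),
     one = (0, 0, 0)\<rparr>"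

lemma didicosm_simps:
  "(a, b, c) \<in> carrier didicosm \<longleftrightarrow> even (a + b + c)"
  "(a, b, c) \<otimes>\<^bsub>didicosm\<^esub> (a', b', c') = (a + psgn c * a', b + psgn a * b', c + psgn b * c')"
  "\<one>\<^bsub>didicosm\<^esub> = (0, 0, 0)"
  by (simp_all add: didicosm_def)

lemma dicosm_simps:
  "v \<in> carrier dicosm"
  "(a, b, c) \<otimes>\<^bsub>dicosm\<^esub> (a', b', c') = (a + a', b + psgn a * b', c + psgn a * c')"
  "\<one>\<^bsub>dicosm\<^esub> = (0, 0, 0)"
  by (simp_all add: dicosm_def)

lemma group_didicosm: "group didicosm"
proof (rule groupI)
  fix u v w assume "u \<in> carrier didicosm" "v \<in> carrier didicosm" "w \<in> carrier didicosm"
  then show "u \<otimes>\<^bsub>didicosm\<^esub> v \<otimes>\<^bsub>didicosm\<^esub> w = u \<otimes>\<^bsub>didicosm\<^esub> (v \<otimes>\<^bsub>didicosm\<^esub> w)"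
    by (cases u; cases v; cases w) (auto simp: didicosm_simps psgn_def)
next
  fix v assume "v \<in> carrier didicosm"
  moreover obtain a b c where "v = (a, b, c)" by (cases v)
  ultimately show "\<exists>w\<in>carrier didicosm. w \<otimes>\<^bsub>didicosm\<^esub> v = \<one>\<^bsub>didicosm\<^esub>"
    by (intro bexI[of _ "(- psgn c * a, - psgn a * b, - psgn b * c)"])
      (auto simp: didicosm_simps psgn_def)
qed (auto simp: didicosm_simps psgn_def)

lemma group_dicosm: "group dicosm"
proof (rule groupI)
  fix u v w :: "int \<times> int \<times> int"
  show "u \<otimes>\<^bsub>dicosm\<^esub> v \<otimes>\<^bsub>dicosm\<^esub> w = u \<otimes>\<^bsub>dicosm\<^esub> (v \<otimes>\<^bsub>dicosm\<^esub> w)"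
    by (cases u; cases v; cases w) (auto simp: dicosm_simps psgn_def)
next
  fix v :: "int \<times> int \<times> int"
  obtain a b c where "v = (a, b, c)" by (cases v)
  then show "\<exists>w\<in>carrier dicosm. w \<otimes>\<^bsub>dicosm\<^esub> v = \<one>\<^bsub>dicosm\<^esub>"
    by (intro bexI[of _ "(- a, - psgn a * b, - psgn a * c)"])
      (auto simp: dicosm_simps psgn_def)
qed (auto simp: dicosm_simps)

lemma inv_didicosm:
  assumes "even (a + b + c)"
  shows "inv\<^bsub>didicosm\<^esub> (a, b, c) = (- psgn c * a, - psgn a * b, - psgn b * c)"
  by (rule group.inv_equality[OF group_didicosm]) (use assms in \<open>auto simp: didicosm_simps psgn_def\<close>)

lemma inv_dicosm: "inv\<^bsub>dicosm\<^esub> (a, b, c) = (- a, - psgn a * b, - psgn a * c)"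
  by (rule group.inv_equality[OF group_dicosm]) (auto simp: dicosm_simps psgn_def)

lemma even_sum_cases [consumes 1, case_names T X Y Z]:
  fixes a b c :: int
  assumes "even (a + b + c)"
  obtains i j k where "a = 2 * i" "b = 2 * j" "c = 2 * k"
    | i j k where "a = 2 * i + 1" "b = 2 * j + 1" "c = 2 * k"
    | i j k where "a = 2 * i" "b = 2 * j + 1" "c = 2 * k + 1"
    | i j k where "a = 2 * i + 1" "b = 2 * j" "c = 2 * k + 1"
proof -
  consider "even a" "even b" "even c" | "odd a" "odd b" "even c" | "even a" "odd b" "odd c"
    | "odd a" "even b" "odd c" using assms by auto
  then show thesis
    by cases (elim evenE oddE, (rule that; assumption))+
qed

section \<open>The presentations in coordinates\<close>

fun didicosm_gen :: "gen3 \<Rightarrow> int \<times> int \<times> int" where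
  "didicosm_gen X = (1, 1, 0)"
| "didicosm_gen Y = (0, 1, 1)"
| "didicosm_gen Z = (1, 0, 1)"

fun dicosm_gen :: "gen3 \<Rightarrow> int \<times> int \<times> int" where
  "dicosm_gen X = (0, 1, 0)"
| "dicosm_gen Y = (0, 0, 1)"
| "dicosm_gen Z = (1, 0, 0)"

lemma (in group) subgroup_int_powers:
  assumes S: "subgroup S G" and \<phi>: "\<And>m n :: int. \<phi> (m + n) = \<phi> m \<otimes> \<phi> n"
    and one: "\<phi> 1 \<in> S" and cl: "\<And>n. \<phi> n \<in> carrier G"
  shows "\<phi> n \<in> S"
proof (induction n rule: int_induct[of _ 0])
  case base
  have "\<phi> 0 = \<one>" using \<phi>[of 0 0] cl[of 0] by simp
  then show ?case using subgroup.one_closed[OF S] by simp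
next
  case (step1 i)
  then show ?case using \<phi>[of i 1] one subgroup.m_closed[OF S] by simp
next
  case (step2 i)
  have "\<phi> (i - 1) = \<phi> i \<otimes> inv \<phi> 1"
    using \<phi>[of "i - 1" 1] cl by (intro inv_absorb) auto
  then show ?case using step2 one subgroup.m_closed[OF S] subgroup.m_inv_closed[OF S] by simp
qed

text \<open>The squares of the generators are twice the unit vectors, so \<open>S\<close> contains
  all even vectors. The remainders modulo 2 of any element are the coordinates of the identity or of
  a generator.\<close>

lemma didicosm_generated:
  assumes S: "subgroup S didicosm" and "range didicosm_gen \<subseteq> S"
  shows "carrier didicosm \<subseteq> S"
proof -
  have gen: "(1, 1, 0) \<in> S" "(0, 1, 1) \<in> S" "(1, 0, 1) \<in> S"
    using assms(2) by (metis didicosm_gen.simps rangeI subsetD)+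
  note m = subgroup.m_closed[OF S]
  note pow = group.subgroup_int_powers[OF group_didicosm S]
  have x: "(2 * i, 0, 0) \<in> S" for i
    by (rule pow) (use m[OF gen(1) gen(1)] in \<open>simp_all add: didicosm_simps distrib_left\<close>)
  have y: "(0, 2 * i, 0) \<in> S" for i
    by (rule pow) (use m[OF gen(2) gen(2)] in \<open>simp_all add: didicosm_simps distrib_left\<close>)
  have z: "(0, 0, 2 * i) \<in> S" for i
    by (rule pow) (use m[OF gen(3) gen(3)] in \<open>simp_all add: didicosm_simps distrib_left\<close>)
  have T: "(2 * i, 2 * j, 2 * k) \<in> S" for i j k
    using m[OF m[OF x y] z, of i j k] by (simp add: didicosm_simps)
  have "(a, b, c) \<in> S" if abc: "even (a + b + c)" for a b c
  proof -
    have "a = 2 * (a div 2) + a mod 2" "b = 2 * (b div 2) + b mod 2" "c = 2 * (c div 2) + c mod 2"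
      by simp_all
    moreover have "(a mod 2, b mod 2, c mod 2) \<in> S"
    proof -
      consider "even a" "even b" "even c" | "odd a" "odd b" "even c" | "even a" "odd b" "odd c"
        | "odd a" "even b" "odd c" using abc by auto
      then show ?thesis
        using T[of 0 0 0] gen by cases (simp_all add: odd_iff_mod_2_eq_one)
    qed
    moreover have "(2 * (a div 2), 2 * (b div 2), 2 * (c div 2)) \<otimes>\<^bsub>didicosm\<^esub>
        (a mod 2, b mod 2, c mod 2) = (a, b, c)"
      by (simp add: didicosm_simps)
    ultimately show ?thesis
      using m[OF T, of "(a mod 2, b mod 2, c mod 2)" "a div 2" "b div 2" "c div 2"] by simp
  qed
  then show ?thesis by (auto simp: didicosm_def)
qed

lemma dicosm_generated:
  assumes S: "subgroup S dicosm" and "range dicosm_gen \<subseteq> S"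
  shows "carrier dicosm \<subseteq> S"
proof -
  have gen: "(0, 1, 0) \<in> S" "(0, 0, 1) \<in> S" "(1, 0, 0) \<in> S"
    using assms(2) by (metis dicosm_gen.simps rangeI subsetD)+
  note m = subgroup.m_closed[OF S]
  note pow = group.subgroup_int_powers[OF group_dicosm S]
  have x: "(0, i, 0) \<in> S" for i
    by (rule pow) (use gen in \<open>simp_all add: dicosm_simps\<close>)
  have y: "(0, 0, i) \<in> S" for i
    by (rule pow) (use gen in \<open>simp_all add: dicosm_simps\<close>)
  have z: "(i, 0, 0) \<in> S" for i
    by (rule pow) (use gen in \<open>simp_all add: dicosm_simps\<close>)
  have "(i, j, k) \<in> S" for i j k
    using m[OF m[OF x y] z, of j k i] by (simp add: dicosm_simps)
  then show ?thesis by auto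
qed

context group
begin

text \<open>The relations say that \<open>x\<close> inverts \<open>y^2\<close>, that
  \<open>y\<close> inverts \<open>x^2\<close>, and that \<open>z\<close> is the inverse of
  \<open>x y\<close>. The conclusions are what a normal form needs: the squares commute, and a
  product of two different generators is a product of squares times the third generator.\<close>

lemma didicosm_relations:
  assumes xy: "x \<in> carrier G" "y \<in> carrier G" "z \<in> carrier G"
    and r1: "x \<otimes> (y \<otimes> (y \<otimes> (inv x \<otimes> (y \<otimes> y)))) = \<one>"
    and r2: "y \<otimes> (x \<otimes> (x \<otimes> (inv y \<otimes> (x \<otimes> x)))) = \<one>"
    and r3: "x \<otimes> (y \<otimes> z) = \<one>"
  defines "A \<equiv> x \<otimes> x" and "B \<equiv> y \<otimes> y" and "C \<equiv> z \<otimes> z"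
  shows "A \<otimes> B = B \<otimes> A" "A \<otimes> C = C \<otimes> A" "B \<otimes> C = C \<otimes> B"
    and "x \<otimes> y = inv C \<otimes> z" "x \<otimes> z = A \<otimes> (inv C \<otimes> y)"
    and "y \<otimes> x = inv A \<otimes> (B \<otimes> z)" "y \<otimes> z = inv A \<otimes> x"
    and "z \<otimes> x = inv B \<otimes> y" "z \<otimes> y = inv B \<otimes> (C \<otimes> x)"
proof -
  have cl [simp]: "x \<in> carrier G" "y \<in> carrier G" "z \<in> carrier G"
    "A \<in> carrier G" "B \<in> carrier G" "C \<in> carrier G"
    using xy by (auto simp: A_def B_def C_def)
  have cancel: "u \<otimes> (inv u \<otimes> w) = w" "inv u \<otimes> (u \<otimes> w) = w"
    if "u \<in> carrier G" "w \<in> carrier G" for u w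
    using that by (simp_all flip: m_assoc)
  have eq_inv: "u = inv w" if "u \<otimes> w = \<one>" "u \<in> carrier G" "w \<in> carrier G" for u w
    using that inv_equality by simp
  have yz: "y \<otimes> z = inv x" using eq_inv[of x "y \<otimes> z"] r3 by (metis cl(1-3) inv_inv m_closed)
  have z: "z = inv y \<otimes> inv x" using yz by (metis cl(1-3) cancel(2) )
  have zx: "z \<otimes> x = inv y" by (simp add: z m_assoc)
  have xy': "x \<otimes> y = inv z" using z by (simp add: inv_mult_group)
  have xB: "x \<otimes> B = inv B \<otimes> x"
  proof -
    have "(x \<otimes> (B \<otimes> inv x)) \<otimes> B = \<one>" using r1 by (simp add: B_def m_assoc)
    then have "x \<otimes> (B \<otimes> inv x) = inv B" by (intro eq_inv) auto
    then have "x \<otimes> (B \<otimes> inv x) \<otimes> x = inv B \<otimes> x" by simp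
    then show ?thesis by (simp add: m_assoc)
  qed
  have yA: "y \<otimes> A = inv A \<otimes> y"
  proof -
    have "(y \<otimes> (A \<otimes> inv y)) \<otimes> A = \<one>" using r2 by (simp add: A_def m_assoc)
    then have "y \<otimes> (A \<otimes> inv y) = inv A" by (intro eq_inv) auto
    then have "y \<otimes> (A \<otimes> inv y) \<otimes> y = inv A \<otimes> y" by simp
    then show ?thesis by (simp add: m_assoc)
  qed
  have flip: "u \<otimes> inv w = w \<otimes> u" if "u \<otimes> w = inv w \<otimes> u" "u \<in> carrier G" "w \<in> carrier G" for u w
  proof -
    have "w \<otimes> (u \<otimes> w) \<otimes> inv w = w \<otimes> (inv w \<otimes> u) \<otimes> inv w" by (simp add: that(1))
    then show ?thesis using that(2,3) by (simp add: m_assoc cancel)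
  qed
  have xB': "x \<otimes> inv B = B \<otimes> x" and yA': "y \<otimes> inv A = A \<otimes> y"
    using flip[OF xB] flip[OF yA] by simp_all
  have inv_x: "inv x = inv A \<otimes> x" and inv_y: "inv y = inv B \<otimes> y" and inv_z: "inv z = inv C \<otimes> z"
    by (simp_all add: A_def B_def C_def inv_mult_group m_assoc)
  have xA: "x \<otimes> A = A \<otimes> x" "y \<otimes> B = B \<otimes> y" "z \<otimes> C = C \<otimes> z"
    by (simp_all add: A_def B_def C_def m_assoc)
  have comm_inv: "u \<otimes> inv w = inv w \<otimes> u" if "u \<otimes> w = w \<otimes> u" "u \<in> carrier G" "w \<in> carrier G" for u w
  proof -
    have "inv w \<otimes> (u \<otimes> w) \<otimes> inv w = inv w \<otimes> (w \<otimes> u) \<otimes> inv w" by (simp add: that(1))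
    then show ?thesis using that(2,3) by (simp add: m_assoc cancel)
  qed
  have xAi: "x \<otimes> inv A = inv A \<otimes> x" "y \<otimes> inv B = inv B \<otimes> y"
    using comm_inv[OF xA(1)] comm_inv[OF xA(2)] by simp_all
  have ext: "u \<otimes> (w \<otimes> t) = w' \<otimes> (u \<otimes> t)"
    if "u \<otimes> w = w' \<otimes> u" "u \<in> carrier G" "w \<in> carrier G" "w' \<in> carrier G" "t \<in> carrier G" for u w w' t
    using that by (metis m_assoc)
  have AB: "A \<otimes> B = B \<otimes> A"
    unfolding A_def by (simp add: m_assoc xB xB' ext[OF xB] ext[OF xB'])
  note rules = xB xB' yA yA' xA xAi ext[OF xB] ext[OF xB'] ext[OF yA] ext[OF yA']
    ext[OF xA(1)] ext[OF xA(2)] ext[OF xAi(1)] ext[OF xAi(2)] cancel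
  have inv_flip: "inv u \<otimes> w = inv w \<otimes> inv u"
    if "u \<otimes> w = inv w \<otimes> u" "u \<in> carrier G" "w \<in> carrier G" for u w
  proof -
    have "inv u \<otimes> (u \<otimes> inv w) \<otimes> inv u = inv u \<otimes> (w \<otimes> u) \<otimes> inv u" by (simp only: flip[OF that])
    then show ?thesis using that(2,3) by (simp add: m_assoc cancel)
  qed
  have z': "inv (x \<otimes> y) = z" by (simp add: z inv_mult_group)
  \<comment> \<open>Of \<open>x\<close> and \<open>y\<close>, one inverts \<open>A\<close> and the
    other commutes with it, and likewise for \<open>B\<close>. So \<open>x \<otimes> y\<close>
    inverts both, and with it its inverse \<open>z\<close>.\<close>
  have zA: "z \<otimes> A = inv A \<otimes> z" and zB: "z \<otimes> B = inv B \<otimes> z"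
    unfolding z'[symmetric] by (rule inv_flip; simp add: m_assoc rules)+
  have zA': "z \<otimes> inv A = A \<otimes> z" and zB': "z \<otimes> inv B = B \<otimes> z"
    using flip[OF zA] flip[OF zB] by simp_all
  \<comment> \<open>Both sides reduce to \<open>B \<otimes> (x \<otimes> (y \<otimes> x))\<close>:
    the left one through \<open>y \<otimes> z = inv x\<close>, the right one through
    \<open>inv z = x \<otimes> y\<close>.\<close>
  have yC: "y \<otimes> C = inv C \<otimes> y"
  proof -
    have "z = inv B \<otimes> (A \<otimes> (y \<otimes> x))"
      by (simp add: z inv_x inv_y m_assoc yA' ext[OF yA'])
    then have "x \<otimes> z = B \<otimes> (A \<otimes> (x \<otimes> (y \<otimes> x)))"
      by (simp add: ext[OF xB'] ext[OF xA(1)])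
    then have "inv A \<otimes> (x \<otimes> z) = B \<otimes> (x \<otimes> (y \<otimes> x))"
      by (simp add: ext[OF AB[symmetric]] cancel)
    moreover have "y \<otimes> C = inv A \<otimes> (x \<otimes> z)"
      by (simp add: C_def yz inv_x m_assoc flip: m_assoc[of y z z])
    moreover have "inv C \<otimes> y = x \<otimes> (y \<otimes> (x \<otimes> B))"
      by (simp add: C_def B_def inv_mult_group m_assoc flip: xy')
    ultimately show ?thesis
      by (simp add: xB ext[OF xAi(2)] ext[OF xB'])
  qed
  show "A \<otimes> B = B \<otimes> A" by (rule AB)
  show "A \<otimes> C = C \<otimes> A" unfolding C_def by (simp add: m_assoc zA ext[OF zA'])
  show "B \<otimes> C = C \<otimes> B" unfolding C_def by (simp add: m_assoc zB ext[OF zB'])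
  show "x \<otimes> y = inv C \<otimes> z" by (simp add: xy' inv_z)
  show yz': "y \<otimes> z = inv A \<otimes> x" by (simp add: yz inv_x)
  show zx': "z \<otimes> x = inv B \<otimes> y" by (simp add: zx inv_y)
  have "A \<otimes> (y \<otimes> C) = A \<otimes> ((y \<otimes> z) \<otimes> z)" by (simp add: C_def m_assoc)
  also have "\<dots> = x \<otimes> z" by (simp only: yz') (simp add: m_assoc cancel)
  finally show "x \<otimes> z = A \<otimes> (inv C \<otimes> y)" by (simp only: yC)
  have "inv A \<otimes> (B \<otimes> z) = inv A \<otimes> (y \<otimes> (y \<otimes> z))" by (simp add: B_def m_assoc)
  also have "\<dots> = y \<otimes> x" by (simp add: yz' ext[OF yA'] cancel)
  finally show "y \<otimes> x = inv A \<otimes> (B \<otimes> z)" by simp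
  have "inv B \<otimes> (C \<otimes> x) = inv B \<otimes> (z \<otimes> (z \<otimes> x))" by (simp add: C_def m_assoc)
  also have "\<dots> = z \<otimes> y" by (simp add: zx' ext[OF zB'] cancel)
  finally show "z \<otimes> y = inv B \<otimes> (C \<otimes> x)" by simp
qed

lemma int_pow_commute:
  assumes "u \<otimes> w = w \<otimes> u" and u: "u \<in> carrier G" and w: "w \<in> carrier G"
  shows "u [^] (i :: int) \<otimes> w [^] (j :: int) = w [^] j \<otimes> u [^] i"
proof -
  have *: "u [^] (i :: int) \<otimes> w = w \<otimes> u [^] i"
    if "u \<otimes> w = w \<otimes> u" and [simp]: "u \<in> carrier G" "w \<in> carrier G" for u w i
  proof (induction i rule: int_induct[of _ 0])
    case (step1 i)
    have "u [^] (i + 1) \<otimes> w = u [^] i \<otimes> (w \<otimes> u)" by (simp add: int_pow_mult m_assoc that(1))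
    also have "\<dots> = w \<otimes> u [^] i \<otimes> u" by (simp add: step1 flip: m_assoc)
    finally show ?case by (simp add: int_pow_mult m_assoc)
  next
    case (step2 i)
    have "inv u \<otimes> w = inv u \<otimes> (w \<otimes> u) \<otimes> inv u" by (simp add: m_assoc)
    also have "\<dots> = w \<otimes> inv u" by (simp flip: that(1) m_assoc)
    finally have 1: "inv u \<otimes> w = w \<otimes> inv u" .
    have "u [^] (i - 1) \<otimes> w = u [^] i \<otimes> (w \<otimes> inv u)" by (simp add: int_pow_diff m_assoc 1)
    also have "\<dots> = w \<otimes> u [^] i \<otimes> inv u" by (simp add: step2 flip: m_assoc)
    finally show ?case by (simp add: int_pow_diff m_assoc)
  qed simp
  show ?thesis using *[OF *[OF assms, symmetric]] u w by simp
qed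

definition abc_power :: "'a \<Rightarrow> 'a \<Rightarrow> 'a \<Rightarrow> int \<Rightarrow> int \<Rightarrow> int \<Rightarrow> 'a" where
  "abc_power A B C i j k = A [^] i \<otimes> (B [^] j \<otimes> C [^] k)"

lemma abc_power_mult:
  assumes [simp]: "A \<in> carrier G" "B \<in> carrier G" "C \<in> carrier G" "t \<in> carrier G"
    and "A \<otimes> B = B \<otimes> A" "A \<otimes> C = C \<otimes> A" "B \<otimes> C = C \<otimes> B"
  shows "abc_power A B C i j k \<otimes> (abc_power A B C i' j' k' \<otimes> t) =
    abc_power A B C (i + i') (j + j') (k + k') \<otimes> t"
proof -
  have ext: "w [^] q \<otimes> (u [^] p \<otimes> t) = u [^] p \<otimes> (w [^] q \<otimes> t)"
    if "u \<otimes> w = w \<otimes> u" "u \<in> carrier G" "w \<in> carrier G" "t \<in> carrier G" for u w t and p q :: int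
    using int_pow_commute[OF that(1-3), of p q] that by (metis int_pow_closed m_assoc)
  show ?thesis
    by (simp add: abc_power_def int_pow_mult m_assoc ext[OF assms(5)] ext[OF assms(6)] ext[OF assms(7)])
qed

lemma conj_inv_power:
  assumes "z \<otimes> u = inv u \<otimes> z" and [simp]: "u \<in> carrier G" "z \<in> carrier G"
  shows "z [^] (a :: int) \<otimes> u [^] (j :: int) = u [^] (psgn a * j) \<otimes> z [^] a"
proof -
  have cancel: "u \<otimes> (inv u \<otimes> w) = w" "inv u \<otimes> (u \<otimes> w) = w"
    if "u \<in> carrier G" "w \<in> carrier G" for u w
    using that by (simp_all flip: m_assoc)
  have zu': "z \<otimes> inv u = u \<otimes> z"
  proof -
    have "u \<otimes> (z \<otimes> u) \<otimes> inv u = u \<otimes> (inv u \<otimes> z) \<otimes> inv u" by (simp add: assms(1))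
    then show ?thesis by (simp add: m_assoc cancel)
  qed
  have z: "z \<otimes> u [^] j = u [^] (- j) \<otimes> z" for j :: int
  proof (induction j rule: int_induct[of _ 0])
    case (step1 i)
    have "z \<otimes> u [^] (i + 1) = (z \<otimes> u [^] i) \<otimes> u" by (simp add: int_pow_mult m_assoc)
    also have "\<dots> = u [^] (- i) \<otimes> (inv u \<otimes> z)" unfolding step1 by (simp add: m_assoc assms(1))
    finally show ?case by (simp add: int_pow_mult int_pow_diff m_assoc)
  next
    case (step2 i)
    have "z \<otimes> u [^] (i - 1) = (z \<otimes> u [^] i) \<otimes> inv u" by (simp add: int_pow_diff m_assoc)
    also have "\<dots> = u [^] (- i) \<otimes> (u \<otimes> z)" unfolding step2 by (simp add: m_assoc zu')
    also have "\<dots> = u [^] (- i + 1) \<otimes> z"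
      using int_pow_mult[of u "- i" 1] by (simp add: m_assoc)
    finally show ?case by simp
  qed simp
  have z': "inv z \<otimes> u [^] j = u [^] (- j) \<otimes> inv z" for j :: int
  proof -
    have "inv z \<otimes> (z \<otimes> u [^] (- j)) \<otimes> inv z = inv z \<otimes> (u [^] j \<otimes> z) \<otimes> inv z" by (simp add: z)
    then show ?thesis by (simp add: m_assoc cancel)
  qed
  show ?thesis
  proof (induction a arbitrary: j rule: int_induct[of _ 0])
    case (step1 i)
    have "z [^] (i + 1) \<otimes> u [^] j = z [^] i \<otimes> u [^] (- j) \<otimes> z"
      by (simp add: int_pow_mult m_assoc z)
    then show ?case unfolding step1 by (simp add: int_pow_mult m_assoc psgn_def)
  next
    case (step2 i)
    have "z [^] (i - 1) \<otimes> u [^] j = z [^] i \<otimes> u [^] (- j) \<otimes> inv z"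
      by (simp add: int_pow_diff m_assoc z')
    then show ?case unfolding step2 by (simp add: int_pow_diff m_assoc psgn_def)
  qed simp
qed

end

lemma presented_group_word_mult:
  "word_class R (a # b # w) =
    word_class R [a] \<otimes>\<^bsub>presented_group R\<^esub> word_class R (b # w)"
  by (simp add: presented_group_mult)

lemma presented_group_inv_letter:
  "word_class R [(g, False)] = inv\<^bsub>presented_group R\<^esub> word_class R [(g, True)]"
  by (rule group.inv_equality[OF group_presented_group, symmetric])
    (use word_eq.cancel[of R "[]" g False "[]"] in
      \<open>auto simp: carrier_presented_group presented_group_mult one_presented_group word_class_eq_iff\<close>)

lemma pi1_G6_iso: "pi1_G6 \<cong> didicosm"
proof -
  define R :: "(gen3 word \<times> gen3 word) set" where
    "R = {(gen X @ gen Y @ gen Y @ word_inv (gen X) @ gen Y @ gen Y, []),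
      (gen Y @ gen X @ gen X @ word_inv (gen Y) @ gen X @ gen X, []),
      (gen X @ gen Y @ gen Z, [])}"
  let ?P = "presented_group R"
  interpret P: group ?P by (rule group_presented_group)
  have cl: "word_class R w \<in> carrier ?P" for w by (simp add: carrier_presented_group)
  define x y z where "x = word_class R (gen X)" and "y = word_class R (gen Y)"
    and "z = word_class R (gen Z)"
  have [simp]: "x \<in> carrier ?P" "y \<in> carrier ?P" "z \<in> carrier ?P"
    by (simp_all add: x_def y_def z_def cl)
  have rel: "word_class R l = \<one>\<^bsub>?P\<^esub>" if "(l, []) \<in> R" for l
    using word_eq.rel[OF that, of "[]" "[]"] by (simp add: one_presented_group word_class_eq_iff)
  have "word_class R (gen X @ gen Y @ gen Y @ word_inv (gen X) @ gen Y @ gen Y) = \<one>\<^bsub>?P\<^esub>"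
    "word_class R (gen Y @ gen X @ gen X @ word_inv (gen Y) @ gen X @ gen X) = \<one>\<^bsub>?P\<^esub>"
    "word_class R (gen X @ gen Y @ gen Z) = \<one>\<^bsub>?P\<^esub>"
    by (rule rel, simp add: R_def)+
  then have rels:
    "x \<otimes>\<^bsub>?P\<^esub> (y \<otimes>\<^bsub>?P\<^esub> (y \<otimes>\<^bsub>?P\<^esub> (inv\<^bsub>?P\<^esub> x \<otimes>\<^bsub>?P\<^esub> (y \<otimes>\<^bsub>?P\<^esub> y)))) = \<one>\<^bsub>?P\<^esub>"
    "y \<otimes>\<^bsub>?P\<^esub> (x \<otimes>\<^bsub>?P\<^esub> (x \<otimes>\<^bsub>?P\<^esub> (inv\<^bsub>?P\<^esub> y \<otimes>\<^bsub>?P\<^esub> (x \<otimes>\<^bsub>?P\<^esub> x)))) = \<one>\<^bsub>?P\<^esub>"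
    "x \<otimes>\<^bsub>?P\<^esub> (y \<otimes>\<^bsub>?P\<^esub> z) = \<one>\<^bsub>?P\<^esub>"
    by (simp_all add: x_def y_def z_def gen_def word_inv_def presented_group_word_mult
        presented_group_inv_letter)
  define A B C where "A = x \<otimes>\<^bsub>?P\<^esub> x" and "B = y \<otimes>\<^bsub>?P\<^esub> y" and "C = z \<otimes>\<^bsub>?P\<^esub> z"
  have [simp]: "A \<in> carrier ?P" "B \<in> carrier ?P" "C \<in> carrier ?P"
    by (simp_all add: A_def B_def C_def)
  note dr = P.didicosm_relations[of x y z, OF _ _ _ rels, folded A_def B_def C_def, simplified]
  define N where "N = P.abc_power A B C"
  have N_cl [simp]: "N i j k \<in> carrier ?P" for i j k by (simp add: N_def P.abc_power_def)
  have N_mult: "N i j k \<otimes>\<^bsub>?P\<^esub> (N i' j' k' \<otimes>\<^bsub>?P\<^esub> t) = N (i + i') (j + j') (k + k') \<otimes>\<^bsub>?P\<^esub> t"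
    if "t \<in> carrier ?P" for i j k i' j' k' t
    unfolding N_def by (rule P.abc_power_mult) (simp_all add: that dr(1-3))
  \<comment> \<open>The multiplication table of the representatives \<open>x\<close>,
    \<open>y\<close>, \<open>z\<close> modulo the translations, in normal form. It makes right
    multiplication by a generator computable.\<close>
  have table: "x \<otimes>\<^bsub>?P\<^esub> x = N 1 0 0 \<otimes>\<^bsub>?P\<^esub> \<one>\<^bsub>?P\<^esub>" "x \<otimes>\<^bsub>?P\<^esub> y = N 0 0 (- 1) \<otimes>\<^bsub>?P\<^esub> z"
    "x \<otimes>\<^bsub>?P\<^esub> z = N 1 0 (- 1) \<otimes>\<^bsub>?P\<^esub> y" "y \<otimes>\<^bsub>?P\<^esub> x = N (- 1) 1 0 \<otimes>\<^bsub>?P\<^esub> z"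
    "y \<otimes>\<^bsub>?P\<^esub> y = N 0 1 0 \<otimes>\<^bsub>?P\<^esub> \<one>\<^bsub>?P\<^esub>" "y \<otimes>\<^bsub>?P\<^esub> z = N (- 1) 0 0 \<otimes>\<^bsub>?P\<^esub> x"
    "z \<otimes>\<^bsub>?P\<^esub> x = N 0 (- 1) 0 \<otimes>\<^bsub>?P\<^esub> y" "z \<otimes>\<^bsub>?P\<^esub> y = N 0 (- 1) 1 \<otimes>\<^bsub>?P\<^esub> x"
    "z \<otimes>\<^bsub>?P\<^esub> z = N 0 0 1 \<otimes>\<^bsub>?P\<^esub> \<one>\<^bsub>?P\<^esub>"
    by (simp_all add: N_def P.abc_power_def P.int_pow_neg dr P.m_assoc)
      (simp_all add: A_def B_def C_def)
  \<comment> \<open>The parities of \<open>a\<close> and \<open>b\<close> determine that of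
    \<open>c\<close>, so they select the representative. Since \<open>div\<close> rounds down, the
    vector of remainders is exactly the coordinate vector of that representative.\<close>
  define s where "s = (\<lambda>(a, b, c). N (a div 2) (b div 2) (c div 2) \<otimes>\<^bsub>?P\<^esub>
    (if odd a then if odd b then x else z else if odd b then y else \<one>\<^bsub>?P\<^esub>))"
  have div2: "(2 * i + 2) div 2 = i + 1" "(2 * i + 1 + 1) div 2 = i + 1"
    "(2 * i - 1) div 2 = i - 1" for i :: int
    by simp_all
  have N_mult1: "N i j k \<otimes>\<^bsub>?P\<^esub> N i' j' k' = N (i + i') (j + j') (k + k')" for i j k i' j' k'
    using N_mult[of "\<one>\<^bsub>?P\<^esub>"] by simp
  have step: "s (v \<otimes>\<^bsub>didicosm\<^esub> didicosm_gen g) = s v \<otimes>\<^bsub>?P\<^esub> word_class R (gen g)"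
    if "v \<in> carrier didicosm" for v g
  proof -
    obtain a b c where v: "v = (a, b, c)" by (cases v)
    then have "even (a + b + c)" using that by (simp add: didicosm_simps)
    then have "s ((a, b, c) \<otimes>\<^bsub>didicosm\<^esub> (1, 1, 0)) = s (a, b, c) \<otimes>\<^bsub>?P\<^esub> x \<and>
      s ((a, b, c) \<otimes>\<^bsub>didicosm\<^esub> (0, 1, 1)) = s (a, b, c) \<otimes>\<^bsub>?P\<^esub> y \<and>
      s ((a, b, c) \<otimes>\<^bsub>didicosm\<^esub> (1, 0, 1)) = s (a, b, c) \<otimes>\<^bsub>?P\<^esub> z"
    proof (cases rule: even_sum_cases)
      case (T i j k)
      show ?thesis unfolding T by (simp add: s_def didicosm_simps P.m_assoc)
    next
      case (X i j k)
      show ?thesis unfolding X by (simp add: s_def didicosm_simps P.m_assoc table N_mult N_mult1 div2 add_ac)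
    next
      case (Y i j k)
      show ?thesis unfolding Y by (simp add: s_def didicosm_simps P.m_assoc table N_mult N_mult1 div2 add_ac)
    next
      case (Z i j k)
      show ?thesis unfolding Z by (simp add: s_def didicosm_simps P.m_assoc table N_mult N_mult1 div2 add_ac)
    qed
    then show ?thesis
      by (cases g) (simp_all add: v x_def y_def z_def)
  qed
  have "?P \<cong> didicosm"
  proof (rule group.presented_group_iso[OF group_didicosm, of didicosm_gen R s])
    show "didicosm_gen g \<in> carrier didicosm" for g
      by (cases g) (simp_all add: didicosm_simps)
    show "eval_word didicosm didicosm_gen l = eval_word didicosm didicosm_gen r"
      if "(l, r) \<in> R" for l r
      using that by (auto simp: R_def gen_def word_inv_def didicosm_simps inv_didicosm)
    show "s v \<in> carrier ?P" for v by (simp add: s_def split: prod.split)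
    show "s \<one>\<^bsub>didicosm\<^esub> = word_class R []"
      by (simp add: s_def didicosm_simps N_def P.abc_power_def flip: one_presented_group)
  qed (use step didicosm_generated in auto)
  then show ?thesis by (simp add: pi1_G6_def R_def Let_def)
qed

text \<open>The normal form is \<open>x^b y^c z^a\<close>. A letter \<open>x\<close> or
  \<open>y\<close> appended on the right passes \<open>z^a\<close> at the cost of the exponent sign
  \<open>psgn a\<close>.\<close>

lemma pi1_G2_iso: "pi1_G2 \<cong> dicosm"
proof -
  define R :: "(gen3 word \<times> gen3 word) set" where
    "R = {(gen X @ gen Y @ word_inv (gen X) @ word_inv (gen Y), []),
      (word_conj (gen X) (gen Z), word_inv (gen X)),
      (word_conj (gen Y) (gen Z), word_inv (gen Y))}"
  let ?P = "presented_group R"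
  interpret P: group ?P by (rule group_presented_group)
  have cl: "word_class R w \<in> carrier ?P" for w by (simp add: carrier_presented_group)
  define x y z where "x = word_class R (gen X)" and "y = word_class R (gen Y)"
    and "z = word_class R (gen Z)"
  have [simp]: "x \<in> carrier ?P" "y \<in> carrier ?P" "z \<in> carrier ?P"
    by (simp_all add: x_def y_def z_def cl)
  have rel: "word_class R l = word_class R r" if "(l, r) \<in> R" for l r
    using word_eq.rel[OF that, of "[]" "[]"] by (simp add: word_class_eq_iff)
  have "word_class R (gen X @ gen Y @ word_inv (gen X) @ word_inv (gen Y)) = word_class R []"
    "word_class R (word_conj (gen X) (gen Z)) = word_class R (word_inv (gen X))"
    "word_class R (word_conj (gen Y) (gen Z)) = word_class R (word_inv (gen Y))"
    by (rule rel, simp add: R_def)+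
  then have rels: "x \<otimes>\<^bsub>?P\<^esub> (y \<otimes>\<^bsub>?P\<^esub> (inv\<^bsub>?P\<^esub> x \<otimes>\<^bsub>?P\<^esub> inv\<^bsub>?P\<^esub> y)) = \<one>\<^bsub>?P\<^esub>"
    "z \<otimes>\<^bsub>?P\<^esub> (x \<otimes>\<^bsub>?P\<^esub> inv\<^bsub>?P\<^esub> z) = inv\<^bsub>?P\<^esub> x"
    "z \<otimes>\<^bsub>?P\<^esub> (y \<otimes>\<^bsub>?P\<^esub> inv\<^bsub>?P\<^esub> z) = inv\<^bsub>?P\<^esub> y"
    by (simp_all add: x_def y_def z_def gen_def word_inv_def word_conj_def
        presented_group_word_mult presented_group_inv_letter flip: one_presented_group)
  have "(x \<otimes>\<^bsub>?P\<^esub> (y \<otimes>\<^bsub>?P\<^esub> (inv\<^bsub>?P\<^esub> x \<otimes>\<^bsub>?P\<^esub> inv\<^bsub>?P\<^esub> y))) \<otimes>\<^bsub>?P\<^esub> (y \<otimes>\<^bsub>?P\<^esub> x) = y \<otimes>\<^bsub>?P\<^esub> x"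
    unfolding rels(1) by simp
  moreover have "(inv\<^bsub>?P\<^esub> x \<otimes>\<^bsub>?P\<^esub> inv\<^bsub>?P\<^esub> y) \<otimes>\<^bsub>?P\<^esub> (y \<otimes>\<^bsub>?P\<^esub> x) = \<one>\<^bsub>?P\<^esub>"
    by (simp flip: P.inv_mult_group)
  ultimately have xy: "x \<otimes>\<^bsub>?P\<^esub> y = y \<otimes>\<^bsub>?P\<^esub> x"
    by (simp add: P.m_assoc)
  have zx: "z \<otimes>\<^bsub>?P\<^esub> x = inv\<^bsub>?P\<^esub> x \<otimes>\<^bsub>?P\<^esub> z" "z \<otimes>\<^bsub>?P\<^esub> y = inv\<^bsub>?P\<^esub> y \<otimes>\<^bsub>?P\<^esub> z"
    by (simp_all add: P.m_assoc flip: rels(2,3))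
  define s where "s = (\<lambda>(a, b, c). P.abc_power x y z b c a)"
  note yx = P.int_pow_commute[OF xy]
  have step: "s (v \<otimes>\<^bsub>dicosm\<^esub> dicosm_gen g) = s v \<otimes>\<^bsub>?P\<^esub> word_class R (gen g)" for v g
  proof -
    obtain a b c where v: "v = (a, b, c)" by (cases v)
    have 1: "z [^]\<^bsub>?P\<^esub> a \<otimes>\<^bsub>?P\<^esub> x = x [^]\<^bsub>?P\<^esub> psgn a \<otimes>\<^bsub>?P\<^esub> z [^]\<^bsub>?P\<^esub> a"
      "z [^]\<^bsub>?P\<^esub> a \<otimes>\<^bsub>?P\<^esub> y = y [^]\<^bsub>?P\<^esub> psgn a \<otimes>\<^bsub>?P\<^esub> z [^]\<^bsub>?P\<^esub> a"
      using P.conj_inv_power[OF zx(1), of a 1] P.conj_inv_power[OF zx(2), of a 1] by simp_all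
    have "y [^]\<^bsub>?P\<^esub> c \<otimes>\<^bsub>?P\<^esub> (x [^]\<^bsub>?P\<^esub> psgn a \<otimes>\<^bsub>?P\<^esub> z [^]\<^bsub>?P\<^esub> a) =
        x [^]\<^bsub>?P\<^esub> psgn a \<otimes>\<^bsub>?P\<^esub> (y [^]\<^bsub>?P\<^esub> c \<otimes>\<^bsub>?P\<^esub> z [^]\<^bsub>?P\<^esub> a)"
      using yx[of "psgn a" c] by (simp flip: P.m_assoc)
    then show ?thesis
      by (cases g) (simp_all add: v s_def dicosm_simps P.abc_power_def P.m_assoc 1 P.int_pow_mult
          flip: x_def y_def z_def)
  qed
  have "?P \<cong> dicosm"
  proof (rule group.presented_group_iso[OF group_dicosm, of dicosm_gen R s])
    show "dicosm_gen g \<in> carrier dicosm" for g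
      by (simp add: dicosm_simps)
    show "eval_word dicosm dicosm_gen l = eval_word dicosm dicosm_gen r" if "(l, r) \<in> R" for l r
      using that by (auto simp: R_def gen_def word_inv_def word_conj_def dicosm_simps inv_dicosm)
    show "s v \<in> carrier ?P" for v by (simp add: s_def P.abc_power_def split: prod.split)
    show "s \<one>\<^bsub>dicosm\<^esub> = word_class R []"
      by (simp add: s_def dicosm_simps P.abc_power_def flip: one_presented_group)
  qed (use step dicosm_generated in auto)
  then show ?thesis by (simp add: pi1_G2_def R_def Let_def)
qed

section \<open>Indices and numbers of orbits\<close>

context group
begin

text \<open>Every index below is read off an explicit fundamental domain \<open>S\<close> by this
  lemma.\<close>

lemma card_rcosets_transversal:
  assumes K: "subgroup K G" and S: "S \<subseteq> carrier G"
    and cover: "\<And>v. v \<in> carrier G \<Longrightarrow> \<exists>s\<in>S. \<exists>k\<in>K. v = k \<otimes> s"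
    and uniq: "\<And>s s' k. s \<in> S \<Longrightarrow> s' \<in> S \<Longrightarrow> k \<in> K \<Longrightarrow> s = k \<otimes> s' \<Longrightarrow> s = s'"
  shows "card (rcosets K) = card S"
proof -
  have "rcosets K = (\<lambda>s. K #> s) ` S"
  proof
    show "rcosets K \<subseteq> (\<lambda>s. K #> s) ` S"
    proof
      fix A assume "A \<in> rcosets K"
      then obtain v where v: "v \<in> carrier G" "A = K #> v" by (auto simp: RCOSETS_def)
      then obtain s k where "s \<in> S" "k \<in> K" "v = k \<otimes> s" using cover by blast
      then have "A = K #> s"
        using v K S by (metis repr_independence rcosI subgroup.subset subset_iff)
      then show "A \<in> (\<lambda>s. K #> s) ` S" using \<open>s \<in> S\<close> by blast
    qed
    show "(\<lambda>s. K #> s) ` S \<subseteq> rcosets K" using S by (auto simp: RCOSETS_def)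
  qed
  moreover have "inj_on (\<lambda>s. K #> s) S"
  proof (rule inj_onI)
    fix s s' assume s: "s \<in> S" "s' \<in> S" "K #> s = K #> s'"
    then have "s \<in> K #> s'" using rcos_self[OF _ K] S by auto
    then show "s = s'" using uniq s(1,2) by (auto simp: r_coset_def)
  qed
  ultimately show ?thesis by (simp add: card_image)
qed

text \<open>By the pigeonhole principle two powers of \<open>g\<close> share a coset, and their
  quotient is the power sought.\<close>

lemma finite_index_pow_mem:
  assumes K: "subgroup K G" and "card (rcosets K) > 0" and g: "g \<in> carrier G"
  obtains n :: nat where "n > 0" "g [^] n \<in> K"
proof -
  have "finite (rcosets K)" using assms(2) by (rule card_ge_0_finite)
  moreover have "range (\<lambda>n :: nat. K #> g [^] n) \<subseteq> rcosets K"
    using g by (auto simp: RCOSETS_def)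
  ultimately have "\<not> inj (\<lambda>n :: nat. K #> g [^] n)"
    by (meson finite_imageD finite_subset infinite_UNIV_nat)
  then obtain m n :: nat where mn: "m < n" "K #> g [^] m = K #> g [^] n"
    by (metis (mono_tags, lifting) injI nat_neq_iff)
  then have "g [^] n \<in> K #> g [^] m" using rcos_self[OF _ K, of "g [^] n"] g by simp
  then obtain k where k: "k \<in> K" "g [^] n = k \<otimes> g [^] m" by (auto simp: r_coset_def)
  have "g [^] n = g [^] (n - m) \<otimes> g [^] m" using mn(1) g by (simp add: nat_pow_mult)
  then have "k = g [^] (n - m)"
    using k g subgroup.mem_carrier[OF K k(1)] by (metis nat_pow_closed right_cancel)
  then show thesis using that[of "n - m"] mn(1) k(1) by simp
qed

end

text \<open>Burnside's lemma without a named group: \<open>f q\<close> is the orbit,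
  \<open>w q\<close> the order of the stabiliser, \<open>N\<close> the group order, and the last
  hypothesis is the orbit-stabiliser theorem.\<close>

lemma card_partition_weighted:
  fixes w :: "'a \<Rightarrow> nat"
  assumes "finite S"
    and part: "\<And>q. q \<in> S \<Longrightarrow> q \<in> f q" "\<And>q. q \<in> S \<Longrightarrow> f q \<subseteq> S"
      "\<And>q r. q \<in> S \<Longrightarrow> r \<in> f q \<Longrightarrow> f r = f q"
    and w: "\<And>q. q \<in> S \<Longrightarrow> card (f q) * w q = N"
  shows "N * card (f ` S) = sum w S"
proof -
  have "sum w S = (\<Sum>A\<in>f ` S. \<Sum>q | q \<in> S \<and> f q = A. w q)"
    by (rule sum.image_gen) fact
  also have "\<dots> = (\<Sum>A\<in>f ` S. N)"
  proof (rule sum.cong)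
    fix A assume "A \<in> f ` S"
    then obtain q where q: "q \<in> S" "A = f q" by blast
    have "{r. r \<in> S \<and> f r = A} = A" using part q by blast
    moreover have "w r = w q" if "r \<in> A" for r
    proof -
      have "r \<in> S" "f r = A" using that q part by blast+
      then have "card A * w r = card A * w q" using w[of r] w[of q] q by simp
      moreover have "card A > 0"
      proof -
        have "A \<subseteq> S" "q \<in> A" using part(1,2)[OF q(1)] q(2) by auto
        then show ?thesis using \<open>finite S\<close> by (metis card_gt_0_iff empty_iff finite_subset)
      qed
      ultimately show ?thesis by simp
    qed
    ultimately show "(\<Sum>q | q \<in> S \<and> f q = A. w q) = N" using w[of q] q by simp
  qed simp
  finally show ?thesis by simp
qed

text \<open>This replaces the counting of conjugacy classes by the counting of values of a complete
  invariant.\<close>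

lemma card_image_eq_iff:
  assumes "\<And>x y. x \<in> S \<Longrightarrow> y \<in> S \<Longrightarrow> f x = f y \<longleftrightarrow> g x = g y"
  shows "card (f ` S) = card (g ` S)"
proof -
  have "bij_betw (\<lambda>a. g (inv_into S f a)) (f ` S) (g ` S)"
  proof (rule bij_betw_imageI)
    have *: "g (inv_into S f (f x)) = g x" if "x \<in> S" for x
      using that assms by (metis f_inv_into_f imageI inv_into_into)
    then show "inj_on (\<lambda>a. g (inv_into S f a)) (f ` S)"
      using assms by (auto simp: inj_on_def)
    show "(\<lambda>a. g (inv_into S f a)) ` f ` S = g ` S"
      by (simp add: image_image * cong: image_cong)
  qed
  then show ?thesis by (rule bij_betw_same_card)
qed

section \<open>Lattices in the plane\<close>

lemma int_subgroup_multiples: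
  fixes I :: "int set"
  assumes diff: "\<And>x y. x \<in> I \<Longrightarrow> y \<in> I \<Longrightarrow> x - y \<in> I" and "n \<in> I" "n \<noteq> 0"
  obtains k :: nat where "k > 0" "I = {x. int k dvd x}"
proof -
  have zero: "0 \<in> I" using diff[of n n] assms(2) by simp
  have neg: "- x \<in> I" if "x \<in> I" for x using diff[OF zero that] by simp
  have add: "x + y \<in> I" if "x \<in> I" "y \<in> I" for x y using diff[OF that(1) neg[OF that(2)]] by simp
  define k where "k = (LEAST k :: nat. k > 0 \<and> int k \<in> I)"
  have "nat \<bar>n\<bar> > 0 \<and> int (nat \<bar>n\<bar>) \<in> I" using assms(2,3) neg by (auto simp: abs_if)
  then have k: "k > 0" "int k \<in> I" unfolding k_def by (rule LeastI2; blast)+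
  have mult: "int k * i \<in> I" for i
  proof (induction i rule: int_induct[of _ 0])
    case (step1 i) then show ?case using add[OF step1(2) k(2)] by (simp add: distrib_left)
  next
    case (step2 i) then show ?case using diff[OF step2(2) k(2)] by (simp add: right_diff_distrib)
  qed (simp add: zero)
  have "int k dvd x" if x: "x \<in> I" for x
  proof (rule ccontr)
    assume "\<not> int k dvd x"
    then have "x mod int k \<noteq> 0" by (simp add: dvd_eq_mod_eq_0)
    then have 1: "x mod int k > 0" "x mod int k < int k"
      using k(1) by (simp_all add: le_neq_trans)
    have "x mod int k = x - int k * (x div int k)" by (simp add: minus_mult_div_eq_mod)
    then have "x mod int k \<in> I" using diff[OF x mult] by simp
    then have "nat (x mod int k) > 0 \<and> int (nat (x mod int k)) \<in> I" using 1 by simp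
    then have "k \<le> nat (x mod int k)"
      unfolding k_def by (rule Least_le)
    then show False using 1 by linarith
  qed
  then show thesis using that[OF k(1)] mult by (auto elim: dvdE)
qed

definition lattice2 :: "(int \<times> int) set \<Rightarrow> bool" where
  "lattice2 M \<longleftrightarrow> (0, 0) \<in> M \<and>
    (\<forall>p q p' q'. (p, q) \<in> M \<longrightarrow> (p', q') \<in> M \<longrightarrow> (p - p', q - q') \<in> M)"

lemma lattice2_zero: "lattice2 M \<Longrightarrow> (0, 0) \<in> M"
  by (simp add: lattice2_def)

lemma lattice2_diff: "lattice2 M \<Longrightarrow> (p, q) \<in> M \<Longrightarrow> (p', q') \<in> M \<Longrightarrow> (p - p', q - q') \<in> M"
  by (simp add: lattice2_def)

lemma lattice2_minus: "lattice2 M \<Longrightarrow> (p, q) \<in> M \<Longrightarrow> (- p, - q) \<in> M"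
  using lattice2_diff[OF _ lattice2_zero] by fastforce

lemma lattice2_minus_iff: "lattice2 M \<Longrightarrow> (- p, - q) \<in> M \<longleftrightarrow> (p, q) \<in> M"
  using lattice2_minus[of M p q] lattice2_minus[of M "- p" "- q"] by auto

lemma lattice2_add: "lattice2 M \<Longrightarrow> (p, q) \<in> M \<Longrightarrow> (p', q') \<in> M \<Longrightarrow> (p + p', q + q') \<in> M"
  using lattice2_diff[OF _ _ lattice2_minus] by fastforce

lemma lattice2_mult: "lattice2 M \<Longrightarrow> (p, q) \<in> M \<Longrightarrow> (i * p, i * q) \<in> M"
proof (induction i rule: int_induct[of _ 0])
  case (step1 i)
  then show ?case using lattice2_add[of M "i * p" "i * q" p q] by (simp add: distrib_right)
next
  case (step2 i)
  then show ?case using lattice2_diff[of M "i * p" "i * q" p q] by (simp add: left_diff_distrib)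
qed (simp add: lattice2_zero)

text \<open>The row span of the triangular matrix with rows \<open>(b, z)\<close> and
  \<open>(0, c)\<close>, which is in Hermite normal form when \<open>z < c\<close>.\<close>

definition lat2 :: "nat \<Rightarrow> nat \<Rightarrow> nat \<Rightarrow> (int \<times> int) set" where
  "lat2 b z c = {(int b * i, int z * i + int c * j) | i j. True}"

lemma lat2I: "(int b * i, int z * i + int c * j) \<in> lat2 b z c"
  by (auto simp: lat2_def)

lemma lattice2_lat2: "lattice2 (lat2 b z c)"
proof -
  have "(int b * i - int b * i', (int z * i + int c * j) - (int z * i' + int c * j')) \<in> lat2 b z c"
    for i i' j j'
    using lat2I[of b "i - i'" z c "j - j'"] by (simp add: algebra_simps)
  moreover have "(0, 0) \<in> lat2 b z c" using lat2I[of b 0 z c 0] by simp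
  ultimately show ?thesis unfolding lattice2_def by (auto simp: lat2_def)
qed

lemma lat2_iff:
  "b > 0 \<Longrightarrow> (int b * i, q) \<in> lat2 b z c \<longleftrightarrow> int c dvd q - int z * i"
  by (auto simp: lat2_def dvd_def algebra_simps)

lemma lat2_0_iff: "b > 0 \<Longrightarrow> (0, q) \<in> lat2 b z c \<longleftrightarrow> int c dvd q"
  using lat2_iff[of b 0 q z c] by simp

lemma lat2_fst_dvd: "(p, q) \<in> lat2 b z c \<Longrightarrow> int b dvd p"
  by (auto simp: lat2_def)

lemma int_less_eq_of_dvd_diff:
  assumes "int b dvd int p - int p'" "p < b" "p' < b"
  shows "p = p'"
  using assms by (metis mod_eq_dvd_iff mod_less of_nat_eq_iff zmod_int)

lemma lat2_reduce_unique:
  assumes "b > 0" "(int p - int p', int q - int q') \<in> lat2 b z c"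
    and "p < b" "p' < b" "q < c" "q' < c"
  shows "p = p' \<and> q = q'"
proof -
  have "p = p'" using lat2_fst_dvd[OF assms(2)] assms(3,4) by (rule int_less_eq_of_dvd_diff)
  moreover from this have "int c dvd int q - int q'" using assms(1,2) by (simp add: lat2_0_iff)
  ultimately show ?thesis using assms(5,6) int_less_eq_of_dvd_diff by simp
qed

text \<open>Division with remainder, first by the row \<open>(b, z)\<close> and then by
  \<open>(0, c)\<close>: the box with sides \<open>b\<close> and \<open>c\<close> represents the
  quotient of the plane by the lattice.\<close>

lemma lat2_reduce:
  assumes "b > 0" "c > 0"
  obtains p' q' where "p' < b" "q' < c" "(p - int p', q - int q') \<in> lat2 b z c"
proof -
  define i where "i = p div int b"
  define r where "r = q - int z * i"
  define p' q' where "p' = nat (p mod int b)" and "q' = nat (r mod int c)"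
  have p': "int p' = p - int b * i" using assms by (simp add: p'_def i_def minus_mult_div_eq_mod)
  have q': "int q' = r - int c * (r div int c)"
    using assms by (simp add: q'_def minus_mult_div_eq_mod)
  have "(p - int p', q - int q') = (int b * i, int z * i + int c * (r div int c))"
    by (simp add: p' q') (simp add: r_def)
  then have "(p - int p', q - int q') \<in> lat2 b z c" by (simp only: lat2I)
  moreover have "p' < b" "q' < c"
    using assms by (simp_all add: p'_def q'_def nat_less_iff)
  ultimately show thesis using that by blast
qed

lemma multiples_eq_imp_eq:
  assumes "{x. int k dvd x} = {x. int l dvd x}"
  shows "k = l"
proof -
  have "int k dvd int l" "int l dvd int k" using assms by (metis dvd_refl mem_Collect_eq)+
  then show ?thesis by (simp add: dvd_antisym)
qed

text \<open>The normal form can be recovered: \<open>b\<close> generates the first coordinates,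
  \<open>c\<close> generates the lattice vectors on the second axis, and \<open>z\<close> is then
  fixed modulo \<open>c\<close>.\<close>

lemma lat2_inj:
  assumes "b > 0" "b' > 0" "z < c" "z' < c'" and eq: "lat2 b z c = lat2 b' z' c'"
  shows "b = b' \<and> z = z' \<and> c = c'"
proof -
  have fst: "fst ` lat2 d y e = {x. int d dvd x}" for d y e
    by (auto simp: lat2_def dvd_def image_iff; blast)
  have b: "b = b'" using fst eq by (metis multiples_eq_imp_eq)
  have "{x. int c dvd x} = {x. int c' dvd x}"
    using lat2_0_iff[of b _ z c] lat2_0_iff[of b' _ z' c'] assms(1,2) eq by simp
  then have c: "c = c'" by (rule multiples_eq_imp_eq)
  have "(int b * 1, int z * 1 + int c * 0) \<in> lat2 b' z' c'" using lat2I eq by blast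
  then have "int c dvd int z - int z'" using assms(2) lat2_iff[of b' 1] b c by simp
  then show ?thesis using b c assms(3,4) int_less_eq_of_dvd_diff by simp
qed

text \<open>The two axis vectors force full rank, so the projection to the first axis and the part
  on the second axis are both nonzero. They are generated by \<open>b\<close> and \<open>c\<close>,
  and \<open>z\<close> is the second coordinate of a vector over \<open>b\<close>, reduced modulo
  \<open>c\<close>.\<close>

lemma lattice2_eq_lat2:
  assumes M: "lattice2 M" and "(m, 0) \<in> M" "(0, n) \<in> M" "m \<noteq> 0" "n \<noteq> 0"
  obtains b z c where "b > 0" "z < c" "M = lat2 b z c"
proof -
  have "x - y \<in> fst ` M" if "x \<in> fst ` M" "y \<in> fst ` M" for x y
    using that lattice2_diff[OF M] by (force simp: image_iff)
  moreover have "m \<in> fst ` M" using assms(2) by force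
  ultimately obtain b where b: "b > 0" "fst ` M = {x. int b dvd x}"
    using assms(4) int_subgroup_multiples by metis
  have "x - y \<in> {q. (0, q) \<in> M}" if "x \<in> {q. (0, q) \<in> M}" "y \<in> {q. (0, q) \<in> M}" for x y
    using that lattice2_diff[OF M, of 0 x 0 y] by simp
  moreover have "n \<in> {q. (0, q) \<in> M}" using assms(3) by simp
  ultimately obtain c where c: "c > 0" "{q. (0, q) \<in> M} = {x. int c dvd x}"
    using assms(5) int_subgroup_multiples by metis
  have "int b \<in> fst ` M" unfolding b(2) by simp
  then obtain r where r: "(int b, r) \<in> M" by auto
  define z where "z = nat (r mod int c)"
  have z: "int z = r - int c * (r div int c)" using c(1) by (simp add: z_def minus_mult_div_eq_mod)
  have c_iff: "(0, q) \<in> M \<longleftrightarrow> int c dvd q" for q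
    using c(2) by (metis mem_Collect_eq)
  then have c_mem: "(0, int c * j) \<in> M" for j by simp
  have bz: "(int b, int z) \<in> M"
    using lattice2_diff[OF M r c_mem, of "r div int c"] by (simp add: z)
  have "z < c" using c(1) by (simp add: z_def nat_less_iff)
  moreover have "M = lat2 b z c"
  proof
    show "lat2 b z c \<subseteq> M"
    proof
      fix v assume "v \<in> lat2 b z c"
      then obtain i j where v: "v = (int b * i, int z * i + int c * j)" by (auto simp: lat2_def)
      show "v \<in> M"
        using lattice2_add[OF M lattice2_mult[OF M bz, of i] c_mem[of j]] by (simp add: v mult.commute)
    qed
    show "M \<subseteq> lat2 b z c"
    proof
      fix v assume v: "v \<in> M"
      obtain p q where pq: "v = (p, q)" by (cases v)
      have "p \<in> fst ` M" using v pq by force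
      then obtain i where i: "p = int b * i" unfolding b(2) by (auto elim: dvdE)
      have "(0, q - int z * i) \<in> M"
        using lattice2_diff[OF M _ lattice2_mult[OF M bz, of i], of p q] v
        by (simp add: pq i mult.commute)
      then have "int c dvd q - int z * i" by (simp add: c_iff)
      then show "v \<in> lat2 b z c" using b(1) by (simp add: pq i lat2_iff)
    qed
  qed
  ultimately show thesis using that b(1) by blast
qed

section \<open>Conjugation and index in the didicosm group\<close>

text \<open>The first summands apply the linear part of \<open>(g, h, k)\<close>. The second ones
  are \<open>1 - R\<close> applied to its translation part, where \<open>R\<close> is the linear
  part of \<open>(a, b, c)\<close>.\<close>

lemma didicosm_conj:
  assumes "even (g + h + k)" "even (a + b + c)"
  shows "(g, h, k) \<otimes>\<^bsub>didicosm\<^esub> (a, b, c) \<otimes>\<^bsub>didicosm\<^esub> inv\<^bsub>didicosm\<^esub> (g, h, k) =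
    (psgn k * a + (1 - psgn c) * g, psgn g * b + (1 - psgn a) * h, psgn h * c + (1 - psgn b) * k)"
  using assms by (auto simp: inv_didicosm didicosm_simps psgn_def)

lemma didicosm_conj_set:
  assumes "(g, h, k) \<in> carrier didicosm" "K \<subseteq> carrier didicosm"
  shows "(g, h, k) <#\<^bsub>didicosm\<^esub> K #>\<^bsub>didicosm\<^esub> inv\<^bsub>didicosm\<^esub> (g, h, k) =
    (\<lambda>(a, b, c). (psgn k * a + (1 - psgn c) * g, psgn g * b + (1 - psgn a) * h,
      psgn h * c + (1 - psgn b) * k)) ` K" (is "?L = ?f ` K")
proof -
  have "?L = (\<lambda>v. (g, h, k) \<otimes>\<^bsub>didicosm\<^esub> v \<otimes>\<^bsub>didicosm\<^esub> inv\<^bsub>didicosm\<^esub> (g, h, k)) ` K"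
    unfolding l_coset_def r_coset_def by blast
  also have "\<dots> = ?f ` K"
  proof (rule image_cong)
    fix v assume v: "v \<in> K"
    obtain a b c where abc: "v = (a, b, c)" by (cases v)
    have "v \<in> carrier didicosm" using v assms(2) by blast
    then show "(g, h, k) \<otimes>\<^bsub>didicosm\<^esub> v \<otimes>\<^bsub>didicosm\<^esub> inv\<^bsub>didicosm\<^esub> (g, h, k) = ?f v"
      using assms(1) didicosm_conj[of g h k a b c] by (simp only: abc didicosm_simps(1) prod.case)
  qed simp
  finally show ?thesis .
qed

text \<open>The third side has even length, so each pair \<open>(u, v)\<close> admits exactly
  \<open>c\<close> values of \<open>w\<close> with the right parity.\<close>

lemma card_even_box:
  "card {(u, v, w). even (u + v + w) \<and> 0 \<le> u \<and> u < int m \<and> 0 \<le> v \<and> v < int n \<and>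
     0 \<le> w \<and> w < 2 * int c} = m * n * c" (is "card ?S = _")
proof -
  let ?f = "\<lambda>(u :: int, v, l). (u, v, 2 * l + (u + v) mod 2)"
  have "?S = ?f ` ({0..<int m} \<times> {0..<int n} \<times> {0..<int c})"
  proof
    show "?S \<subseteq> ?f ` ({0..<int m} \<times> {0..<int n} \<times> {0..<int c})"
    proof
      fix s assume "s \<in> ?S"
      then obtain u v w where s: "s = (u, v, w)" "even (u + v + w)" "0 \<le> u" "u < int m"
        "0 \<le> v" "v < int n" "0 \<le> w" "w < 2 * int c" by auto
      have "w = 2 * (w div 2) + (u + v) mod 2" using s(2) by presburger
      then have "s = ?f (u, v, w div 2)" by (simp add: s(1))
      moreover have "(u, v, w div 2) \<in> {0..<int m} \<times> {0..<int n} \<times> {0..<int c}" using s by auto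
      ultimately show "s \<in> ?f ` ({0..<int m} \<times> {0..<int n} \<times> {0..<int c})" by blast
    qed
    show "?f ` ({0..<int m} \<times> {0..<int n} \<times> {0..<int c}) \<subseteq> ?S"
      by auto
  qed
  moreover have "inj_on ?f ({0..<int m} \<times> {0..<int n} \<times> {0..<int c})"
    by (auto simp: inj_on_def)
  ultimately show ?thesis by (simp add: card_image)
qed

lemma abs_less_dvd_imp_0:
  fixes p :: int
  assumes "int b dvd p" "\<bar>p\<bar> < int b"
  shows "p = 0"
  using assms zdvd_imp_le[of "int b" "\<bar>p\<bar>"] by fastforce

section \<open>Subgroups of translations\<close>

definition transl :: "(int \<times> int \<times> int) set" where
  "transl = {(a, b, c). even a \<and> even b \<and> even c}"

lemma translI [simp]: "(2 * i, 2 * j, 2 * k) \<in> transl"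
  by (simp add: transl_def)

lemma transl_mult:
  "(a, b, c) \<in> transl \<Longrightarrow> (a, b, c) \<otimes>\<^bsub>didicosm\<^esub> (a', b', c') = (a + a', b + b', c + c')"
  by (simp add: didicosm_simps transl_def)

lemma transl_inv: "(a, b, c) \<in> transl \<Longrightarrow> inv\<^bsub>didicosm\<^esub> (a, b, c) = (- a, - b, - c)"
  by (simp add: inv_didicosm transl_def)

lemma transl_subset: "transl \<subseteq> carrier didicosm"
  by (auto simp: transl_def didicosm_simps)

lemma transl_pow:
  "(2 * a, 2 * b, 2 * c) [^]\<^bsub>didicosm\<^esub> n = (2 * (int n * a), 2 * (int n * b), 2 * (int n * c))"
proof (induction n)
  case 0
  show ?case by (simp add: didicosm_simps)
next
  case (Suc n)
  then show ?case by (simp add: didicosm_simps algebra_simps)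
qed

lemma subgroup_transl_add:
  "subgroup K didicosm \<Longrightarrow> (2 * a, 2 * b, 2 * c) \<in> K \<Longrightarrow> (a', b', c') \<in> K \<Longrightarrow>
    (2 * a + a', 2 * b + b', 2 * c + c') \<in> K"
  using subgroup.m_closed[of K didicosm "(2 * a, 2 * b, 2 * c)" "(a', b', c')"]
  by (simp add: transl_mult)

lemma subgroup_transl_minus:
  "subgroup K didicosm \<Longrightarrow> (2 * a, 2 * b, 2 * c) \<in> K \<Longrightarrow> (2 * (- a), 2 * (- b), 2 * (- c)) \<in> K"
  using subgroup.m_inv_closed[of K didicosm "(2 * a, 2 * b, 2 * c)"]
  by (simp add: transl_inv)

lemma subgroup_transl_diff:
  assumes "subgroup K didicosm" "(2 * a, 2 * b, 2 * c) \<in> K" "(2 * a', 2 * b', 2 * c') \<in> K"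
  shows "(2 * (a - a'), 2 * (b - b'), 2 * (c - c')) \<in> K"
  using subgroup_transl_add[OF assms(1) subgroup_transl_minus[OF assms(1,3)] assms(2)]
  by (simp add: right_diff_distrib)

lemma subgroup_transl_mult:
  assumes K: "subgroup K didicosm" and v: "(2 * a, 2 * b, 2 * c) \<in> K"
  shows "(2 * (i * a), 2 * (i * b), 2 * (i * c)) \<in> K"
proof (induction i rule: int_induct[of _ 0])
  case base
  then show ?case using subgroup.one_closed[OF K] by (simp add: didicosm_simps)
next
  case (step1 i)
  then show ?case using subgroup_transl_add[OF K v step1(2)] by (simp add: algebra_simps)
next
  case (step2 i)
  then show ?case using subgroup_transl_diff[OF K step2(2) v] by (simp add: left_diff_distrib)
qed

lemma subgroup_didicosm_lattice2:
  assumes K: "subgroup K didicosm"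
  shows "lattice2 {(p, q). (0, 2 * p, 2 * q) \<in> K}"
  using subgroup.one_closed[OF K] subgroup_transl_diff[OF K, of 0 _ _ 0]
  by (auto simp: lattice2_def didicosm_simps)

lemma finite_index_transl:
  assumes "subgroup K didicosm" "card (rcosets\<^bsub>didicosm\<^esub> K) > 0"
  obtains n :: int where "n \<noteq> 0" "(2 * (n * a), 2 * (n * b), 2 * (n * c)) \<in> K"
proof -
  obtain n :: nat where "n > 0" "(2 * a, 2 * b, 2 * c) [^]\<^bsub>didicosm\<^esub> n \<in> K"
    using group.finite_index_pow_mem[OF group_didicosm assms, of "(2 * a, 2 * b, 2 * c)"]
    by (auto simp: didicosm_simps)
  then show thesis using that[of "int n"] by (simp add: transl_pow)
qed

text \<open>Finite index puts a nonzero multiple of each axis vector into \<open>K\<close>, so the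
  plane lattice has full rank.\<close>

lemma finite_index_lat2:
  assumes K: "subgroup K didicosm" "card (rcosets\<^bsub>didicosm\<^esub> K) > 0"
  obtains b z c where "b > 0" "z < c" "{(p, q). (0, 2 * p, 2 * q) \<in> K} = lat2 b z c"
proof -
  obtain m n where m: "m \<noteq> 0" "(2 * (m * 0), 2 * (m * 1), 2 * (m * 0)) \<in> K"
    and n: "n \<noteq> 0" "(2 * (n * 0), 2 * (n * 0), 2 * (n * 1)) \<in> K"
    using finite_index_transl[OF K] by metis
  show thesis
    by (rule lattice2_eq_lat2[OF subgroup_didicosm_lattice2[OF K(1)], of m n])
      (use m n that in auto)
qed

text \<open>\<open>tlat (a, b, c) (x, y, z)\<close> is twice the lattice with Hermite normal form
  \<open>(a, x, y), (0, b, z), (0, 0, c)\<close>.\<close>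

definition tlat :: "nat \<times> nat \<times> nat \<Rightarrow> nat \<times> nat \<times> nat \<Rightarrow> (int \<times> int \<times> int) set" where
  "tlat = (\<lambda>(a, b, c) (x, y, z). {(2 * (int a * i), 2 * p, 2 * q) | i p q.
    (p - int x * i, q - int y * i) \<in> lat2 b z c})"

lemma tlat_iff:
  assumes "a > 0"
  shows "(2 * (int a * i), 2 * p, 2 * q) \<in> tlat (a, b, c) (x, y, z) \<longleftrightarrow>
    (p - int x * i, q - int y * i) \<in> lat2 b z c"
  using assms by (auto simp: tlat_def)

lemma tlatE:
  assumes "v \<in> tlat (a, b, c) (x, y, z)"
  obtains i p q where "v = (2 * (int a * i), 2 * p, 2 * q)" "(p - int x * i, q - int y * i) \<in> lat2 b z c"
  using assms by (auto simp: tlat_def)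

lemma tlat_transl: "tlat (a, b, c) (x, y, z) \<subseteq> transl"
  by (auto simp: tlat_def transl_def)

lemma subgroup_tlat:
  assumes "a > 0"
  shows "subgroup (tlat (a, b, c) (x, y, z)) didicosm" (is "subgroup ?K _")
proof (rule group.subgroupI[OF group_didicosm])
  show "?K \<subseteq> carrier didicosm" using tlat_transl transl_subset by blast
  show "?K \<noteq> {}"
    using tlat_iff[OF assms, of 0 0 0 b c x y z] lattice2_zero[OF lattice2_lat2] by auto
  fix u assume "u \<in> ?K"
  then obtain i p q where u: "u = (2 * (int a * i), 2 * p, 2 * q)"
    "(p - int x * i, q - int y * i) \<in> lat2 b z c" by (rule tlatE)
  have "(- p - int x * (- i), - q - int y * (- i)) \<in> lat2 b z c"
    using lattice2_minus[OF lattice2_lat2 u(2)] by simp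
  then have "(2 * (int a * - i), 2 * - p, 2 * - q) \<in> ?K" by (simp only: tlat_iff[OF assms])
  then show "inv\<^bsub>didicosm\<^esub> u \<in> ?K" by (simp add: u transl_inv)
  fix v assume "v \<in> ?K"
  then obtain i' p' q' where v: "v = (2 * (int a * i'), 2 * p', 2 * q')"
    "(p' - int x * i', q' - int y * i') \<in> lat2 b z c" by (rule tlatE)
  have "((p + p') - int x * (i + i'), (q + q') - int y * (i + i')) \<in> lat2 b z c"
    using lattice2_add[OF lattice2_lat2 u(2) v(2)] by (simp add: algebra_simps)
  then have "(2 * (int a * (i + i')), 2 * (p + p'), 2 * (q + q')) \<in> ?K"
    by (simp only: tlat_iff[OF assms])
  then show "u \<otimes>\<^bsub>didicosm\<^esub> v \<in> ?K" by (simp add: u v transl_mult distrib_left)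
qed

text \<open>The box with sides \<open>2 * a\<close>, \<open>2 * b\<close>, \<open>2 * c\<close> is a
  fundamental domain of the doubled lattice in Z^3, and the parity condition keeps half of its
  points.\<close>

lemma index_tlat:
  assumes "a > 0" "b > 0" "c > 0"
  shows "card (rcosets\<^bsub>didicosm\<^esub> (tlat (a, b, c) (x, y, z))) = 4 * (a * b * c)"
proof -
  let ?K = "tlat (a, b, c) (x, y, z)"
  let ?S = "{(u, v, w). even (u + v + w) \<and> 0 \<le> u \<and> u < int (2 * a) \<and> 0 \<le> v \<and> v < int (2 * b) \<and>
     0 \<le> w \<and> w < 2 * int c}"
  have "card (rcosets\<^bsub>didicosm\<^esub> ?K) = card ?S"
  proof (rule group.card_rcosets_transversal[OF group_didicosm subgroup_tlat[OF assms(1)]])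
    show "?S \<subseteq> carrier didicosm" by (auto simp: didicosm_simps)
  next
    fix v assume "v \<in> carrier didicosm"
    then obtain v1 v2 v3 where v: "v = (v1, v2, v3)" "even (v1 + v2 + v3)"
      by (cases v) (auto simp: didicosm_simps)
    define i where "i = v1 div (2 * int a)"
    obtain p q where pq: "p < b" "q < c"
      "(v2 div 2 - int x * i - int p, v3 div 2 - int y * i - int q) \<in> lat2 b z c"
      using lat2_reduce[OF assms(2,3)] by metis
    have "((v2 div 2 - int p) - int x * i, (v3 div 2 - int q) - int y * i) \<in> lat2 b z c"
      using pq(3) by (simp add: algebra_simps)
    then have k: "(2 * (int a * i), 2 * (v2 div 2 - int p), 2 * (v3 div 2 - int q)) \<in> ?K"
      by (simp only: tlat_iff[OF assms(1)])
    \<comment> \<open>The remainders modulo 2 of \<open>v2\<close> and \<open>v3\<close> are set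
      aside first, because the doubled lattice absorbs only even vectors.\<close>
    define s where "s = (v1 mod (2 * int a), 2 * int p + v2 mod 2, 2 * int q + v3 mod 2)"
    have v1: "2 * (int a * i) + v1 mod (2 * int a) = v1"
      using mult_div_mod_eq[of "2 * int a" v1] by (simp only: i_def mult.assoc)
    have "v = (2 * (int a * i), 2 * (v2 div 2 - int p), 2 * (v3 div 2 - int q)) \<otimes>\<^bsub>didicosm\<^esub> s"
      by (simp add: didicosm_simps s_def v(1) v1)
    moreover have "s \<in> ?S"
    proof -
      have "even (v1 mod (2 * int a) + v2 + v3)"
        using v(2) by (subst (asm) v1[symmetric]) simp
      then show ?thesis using pq(1,2) assms(1) by (auto simp: s_def)
    qed
    ultimately show "\<exists>s\<in>?S. \<exists>k\<in>?K. v = k \<otimes>\<^bsub>didicosm\<^esub> s" using k by blast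
  next
    fix s s' k assume s: "s \<in> ?S" "s' \<in> ?S" and k: "k \<in> ?K" and eq: "s = k \<otimes>\<^bsub>didicosm\<^esub> s'"
    obtain i p q where ipq: "k = (2 * (int a * i), 2 * p, 2 * q)"
      "(p - int x * i, q - int y * i) \<in> lat2 b z c" using k by (rule tlatE)
    obtain u v w where s': "s' = (u, v, w)" by (cases s')
    have "s = (2 * (int a * i) + u, 2 * p + v, 2 * q + w)"
      by (simp add: eq ipq s' transl_mult)
    then have b: "\<bar>int a * i\<bar> < int a" "\<bar>p\<bar> < int b" "\<bar>q\<bar> < int c" using s s' by auto
    have "int a * i = 0" using b(1) by (intro abs_less_dvd_imp_0) auto
    then have "i = 0" using assms(1) by simp
    then have "p = 0" using b(2) ipq(2) lat2_fst_dvd by (intro abs_less_dvd_imp_0) auto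
    then have "q = 0"
      using b(3) ipq(2) \<open>i = 0\<close> assms(2) by (intro abs_less_dvd_imp_0) (auto simp: lat2_0_iff)
    show "s = s'" by (simp add: eq ipq(1) s' didicosm_simps \<open>i = 0\<close> \<open>p = 0\<close> \<open>q = 0\<close>)
  qed
  also have "\<dots> = 2 * a * (2 * b) * c" by (rule card_even_box)
  finally show ?thesis by simp
qed

text \<open>The three Hermite rows, doubled, are a basis.\<close>

lemma tlat_iso:
  assumes "a > 0" "b > 0" "c > 0"
  shows "didicosm\<lparr>carrier := tlat (a, b, c) (x, y, z)\<rparr> \<cong> pi1_G1"
proof -
  let ?K = "tlat (a, b, c) (x, y, z)"
  interpret K: group "didicosm\<lparr>carrier := ?K\<rparr>"
    by (rule subgroup.subgroup_is_group[OF subgroup_tlat[OF assms(1)] group_didicosm])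
  have Z3: "group pi1_G1"
    by (simp add: pi1_G1_def DirProd_group)
  let ?f = "\<lambda>(i, j, k). (2 * (int a * i), 2 * (int x * i + int b * j),
    2 * (int y * i + (int z * j + int c * k)))"
  have mem: "?f (i, j, k) \<in> ?K" for i j k
    using lat2I[of b j z c k] assms(1) by (simp only: prod.case, subst tlat_iff) simp_all
  have "?f \<in> hom pi1_G1 (didicosm\<lparr>carrier := ?K\<rparr>)"
  proof (rule homI)
    show "?f v \<in> carrier (didicosm\<lparr>carrier := ?K\<rparr>)" for v
      by (cases v) (use mem in auto)
    show "?f (u \<otimes>\<^bsub>pi1_G1\<^esub> v) = ?f u \<otimes>\<^bsub>didicosm\<lparr>carrier := ?K\<rparr>\<^esub> ?f v" for u v
      by (cases u; cases v) (simp add: pi1_G1_def didicosm_simps algebra_simps)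
  qed
  moreover have "bij_betw ?f (carrier pi1_G1) ?K"
  proof (rule bij_betw_imageI)
    show "inj_on ?f (carrier pi1_G1)" using assms by (auto simp: inj_on_def)
    show "?f ` carrier pi1_G1 = ?K"
    proof
      show "?f ` carrier pi1_G1 \<subseteq> ?K" using mem by auto
      show "?K \<subseteq> ?f ` carrier pi1_G1"
      proof
        fix v assume "v \<in> ?K"
        then obtain i p q where v: "v = (2 * (int a * i), 2 * p, 2 * q)"
          "(p - int x * i, q - int y * i) \<in> lat2 b z c" by (rule tlatE)
        then obtain j k where "p = int x * i + int b * j" "q = int y * i + (int z * j + int c * k)"
          by (auto simp: lat2_def) (metis add_diff_cancel_left' diff_add_cancel add.commute)
        then have "v = ?f (i, j, k)" using v by simp
        moreover have "(i, j, k) \<in> carrier pi1_G1" by (simp add: pi1_G1_def)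
        ultimately show "v \<in> ?f ` carrier pi1_G1" by blast
      qed
    qed
  qed
  ultimately have "?f \<in> iso pi1_G1 (didicosm\<lparr>carrier := ?K\<rparr>)" by (simp add: iso_def)
  then show ?thesis using group.iso_sym[OF Z3] is_isoI by blast
qed

text \<open>The Hermite argument one dimension up: \<open>a\<close> generates the halved first
  coordinates, the plane lattice is the kernel of that coordinate, and an element over
  \<open>a\<close> is reduced modulo the kernel to give \<open>x\<close> and
  \<open>y\<close>.\<close>

lemma transl_subgroup_eq_tlat:
  assumes K: "subgroup K didicosm" "card (rcosets\<^bsub>didicosm\<^esub> K) > 0" and T: "K \<subseteq> transl"
  obtains a b c x y z where "a > 0" "b > 0" "c > 0" "x < b" "y < c" "z < c"
    "K = tlat (a, b, c) (x, y, z)"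
proof -
  obtain b z c where bzc: "b > 0" "z < c" "{(p, q). (0, 2 * p, 2 * q) \<in> K} = lat2 b z c"
    using finite_index_lat2[OF K] .
  then have c: "c > 0" by simp
  have M: "(p, q) \<in> lat2 b z c \<longleftrightarrow> (0, 2 * p, 2 * q) \<in> K" for p q
    unfolding bzc(3)[symmetric] by simp
  define I where "I = {i. \<exists>p q. (2 * i, 2 * p, 2 * q) \<in> K}"
  have diff: "i - j \<in> I" if "i \<in> I" "j \<in> I" for i j
    using that subgroup_transl_diff[OF K(1)] unfolding I_def by blast
  obtain n where n: "n \<noteq> 0" "(2 * (n * 1), 2 * (n * 0), 2 * (n * 0)) \<in> K"
    using finite_index_transl[OF K] .
  have "(2 * n, 2 * 0, 2 * 0) \<in> K" using n(2) by simp
  then have "n \<in> I" unfolding I_def by blast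
  obtain a where a: "a > 0" "I = {i. int a dvd i}"
    using int_subgroup_multiples[of I n, OF diff \<open>n \<in> I\<close> n(1)] by blast
  have "int a \<in> I" by (simp add: a(2))
  then obtain p q where pq: "(2 * int a, 2 * p, 2 * q) \<in> K" by (auto simp: I_def)
  obtain x y where xy: "x < b" "y < c" "(p - int x, q - int y) \<in> lat2 b z c"
    using lat2_reduce[OF bzc(1) c] by metis
  have g: "(2 * int a, 2 * int x, 2 * int y) \<in> K"
    using subgroup_transl_diff[OF K(1) pq, of 0 "p - int x" "q - int y"] xy(3) by (simp add: M)
  have gi: "(2 * (i * int a), 2 * (i * int x), 2 * (i * int y)) \<in> K" for i
    by (rule subgroup_transl_mult[OF K(1) g])
  have iff: "(2 * (int a * i), 2 * p, 2 * q) \<in> K \<longleftrightarrow> (p - int x * i, q - int y * i) \<in> lat2 b z c"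
    for i p q
  proof
    assume "(2 * (int a * i), 2 * p, 2 * q) \<in> K"
    then show "(p - int x * i, q - int y * i) \<in> lat2 b z c"
      using subgroup_transl_diff[OF K(1) _ gi[of i], of "int a * i" p q] by (simp add: M mult.commute)
  next
    assume "(p - int x * i, q - int y * i) \<in> lat2 b z c"
    then have "(2 * 0, 2 * (p - int x * i), 2 * (q - int y * i)) \<in> K" by (simp add: M)
    from subgroup_transl_add[OF K(1) this gi[of i]]
    show "(2 * (int a * i), 2 * p, 2 * q) \<in> K" by (simp add: algebra_simps)
  qed
  have "K = tlat (a, b, c) (x, y, z)"
  proof
    show "tlat (a, b, c) (x, y, z) \<subseteq> K" by (auto simp: iff elim!: tlatE)
    show "K \<subseteq> tlat (a, b, c) (x, y, z)"
    proof
      fix v assume v: "v \<in> K"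
      then obtain i p q where v': "v = (2 * i, 2 * p, 2 * q)"
        using T by (auto simp: transl_def elim!: evenE)
      then have "i \<in> I" using v by (auto simp: I_def)
      then obtain j where "i = int a * j" unfolding a(2) by (auto elim: dvdE)
      then show "v \<in> tlat (a, b, c) (x, y, z)" using v v' by (simp add: iff tlat_iff[OF a(1)])
    qed
  qed
  then show thesis using that a(1) bzc(1,2) c xy(1,2) by blast
qed

lemma tlat_inj:
  assumes eq: "tlat (a, b, c) (x, y, z) = tlat (a', b', c') (x', y', z')"
    and pos: "a > 0" "b > 0" "a' > 0" "b' > 0" and less: "x < b" "y < c" "z < c" "x' < b'" "y' < c'" "z' < c'"
  shows "a = a' \<and> b = b' \<and> c = c' \<and> x = x' \<and> y = y' \<and> z = z'"
proof -
  have I: "int a dvd i \<longleftrightarrow> (\<exists>p q. (2 * i, 2 * p, 2 * q) \<in> tlat (a, b, c) (x, y, z))"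
    if "a > 0" for a b c x y z i
  proof
    assume "int a dvd i"
    then obtain j where j: "i = int a * j" by (elim dvdE)
    have "(int x * j - int x * j, int y * j - int y * j) \<in> lat2 b z c"
      by (simp add: lattice2_zero lattice2_lat2)
    then show "\<exists>p q. (2 * i, 2 * p, 2 * q) \<in> tlat (a, b, c) (x, y, z)"
      unfolding j tlat_iff[OF that] by blast
  qed (auto elim!: tlatE)
  have "{i. int a dvd i} = {i. int a' dvd i}"
    by (simp add: I[OF pos(1), of _ b c x y z] I[OF pos(3), of _ b' c' x' y' z'] eq)
  then have a: "a = a'" by (rule multiples_eq_imp_eq)
  have "lat2 b z c = lat2 b' z' c'"
    using tlat_iff[OF pos(1), of 0 _ _ b c x y z] tlat_iff[OF pos(3), of 0 _ _ b' c' x' y' z'] eq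
    by auto
  then have bzc: "b = b' \<and> z = z' \<and> c = c'" using lat2_inj pos less by blast
  have "(int x - int x * 1, int y - int y * 1) \<in> lat2 b z c"
    by (simp add: lattice2_zero lattice2_lat2)
  then have "(2 * (int a * 1), 2 * int x, 2 * int y) \<in> tlat (a, b, c) (x, y, z)"
    by (simp only: tlat_iff[OF pos(1)])
  then have "(int x - int x' * 1, int y - int y' * 1) \<in> lat2 b' z' c'"
    using tlat_iff[OF pos(3)] eq a by metis
  then have "(int x - int x', int y - int y') \<in> lat2 b' z' c'" by simp
  then have "x = x' \<and> y = y'"
    by (rule lat2_reduce_unique[OF pos(4)]) (use less bzc in simp_all)
  then show ?thesis using a bzc by simp
qed

section \<open>Symmetries acting on the translation subgroups\<close>

definition sign_change :: "int \<Rightarrow> int \<Rightarrow> int \<Rightarrow> int \<times> int \<times> int \<Rightarrow> int \<times> int \<times> int" where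
  "sign_change d e f = (\<lambda>(a, b, c). (d * a, e * b, f * c))"

text \<open>The cyclic shift of the axes. It respects the product because each coordinate is signed
  by the parity of its cyclic predecessor. It carries \<open>x\<close> to \<open>y\<close>,
  \<open>y\<close> to \<open>z\<close> and \<open>z\<close> to \<open>x\<close>, so that one axis
  can stand for all three.\<close>

definition rot :: "int \<times> int \<times> int \<Rightarrow> int \<times> int \<times> int" where
  "rot = (\<lambda>(a, b, c). (c, a, b))"

lemma rot_simp [simp]: "rot (a, b, c) = (c, a, b)"
  by (simp add: rot_def)

lemma rot_rot_rot: "rot ` rot ` rot ` K = K"
  by (force simp: image_image rot_def image_iff split: prod.splits)

lemma rot_iso: "rot \<in> iso didicosm didicosm"
proof (rule isoI)
  show "rot \<in> hom didicosm didicosm"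
    by (rule homI) (auto simp: didicosm_simps didicosm_def split: prod.splits)
  show "bij_betw rot (carrier didicosm) (carrier didicosm)"
    by (rule bij_betw_byWitness[of _ "\<lambda>(a, b, c). (b, c, a)"]) (auto simp: didicosm_simps)
qed

lemma sign_change_iso:
  assumes "\<bar>d\<bar> = 1" "\<bar>e\<bar> = 1" "\<bar>f\<bar> = 1"
  shows "sign_change d e f \<in> iso didicosm didicosm"
proof (rule isoI)
  have par: "even (d * a) = even a" "even (e * a) = even a" "even (f * a) = even a" for a
    using assms by (auto simp: abs_if split: if_splits)
  have sq: "d * (d * a) = a" "e * (e * a) = a" "f * (f * a) = a" for a
    using assms by (auto simp: abs_if split: if_splits)
  show "sign_change d e f \<in> hom didicosm didicosm"
    by (rule homI)
      (auto simp: sign_change_def didicosm_simps par psgn_def distrib_left simp del: even_mult_iff)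
  show "bij_betw (sign_change d e f) (carrier didicosm) (carrier didicosm)"
    by (rule bij_betw_byWitness[of _ "sign_change d e f"])
      (auto simp: sign_change_def sq didicosm_simps par simp del: even_mult_iff)
qed

text \<open>Ordered factorisations into three factors: the index set of a coefficient in a product
  of three Dirichlet series.\<close>

definition triples :: "nat \<Rightarrow> (nat \<times> nat \<times> nat) set" where
  "triples m = {(a, b, c). a * b * c = m}"

lemma finite_triples: "m > 0 \<Longrightarrow> finite (triples m)"
  by (rule finite_subset[of _ "{..m} \<times> {..m} \<times> {..m}"]) (auto simp: triples_def)

lemma triples_pos:
  assumes "(a, b, c) \<in> triples m" "m > 0"
  shows "a > 0" "b > 0" "c > 0"
  using assms by (auto simp: triples_def)

section \<open>Enumeration of the translation subgroups and of their conjugacy classes\<close>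

definition transl_subgroups :: "nat \<Rightarrow> (int \<times> int \<times> int) set set" where
  "transl_subgroups n =
    {K. subgroup K didicosm \<and> card (rcosets\<^bsub>didicosm\<^esub> K) = n \<and> K \<subseteq> transl}"

definition tlat_params :: "nat \<Rightarrow> ((nat \<times> nat \<times> nat) \<times> (nat \<times> nat \<times> nat)) set" where
  "tlat_params m = (SIGMA t:triples m. case t of (a, b, c) \<Rightarrow> {..<b} \<times> {..<c} \<times> {..<c})"

lemma finite_tlat_params: "m > 0 \<Longrightarrow> finite (tlat_params m)"
  unfolding tlat_params_def by (intro finite_SigmaI finite_triples) auto

lemma tlat_paramsE:
  assumes "tr \<in> tlat_params m" "m > 0"
  obtains a b c x y z where "tr = ((a, b, c), (x, y, z))" "a > 0" "b > 0" "c > 0"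
    "a * b * c = m" "x < b" "y < c" "z < c"
proof -
  obtain a b c x y z where tr: "tr = ((a, b, c), (x, y, z))" by (cases tr) auto
  then have t: "(a, b, c) \<in> triples m" and r: "x < b" "y < c" "z < c"
    using assms(1) by (simp_all add: tlat_params_def)
  show thesis
    by (rule that[OF tr triples_pos[OF t assms(2)] _ r]) (use t in \<open>simp add: triples_def\<close>)
qed

lemma transl_subgroups_eq:
  assumes "m > 0"
  shows "transl_subgroups (4 * m) = (\<lambda>(t, r). tlat t r) ` tlat_params m"
proof
  show "transl_subgroups (4 * m) \<subseteq> (\<lambda>(t, r). tlat t r) ` tlat_params m"
  proof
    fix K assume "K \<in> transl_subgroups (4 * m)"
    then have K: "subgroup K didicosm" "card (rcosets\<^bsub>didicosm\<^esub> K) = 4 * m" "K \<subseteq> transl"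
      by (auto simp: transl_subgroups_def)
    have pos: "card (rcosets\<^bsub>didicosm\<^esub> K) > 0" using K(2) assms by simp
    obtain a b c x y z where p: "a > 0" "b > 0" "c > 0" "x < b" "y < c" "z < c"
      "K = tlat (a, b, c) (x, y, z)"
      using transl_subgroup_eq_tlat[OF K(1) pos K(3)] .
    then have "((a, b, c), (x, y, z)) \<in> tlat_params m"
      using index_tlat[OF p(1-3), of x y z] K(2) by (simp add: tlat_params_def triples_def)
    then show "K \<in> (\<lambda>(t, r). tlat t r) ` tlat_params m" using p(7) by force
  qed
  show "(\<lambda>(t, r). tlat t r) ` tlat_params m \<subseteq> transl_subgroups (4 * m)"
  proof
    fix K assume "K \<in> (\<lambda>(t, r). tlat t r) ` tlat_params m"
    then obtain tr where tr: "tr \<in> tlat_params m" "K = (\<lambda>(t, r). tlat t r) tr" by blast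
    obtain a b c x y z where p: "tr = ((a, b, c), (x, y, z))" "a > 0" "b > 0" "c > 0" "a * b * c = m"
      using tr(1) assms by (rule tlat_paramsE)
    show "K \<in> transl_subgroups (4 * m)"
      using subgroup_tlat[OF p(2)] index_tlat[OF p(2-4)] tlat_transl
      by (simp add: tr(2) p(1,5) transl_subgroups_def)
  qed
qed

lemma transl_subgroups_dvd:
  assumes "n > 0" "\<not> 4 dvd n"
  shows "transl_subgroups n = {}"
proof (rule equals0I)
  fix K assume "K \<in> transl_subgroups n"
  then have K: "subgroup K didicosm" "card (rcosets\<^bsub>didicosm\<^esub> K) = n" "K \<subseteq> transl"
    by (auto simp: transl_subgroups_def)
  have pos: "card (rcosets\<^bsub>didicosm\<^esub> K) > 0" using K(2) assms by simp
  obtain a b c x y z where p: "a > 0" "b > 0" "c > 0" "x < b" "y < c" "z < c"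
    "K = tlat (a, b, c) (x, y, z)"
    using transl_subgroup_eq_tlat[OF K(1) pos K(3)] .
  have "n = 4 * (a * b * c)" using index_tlat[OF p(1-3), of x y z] K(2) p(7) by simp
  then show False using assms(2) by (metis dvd_triv_left)
qed

lemma tlat_params_inj:
  assumes "m > 0"
  shows "inj_on (\<lambda>(t, r). tlat t r) (tlat_params m)"
proof (rule inj_onI)
  fix u v assume uv: "u \<in> tlat_params m" "v \<in> tlat_params m"
    and eq: "(\<lambda>(t, r). tlat t r) u = (\<lambda>(t, r). tlat t r) v"
  obtain a b c x y z where u: "u = ((a, b, c), (x, y, z))" "a > 0" "b > 0" "x < b" "y < c" "z < c"
    using uv(1) assms by (rule tlat_paramsE)
  obtain a' b' c' x' y' z' where v: "v = ((a', b', c'), (x', y', z'))" "a' > 0" "b' > 0"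
    "x' < b'" "y' < c'" "z' < c'"
    using uv(2) assms by (rule tlat_paramsE)
  have "tlat (a, b, c) (x, y, z) = tlat (a', b', c') (x', y', z')"
    using eq by (simp add: u(1) v(1))
  from tlat_inj[OF this u(2,3) v(2,3) u(4-6) v(4-6)] show "u = v" by (simp add: u(1) v(1))
qed

lemma finite_transl_subgroups:
  assumes "n > 0"
  shows "finite (transl_subgroups n)"
proof (cases "4 dvd n")
  case True
  then obtain m where "n = 4 * m" by (elim dvdE)
  then show ?thesis using assms by (simp add: transl_subgroups_eq finite_tlat_params)
qed (simp add: transl_subgroups_dvd assms)

lemma card_transl_subgroups:
  assumes "m > 0"
  shows "card (transl_subgroups (4 * m)) = (\<Sum>(a, b, c)\<in>triples m. b * c * c)"
proof -
  have "card (transl_subgroups (4 * m)) = card (tlat_params m)"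
    unfolding transl_subgroups_eq[OF assms] by (rule card_image[OF tlat_params_inj[OF assms]])
  also have "\<dots> = (\<Sum>t\<in>triples m. card (case t of (a, b, c) \<Rightarrow> {..<b} \<times> {..<c} \<times> {..<c}))"
    unfolding tlat_params_def by (rule card_SigmaI) (auto simp: finite_triples assms)
  also have "\<dots> = (\<Sum>(a, b, c)\<in>triples m. b * c * c)"
    by (rule sum.cong) (auto simp: card_cartesian_product)
  finally show ?thesis .
qed

text \<open>The half turn maps the plane lattice to itself and the row \<open>(a, x, y)\<close> to
  \<open>(a, - x, - y)\<close>. The lattice is preserved exactly when the difference of these two
  rows lies in the plane lattice.\<close>

lemma half_turn_tlat:
  assumes "a > 0"
  shows "sign_change 1 (- 1) (- 1) ` tlat (a, b, c) (x, y, z) = tlat (a, b, c) (x, y, z) \<longleftrightarrow>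
    (2 * int x, 2 * int y) \<in> lat2 b z c" (is "?s ` ?K = ?K \<longleftrightarrow> _")
proof
  assume eq: "?s ` ?K = ?K"
  have "(int x - int x * 1, int y - int y * 1) \<in> lat2 b z c"
    by (simp add: lattice2_zero lattice2_lat2)
  then have "(2 * (int a * 1), 2 * int x, 2 * int y) \<in> ?K" by (simp only: tlat_iff[OF assms])
  then have "?s (2 * (int a * 1), 2 * int x, 2 * int y) \<in> ?K" using eq by blast
  then have "(2 * (int a * 1), 2 * (- int x), 2 * (- int y)) \<in> ?K" by (simp add: sign_change_def)
  then have "(- (2 * int x), - (2 * int y)) \<in> lat2 b z c" unfolding tlat_iff[OF assms] by simp
  then show "(2 * int x, 2 * int y) \<in> lat2 b z c" using lattice2_minus_iff[OF lattice2_lat2] by blast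
next
  assume xy: "(2 * int x, 2 * int y) \<in> lat2 b z c"
  have 1: "?s v \<in> ?K" if mem: "v \<in> ?K" for v
  proof -
    obtain i p q where v: "v = (2 * (int a * i), 2 * p, 2 * q)"
      "(p - int x * i, q - int y * i) \<in> lat2 b z c" using mem by (rule tlatE)
    have "(- (p - int x * i) - i * (2 * int x), - (q - int y * i) - i * (2 * int y)) \<in> lat2 b z c"
      by (intro lattice2_diff lattice2_mult lattice2_minus lattice2_lat2 v xy)
    then have "(2 * (int a * i), 2 * (- p), 2 * (- q)) \<in> ?K"
      unfolding tlat_iff[OF assms] by (simp add: algebra_simps)
    then show ?thesis by (simp add: v sign_change_def)
  qed
  have "v \<in> ?s ` ?K" if "v \<in> ?K" for v
    using 1[OF that] by (intro image_eqI[of _ _ "?s v"]) (auto simp: sign_change_def split: prod.splits)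
  then show "?s ` ?K = ?K" using 1 by blast
qed

text \<open>For fixed \<open>z\<close> the pairs \<open>(x, y)\<close> are the 2-torsion of Z^2
  modulo \<open>lat2 b z c\<close>. Write \<open>(2 x, 2 y)\<close> as \<open>i\<close> times
  \<open>(b, z)\<close> plus \<open>j\<close> times \<open>(0, c)\<close>; then \<open>x < b\<close>
  leaves \<open>i = 0\<close> or \<open>i = 1\<close>. The case \<open>i = 0\<close> gives
  \<open>x = 0\<close>, \<open>c dvd 2 * y\<close> and a free \<open>z\<close> (the set
  \<open>?B\<close>); the case \<open>i = 1\<close> gives \<open>2 * x = b\<close> and determines
  \<open>z\<close> by \<open>y\<close> (the set \<open>?C\<close>).\<close>

lemma card_half_turn_invariant:
  assumes "b > 0" "c > 0"
  shows "card {(x, y, z) \<in> {..<b} \<times> {..<c} \<times> {..<c}. (2 * int x, 2 * int y) \<in> lat2 b z c} =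
    c * (1 + of_bool (even c) + of_bool (even b))" (is "card ?A = _")
proof -
  let ?Y = "{y \<in> {..<c}. c dvd 2 * y}"
  let ?B = "{0} \<times> ?Y \<times> {..<c}"
  let ?C = "if even b then (\<lambda>y. (b div 2, y, (2 * y) mod c)) ` {..<c} else {}"
  have iff: "(2 * int x, 2 * int y) \<in> lat2 b z c \<longleftrightarrow>
      (x = 0 \<and> c dvd 2 * y) \<or> (2 * x = b \<and> z = (2 * y) mod c)"
    if "x < b" "z < c" for x y z
  proof
    assume "(2 * int x, 2 * int y) \<in> lat2 b z c"
    then obtain i j where ij: "2 * int x = int b * i" "2 * int y = int z * i + int c * j"
      by (auto simp: lat2_def)
    have "0 \<le> int b * i" "int b * i < int b * 2" using ij(1) that(1) by linarith+
    then have "0 \<le> i" "i < 2"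
      using assms(1) by (metis mult_less_cancel_left_pos of_nat_0_less_iff zero_le_mult_iff not_less,
        metis mult_less_cancel_left_pos of_nat_0_less_iff)
    then consider "i = 0" | "i = 1" by linarith
    then show "(x = 0 \<and> c dvd 2 * y) \<or> (2 * x = b \<and> z = (2 * y) mod c)"
    proof cases
      case 1
      then have "int c dvd int (2 * y)" using ij(2) by simp
      then show ?thesis using 1 ij(1) by (simp only: int_dvd_int_iff) simp
    next
      case 2
      then have "int (2 * y) mod int c = int z mod int c" using ij(2) by simp
      then have "(2 * y) mod c = z mod c" by (metis of_nat_eq_iff zmod_int)
      then show ?thesis using 2 ij(1) that(2) by simp
    qed
  next
    assume "(x = 0 \<and> c dvd 2 * y) \<or> (2 * x = b \<and> z = (2 * y) mod c)"
    then show "(2 * int x, 2 * int y) \<in> lat2 b z c"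
    proof
      assume xy: "x = 0 \<and> c dvd 2 * y"
      then have "int c dvd int (2 * y)" by (simp only: int_dvd_int_iff)
      then show ?thesis using xy assms(1) by (simp add: lat2_0_iff)
    next
      assume xy: "2 * x = b \<and> z = (2 * y) mod c"
      then have "int c dvd int (2 * y) - int z * 1"
        by (simp add: zmod_int mod_eq_dvd_iff[symmetric])
      moreover have "2 * int x = int b * 1" using xy by auto
      ultimately show ?thesis using lat2_iff[OF assms(1), of 1 "int (2 * y)" z c] by simp
    qed
  qed
  have "?A = ?B \<union> ?C"
  proof (rule Set.set_eqI)
    fix t :: "nat \<times> nat \<times> nat"
    obtain x y z where t: "t = (x, y, z)" by (cases t)
    have "t \<in> ?A \<longleftrightarrow> x < b \<and> y < c \<and> z < c \<and>
        ((x = 0 \<and> c dvd 2 * y) \<or> (2 * x = b \<and> z = (2 * y) mod c))"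
      by (cases "x < b \<and> z < c") (simp add: t iff, auto simp: t)
    then show "t \<in> ?A \<longleftrightarrow> t \<in> ?B \<union> ?C"
      using assms by (auto simp: t)
  qed
  moreover have "card ?B = (1 + of_bool (even c)) * c"
  proof -
    have "?Y = (if even c then {0, c div 2} else {0})"
    proof (rule Set.set_eqI)
      fix y
      show "y \<in> ?Y \<longleftrightarrow> y \<in> (if even c then {0, c div 2} else {0})"
      proof
        assume y: "y \<in> ?Y"
        then have "c dvd 2 * y" by simp
        then obtain j where j: "2 * y = c * j" by (elim dvdE)
        have "y < c" using y by simp
        then have "c * j < c * 2" using j by linarith
        then have "j < 2" using assms(2) by (metis mult_less_cancel1)
        then have "j = 0 \<or> j = 1" by auto
        then show "y \<in> (if even c then {0, c div 2} else {0})" using j by auto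
      qed (use assms(2) in \<open>auto split: if_splits\<close>)
    qed
    moreover have "c div 2 \<noteq> 0" if "even c" using that assms(2) by auto
    then have "card (if even c then {0, c div 2} else {0}) = 1 + of_bool (even c)" by simp
    ultimately have "card ?Y = 1 + of_bool (even c)" by (simp only:)
    then show ?thesis by (simp add: card_cartesian_product)
  qed
  moreover have "card ?C = of_bool (even b) * c"
    by (simp add: card_image inj_on_def)
  moreover have "?B \<inter> ?C = {}" using assms(1) by auto
  ultimately show ?thesis by (simp add: card_Un_disjoint algebra_simps)
qed

lemma card_half_turn_transl_subgroups:
  assumes "m > 0"
  shows "card {K \<in> transl_subgroups (4 * m). sign_change 1 (- 1) (- 1) ` K = K} =
    (\<Sum>(a, b, c)\<in>triples m. c * (1 + of_bool (even c) + of_bool (even b)))"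
proof -
  let ?P = "{(t, r). (t, r) \<in> tlat_params m \<and>
    sign_change 1 (- 1) (- 1) ` tlat t r = tlat t r}"
  let ?Q = "SIGMA t:triples m. case t of (a, b, c) \<Rightarrow>
    {(x, y, z) \<in> {..<b} \<times> {..<c} \<times> {..<c}. (2 * int x, 2 * int y) \<in> lat2 b z c}"
  have "{K \<in> transl_subgroups (4 * m). sign_change 1 (- 1) (- 1) ` K = K} = (\<lambda>(t, r). tlat t r) ` ?P"
    unfolding transl_subgroups_eq[OF assms] by auto
  then have "card {K \<in> transl_subgroups (4 * m). sign_change 1 (- 1) (- 1) ` K = K} = card ?P"
    by (auto intro!: card_image inj_on_subset[OF tlat_params_inj[OF assms]])
  also have "?P = ?Q"
  proof (rule Set.set_eqI)
    fix tr :: "(nat \<times> nat \<times> nat) \<times> (nat \<times> nat \<times> nat)"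
    obtain a b c x y z where tr: "tr = ((a, b, c), (x, y, z))" by (cases tr) auto
    show "tr \<in> ?P \<longleftrightarrow> tr \<in> ?Q"
    proof (cases "(a, b, c) \<in> triples m")
      case True
      then have "a > 0" using triples_pos assms by blast
      then show ?thesis using True by (simp add: tr half_turn_tlat tlat_params_def)
    qed (simp add: tr tlat_params_def)
  qed
  also have "card ?Q = (\<Sum>t\<in>triples m. card (case t of (a, b, c) \<Rightarrow>
    {(x, y, z) \<in> {..<b} \<times> {..<c} \<times> {..<c}. (2 * int x, 2 * int y) \<in> lat2 b z c}))"
    by (rule card_SigmaI) (auto simp: finite_triples assms intro: finite_subset[of _ "{..<_} \<times> {..<_} \<times> {..<_}"])
  also have "\<dots> = (\<Sum>(a, b, c)\<in>triples m. c * (1 + of_bool (even c) + of_bool (even b)))"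
  proof (rule sum.cong)
    fix t assume t: "t \<in> triples m"
    obtain a b c where abc: "t = (a, b, c)" by (cases t)
    then have "b > 0" "c > 0" using t triples_pos assms by blast+
    then show "card (case t of (a, b, c) \<Rightarrow>
        {(x, y, z) \<in> {..<b} \<times> {..<c} \<times> {..<c}. (2 * int x, 2 * int y) \<in> lat2 b z c}) =
      (case t of (a, b, c) \<Rightarrow> c * (1 + of_bool (even c) + of_bool (even b)))"
      by (simp only: abc prod.case card_half_turn_invariant)
  qed simp
  finally show ?thesis .
qed

text \<open>A translation has trivial linear part, so the translation part of the conjugating
  element drops out.\<close>

lemma transl_conj:
  assumes K: "K \<subseteq> transl" and g: "(g, h, k) \<in> carrier didicosm"
  shows "(g, h, k) <#\<^bsub>didicosm\<^esub> K #>\<^bsub>didicosm\<^esub> inv\<^bsub>didicosm\<^esub> (g, h, k) =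
    sign_change (psgn k) (psgn g) (psgn h) ` K"
proof -
  have "K \<subseteq> carrier didicosm" using K transl_subset by blast
  show ?thesis
    unfolding didicosm_conj_set[OF g \<open>K \<subseteq> carrier didicosm\<close>]
    using K by (intro image_cong) (auto simp: sign_change_def transl_def)
qed

lemma transl_conjugacy_class:
  assumes "K \<subseteq> transl"
  shows "conjugacy_class didicosm K = {K, sign_change 1 (- 1) (- 1) ` K,
    sign_change (- 1) 1 (- 1) ` K, sign_change (- 1) (- 1) 1 ` K}" (is "_ = ?R")
proof
  have id: "sign_change 1 1 1 ` K = K" by (auto simp: sign_change_def)
  show "conjugacy_class didicosm K \<subseteq> ?R"
  proof
    fix L assume "L \<in> conjugacy_class didicosm K"
    then obtain g h k where g: "(g, h, k) \<in> carrier didicosm"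
      and L: "L = (g, h, k) <#\<^bsub>didicosm\<^esub> K #>\<^bsub>didicosm\<^esub> inv\<^bsub>didicosm\<^esub> (g, h, k)"
      unfolding conjugacy_class_def by auto
    have "even (g + h + k)" using g by (simp only: didicosm_simps)
    then show "L \<in> ?R"
      unfolding L transl_conj[OF assms g]
      by (cases rule: even_sum_cases) (simp_all add: id)
  qed
  have mem: "sign_change (psgn k) (psgn g) (psgn h) ` K \<in> conjugacy_class didicosm K"
    if "even (g + h + k)" for g h k
  proof -
    have g: "(g, h, k) \<in> carrier didicosm" using that by (simp only: didicosm_simps)
    then show ?thesis unfolding conjugacy_class_def transl_conj[OF assms g, symmetric] by blast
  qed
  show "?R \<subseteq> conjugacy_class didicosm K"
    using mem[of 0 0 0] mem[of 1 1 0] mem[of 0 1 1] mem[of 1 0 1] by (simp add: id)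
qed

lemma sign_change_transl_subgroups:
  assumes "K \<in> transl_subgroups n" "\<bar>d\<bar> = 1" "\<bar>e\<bar> = 1" "\<bar>f\<bar> = 1"
  shows "sign_change d e f ` K \<in> transl_subgroups n"
proof -
  have "sign_change d e f ` K \<subseteq> transl" if "K \<subseteq> transl"
    using that by (force simp: sign_change_def transl_def)
  then show ?thesis
    using assms image_subgroup_iso[OF group_didicosm group_didicosm sign_change_iso[of d e f], of K]
    by (simp add: transl_subgroups_def)
qed

lemma rot_transl_subgroups:
  assumes "K \<in> transl_subgroups n"
  shows "rot ` K \<in> transl_subgroups n"
proof -
  have "rot ` K \<subseteq> transl" if "K \<subseteq> transl"
    using that by (force simp: rot_def transl_def)
  then show ?thesis
    using assms image_subgroup_iso[OF group_didicosm group_didicosm rot_iso, of K]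
    by (simp add: transl_subgroups_def)
qed

text \<open>\<open>image rot\<close> is injective, so the inclusions around the cycle squeeze the
  three cardinalities together.\<close>

lemma card_rot_cycle:
  assumes fin: "finite A" "finite B" "finite C"
    and sub: "image rot ` A \<subseteq> B" "image rot ` B \<subseteq> C" "image rot ` C \<subseteq> A"
  shows "card B = card A" "card C = card A"
proof -
  have inj: "inj_on (image rot) S" for S
    by (rule inj_on_inverseI[of _ "\<lambda>K. rot ` rot ` K"]) (rule rot_rot_rot)
  have "card A \<le> card B" "card B \<le> card C" "card C \<le> card A"
    using card_inj_on_le[OF inj] fin sub by blast+
  then show "card B = card A" "card C = card A" by simp_all
qed

text \<open>The orbit-stabiliser theorem for the Klein four-group: \<open>e\<close> is a point and
  \<open>x\<close>, \<open>y\<close>, \<open>z\<close> are its images under the three involutions.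
  The hypotheses are the coincidences forced by the group law, and the second factor is the order of
  the stabiliser.\<close>

lemma card_klein_orbit:
  assumes "x = e \<Longrightarrow> y = z" "y = e \<Longrightarrow> x = z" "z = e \<Longrightarrow> x = y"
    and "x = y \<Longrightarrow> z = e" "x = z \<Longrightarrow> y = e" "y = z \<Longrightarrow> x = e"
  shows "card {e, x, y, z} * (1 + of_bool (x = e) + of_bool (y = e) + of_bool (z = e)) = (4 :: nat)"
proof (cases "x = e \<or> y = e \<or> z = e")
  case True
  then have "x = e \<and> y = z \<or> y = e \<and> x = z \<or> z = e \<and> x = y" using assms by blast
  then show ?thesis by (elim disjE conjE) (simp_all add: card_insert_if)
next
  case False
  then have "x \<noteq> e" "y \<noteq> e" "z \<noteq> e" "x \<noteq> y" "x \<noteq> z" "y \<noteq> z"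
    using assms(4-6) by blast+
  then show ?thesis by (simp add: card_insert_if)
qed

lemma card_conjugacy_classes_transl:
  assumes "m > 0"
  shows "4 * card (conjugacy_class didicosm ` transl_subgroups (4 * m)) =
    (\<Sum>(a, b, c)\<in>triples m. b * c * c) +
    3 * (\<Sum>(a, b, c)\<in>triples m. c * (1 + of_bool (even c) + of_bool (even b)))"
proof -
  let ?S = "transl_subgroups (4 * m)"
  let ?x = "sign_change 1 (- 1) (- 1)" and ?y = "sign_change (- 1) 1 (- 1)"
    and ?z = "sign_change (- 1) (- 1) 1"
  \<comment> \<open>The order of the stabiliser of \<open>K\<close> in the Klein four-group of sign
    changes.\<close>
  let ?w = "\<lambda>K. 1 + of_bool (?x ` K = K) + of_bool (?y ` K = K) + of_bool (?z ` K = K) :: nat"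
  have fin: "finite ?S" using assms by (simp add: finite_transl_subgroups)
  have T: "K \<subseteq> transl" if "K \<in> ?S" for K using that by (simp add: transl_subgroups_def)
  note cc = transl_conjugacy_class[OF T]
  have mult: "?x ` ?x ` K = K" "?y ` ?y ` K = K" "?z ` ?z ` K = K"
    "?x ` ?y ` K = ?z ` K" "?y ` ?x ` K = ?z ` K" "?x ` ?z ` K = ?y ` K" "?z ` ?x ` K = ?y ` K"
    "?y ` ?z ` K = ?x ` K" "?z ` ?y ` K = ?x ` K" for K
    by (simp_all add: image_image sign_change_def case_prod_unfold)
  have stab: "sign_change d e f ` K \<in> ?S" if "K \<in> ?S" "\<bar>d\<bar> = 1" "\<bar>e\<bar> = 1" "\<bar>f\<bar> = 1" for d e f K
    by (rule sign_change_transl_subgroups[OF that])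
  have "4 * card (conjugacy_class didicosm ` ?S) = sum ?w ?S"
  proof (rule card_partition_weighted[OF fin])
    fix K assume K: "K \<in> ?S"
    show "K \<in> conjugacy_class didicosm K" by (simp add: cc[OF K])
    show "conjugacy_class didicosm K \<subseteq> ?S" using K stab by (simp add: cc[OF K])
    show "conjugacy_class didicosm L = conjugacy_class didicosm K" if L: "L \<in> conjugacy_class didicosm K" for L
    proof -
      have "L \<in> ?S" using \<open>conjugacy_class didicosm K \<subseteq> ?S\<close> L by blast
      moreover have "L = K \<or> L = ?x ` K \<or> L = ?y ` K \<or> L = ?z ` K"
        using L unfolding cc[OF K] by blast
      ultimately show ?thesis
        unfolding cc[OF \<open>L \<in> ?S\<close>] cc[OF K] by (elim disjE; simp only: mult insert_commute)
    qed
    have comp: "?x ` K = K \<Longrightarrow> ?y ` K = ?z ` K" "?y ` K = K \<Longrightarrow> ?x ` K = ?z ` K"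
      "?z ` K = K \<Longrightarrow> ?x ` K = ?y ` K" "?x ` K = ?y ` K \<Longrightarrow> ?z ` K = K"
      "?x ` K = ?z ` K \<Longrightarrow> ?y ` K = K" "?y ` K = ?z ` K \<Longrightarrow> ?x ` K = K"
      using mult[of K] by metis+
    show "card (conjugacy_class didicosm K) * ?w K = 4"
      unfolding cc[OF K]
      by (rule card_klein_orbit) (use comp in blast)+
  qed
  also have "sum ?w ?S = card ?S + card {K \<in> ?S. ?x ` K = K} + card {K \<in> ?S. ?y ` K = K} +
      card {K \<in> ?S. ?z ` K = K}"
    unfolding sum.distrib using fin by (simp add: Int_def)
  finally have count: "4 * card (conjugacy_class didicosm ` ?S) = card ?S +
      card {K \<in> ?S. ?x ` K = K} + card {K \<in> ?S. ?y ` K = K} + card {K \<in> ?S. ?z ` K = K}" .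
  have "card {K \<in> ?S. ?y ` K = K} = card {K \<in> ?S. ?x ` K = K}"
    "card {K \<in> ?S. ?z ` K = K} = card {K \<in> ?S. ?x ` K = K}"
  proof -
    \<comment> \<open>Conjugation by \<open>rot\<close> permutes the three sign changes cyclically,
      so each of them fixes the same number of subgroups.\<close>
    have r: "?y ` rot ` K = rot ` ?x ` K" "?z ` rot ` K = rot ` ?y ` K" "?x ` rot ` K = rot ` ?z ` K" for K
      by (simp_all add: image_image sign_change_def rot_def case_prod_unfold)
    have sub: "image rot ` {K \<in> ?S. ?x ` K = K} \<subseteq> {K \<in> ?S. ?y ` K = K}"
      "image rot ` {K \<in> ?S. ?y ` K = K} \<subseteq> {K \<in> ?S. ?z ` K = K}"
      "image rot ` {K \<in> ?S. ?z ` K = K} \<subseteq> {K \<in> ?S. ?x ` K = K}"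
      by (rule image_subsetI, simp add: rot_transl_subgroups, simp only: r)+
    show "card {K \<in> ?S. ?y ` K = K} = card {K \<in> ?S. ?x ` K = K}"
      "card {K \<in> ?S. ?z ` K = K} = card {K \<in> ?S. ?x ` K = K}"
      using card_rot_cycle[OF _ _ _ sub] fin by simp_all
  qed
  then show ?thesis
    by (simp add: count card_half_turn_transl_subgroups card_transl_subgroups assms)
qed

section \<open>Subgroups with holonomy of order two\<close>

text \<open>\<open>xlat (k, b, c) (z, x, y)\<close> is generated by \<open>(k, 2 x + 1, 2 y)\<close> and the translations by
  \<open>{0} \<times> 2 lat2 b z c\<close>.\<close>

definition xlat :: "nat \<times> nat \<times> nat \<Rightarrow> nat \<times> nat \<times> nat \<Rightarrow> (int \<times> int \<times> int) set" where
  "xlat = (\<lambda>(k, b, c) (z, x, y).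
    {(2 * (int k * j), 2 * p, 2 * q) | j p q. (p, q) \<in> lat2 b z c} \<union>
    {(int k * (2 * j + 1), 2 * p + 1, 2 * q) | j p q. (p - int x, q - int y) \<in> lat2 b z c})"

lemma xlat_even_iff:
  assumes "k > 0"
  shows "(2 * (int k * j), 2 * p, 2 * q) \<in> xlat (k, b, c) (z, x, y) \<longleftrightarrow> (p, q) \<in> lat2 b z c"
proof -
  have "2 * p \<noteq> 2 * p' + 1" for p' by presburger
  then show ?thesis using assms by (auto simp: xlat_def)
qed

lemma xlat_odd_iff:
  assumes "k > 0"
  shows "(int k * (2 * j + 1), 2 * p + 1, 2 * q) \<in> xlat (k, b, c) (z, x, y) \<longleftrightarrow>
    (p - int x, q - int y) \<in> lat2 b z c"
proof -
  have "2 * p + 1 \<noteq> 2 * p'" for p' by presburger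
  then show ?thesis using assms by (auto simp: xlat_def)
qed

lemma xlat_cases:
  assumes "v \<in> xlat (k, b, c) (z, x, y)"
  obtains (even) j p q where "v = (2 * (int k * j), 2 * p, 2 * q)" "(p, q) \<in> lat2 b z c"
    | (odd) j p q where "v = (int k * (2 * j + 1), 2 * p + 1, 2 * q)"
        "(p - int x, q - int y) \<in> lat2 b z c"
  using assms unfolding xlat_def prod.case Un_iff mem_Collect_eq by blast

lemma subgroup_xlat:
  assumes k: "odd k"
  shows "subgroup (xlat (k, b, c) (z, x, y)) didicosm" (is "subgroup ?K _")
proof (rule group.subgroupI[OF group_didicosm])
  have "k > 0" using k by (rule odd_pos)
  note iff = xlat_even_iff[OF \<open>k > 0\<close>, where b = b and c = c and z = z and x = x and y = y]
    xlat_odd_iff[OF \<open>k > 0\<close>, where b = b and c = c and z = z and x = x and y = y]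
  note L = lattice2_lat2[of b z c]
  show "?K \<subseteq> carrier didicosm" using k by (auto simp: didicosm_simps elim!: xlat_cases)
  show "?K \<noteq> {}" using iff(1)[of 0 0 0] lattice2_zero[OF L] by auto
  fix u assume u: "u \<in> ?K"
  show "inv\<^bsub>didicosm\<^esub> u \<in> ?K"
    using u
  proof (cases rule: xlat_cases)
    case (even j p q)
    then have "(2 * (int k * - j), 2 * - p, 2 * - q) \<in> ?K"
      unfolding iff using lattice2_minus[OF L] by blast
    then show ?thesis by (simp add: even inv_didicosm)
  next
    case (odd j p q)
    then have "(int k * (2 * (- j - 1) + 1), 2 * p + 1, 2 * q) \<in> ?K"
      unfolding iff by blast
    then show ?thesis using k by (simp add: odd inv_didicosm algebra_simps)
  qed
  fix v assume v: "v \<in> ?K"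
  show "u \<otimes>\<^bsub>didicosm\<^esub> v \<in> ?K"
    using u
  proof (cases rule: xlat_cases)
    case u: (even j p q)
    show ?thesis
      using v
    proof (cases rule: xlat_cases)
      case v: (even j' p' q')
      have "(2 * (int k * (j + j')), 2 * (p + p'), 2 * (q + q')) \<in> ?K"
        unfolding iff using lattice2_add[OF L u(2) v(2)] .
      then show ?thesis by (simp add: u v didicosm_simps algebra_simps)
    next
      case v: (odd j' p' q')
      have "(int k * (2 * (j + j') + 1), 2 * (p + p') + 1, 2 * (q + q')) \<in> ?K"
        unfolding iff using lattice2_add[OF L u(2) v(2)] by (simp add: algebra_simps)
      then show ?thesis by (simp add: u v didicosm_simps algebra_simps)
    qed
  next
    case u: (odd j p q)
    show ?thesis
      using v
    proof (cases rule: xlat_cases)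
      case v: (even j' p' q')
      have "(int k * (2 * (j + j') + 1), 2 * (p - p') + 1, 2 * (q - q')) \<in> ?K"
        unfolding iff using lattice2_diff[OF L u(2) v(2)] by (simp add: algebra_simps)
      then show ?thesis using k by (simp add: u v didicosm_simps algebra_simps)
    next
      case v: (odd j' p' q')
      have "(2 * (int k * (j + j' + 1)), 2 * (p - p'), 2 * (q - q')) \<in> ?K"
        unfolding iff using lattice2_diff[OF L u(2) v(2)] by simp
      then show ?thesis using k by (simp add: u v didicosm_simps algebra_simps)
    qed
  qed
qed

text \<open>The first side of the box is \<open>k\<close> and not \<open>2 * k\<close>, because the
  generator of type \<open>x\<close> already advances the first coordinate by
  \<open>k\<close>.\<close>

lemma index_xlat:
  assumes k: "odd k" and bc: "b > 0" "c > 0"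
  shows "card (rcosets\<^bsub>didicosm\<^esub> (xlat (k, b, c) (z, x, y))) = 2 * (k * b * c)"
proof -
  let ?K = "xlat (k, b, c) (z, x, y)"
  let ?S = "{(u, v, w). even (u + v + w) \<and> 0 \<le> u \<and> u < int k \<and> 0 \<le> v \<and> v < int (2 * b) \<and>
     0 \<le> w \<and> w < 2 * int c}"
  have "k > 0" using k by (rule odd_pos)
  have "card (rcosets\<^bsub>didicosm\<^esub> ?K) = card ?S"
  proof (rule group.card_rcosets_transversal[OF group_didicosm subgroup_xlat[OF k]])
    show "?S \<subseteq> carrier didicosm" by (auto simp: didicosm_simps)
  next
    fix v assume "v \<in> carrier didicosm"
    then obtain v1 v2 v3 where v: "v = (v1, v2, v3)" "even (v1 + v2 + v3)"
      by (cases v) (auto simp: didicosm_simps)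
    define i where "i = v1 div int k"
    have v1: "int k * i + v1 mod int k = v1" by (simp add: i_def)
    show "\<exists>s\<in>?S. \<exists>g\<in>?K. v = g \<otimes>\<^bsub>didicosm\<^esub> s"
    proof (cases "even i")
      case True
      then obtain j where j: "i = 2 * j" by (elim evenE)
      obtain p q where pq: "p < b" "q < c" "(v2 div 2 - int p, v3 div 2 - int q) \<in> lat2 b z c"
        using lat2_reduce[OF bc] by metis
      let ?s = "(v1 mod int k, 2 * int p + v2 mod 2, 2 * int q + v3 mod 2)"
      let ?g = "(2 * (int k * j), 2 * (v2 div 2 - int p), 2 * (v3 div 2 - int q))"
      have "even (v1 mod int k + v2 + v3)"
        using v(2) by (subst (asm) v1[symmetric]) (simp add: j)
      then have "?s \<in> ?S" using pq(1,2) \<open>k > 0\<close> by auto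
      moreover have "?g \<in> ?K" unfolding xlat_even_iff[OF \<open>k > 0\<close>] by (rule pq)
      moreover have "v = ?g \<otimes>\<^bsub>didicosm\<^esub> ?s"
        using v1 by (simp add: didicosm_simps v(1) j algebra_simps)
      ultimately show ?thesis by blast
    next
      case False
      then obtain j where j: "i = 2 * j + 1" by (elim oddE)
      \<comment> \<open>An odd \<open>i\<close> is realised by an element of type \<open>x\<close>,
        which negates the last two coordinates of the representative. Hence \<open>1 - v2\<close>
        and \<open>- v3\<close> are halved here in place of \<open>v2\<close> and
        \<open>v3\<close>.\<close>
      define P Q where "P = (1 - v2) div 2" and "Q = (- v3) div 2"
      obtain p q where pq: "p < b" "q < c" "(P + int x - int p, Q + int y - int q) \<in> lat2 b z c"
        using lat2_reduce[OF bc] by metis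
      let ?s = "(v1 mod int k, 2 * int p + (1 - v2) mod 2, 2 * int q + (- v3) mod 2)"
      let ?g = "(int k * (2 * j + 1), 2 * (int p - P) + 1, 2 * (int q - Q))"
      have "even (v1 mod int k + (1 - v2) + (- v3))"
        using v(2) k by (subst (asm) v1[symmetric]) (auto simp: j)
      then have "?s \<in> ?S" using pq(1,2) \<open>k > 0\<close> by auto
      moreover have "?g \<in> ?K"
        unfolding xlat_odd_iff[OF \<open>k > 0\<close>]
        using lattice2_minus[OF lattice2_lat2 pq(3)] by (simp add: algebra_simps)
      moreover have "v = ?g \<otimes>\<^bsub>didicosm\<^esub> ?s"
      proof -
        have "2 * P + (1 - v2) mod 2 = 1 - v2" "2 * Q + (- v3) mod 2 = - v3"
          by (simp_all only: P_def Q_def mult_div_mod_eq)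
        then show ?thesis using v1 k by (simp add: didicosm_simps v(1) j algebra_simps)
      qed
      ultimately show ?thesis by blast
    qed
  next
    fix s s' g assume s: "s \<in> ?S" "s' \<in> ?S" and g: "g \<in> ?K" and eq: "s = g \<otimes>\<^bsub>didicosm\<^esub> s'"
    obtain u v w where s': "s' = (u, v, w)" by (cases s')
    show "s = s'"
      using g
    proof (cases rule: xlat_cases)
      case (even j p q)
      have "s = (2 * (int k * j) + u, 2 * p + v, 2 * q + w)"
        by (simp add: eq even s' didicosm_simps)
      then have b: "\<bar>2 * (int k * j)\<bar> < int k" "\<bar>p\<bar> < int b" "\<bar>q\<bar> < int c" using s s' by auto
      have "2 * (int k * j) = 0" using b(1) by (intro abs_less_dvd_imp_0) auto
      moreover have "p = 0" using b(2) even(2) lat2_fst_dvd by (intro abs_less_dvd_imp_0) auto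
      moreover from this have "q = 0"
        using b(3) even(2) bc by (intro abs_less_dvd_imp_0) (auto simp: lat2_0_iff)
      ultimately show ?thesis by (simp add: eq even(1) s' didicosm_simps)
    next
      \<comment> \<open>An odd multiple of \<open>k\<close> is nonzero and therefore too long to
        join two points of the box.\<close>
      case (odd j p q)
      have "fst s = int k * (2 * j + 1) + u" by (simp add: eq odd s' didicosm_simps)
      then have "\<bar>int k * (2 * j + 1)\<bar> < int k" using s s' by auto
      then have "int k * (2 * j + 1) = 0" by (intro abs_less_dvd_imp_0) auto
      then have "2 * j + 1 = 0" using \<open>k > 0\<close> by simp
      then have False by presburger
      then show ?thesis ..
    qed
  qed
  also have "\<dots> = k * (2 * b) * c" by (rule card_even_box)
  finally show ?thesis by simp
qed

text \<open>The generator \<open>(k, 2 x + 1, 2 y)\<close> has square \<open>(2 k, 0, 0)\<close>, so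
  its offset enters \<open>?f\<close> only through \<open>i mod 2\<close>. It negates the plane
  lattice, just as the first factor of \<open>dicosm\<close> acts on the other two by
  \<open>psgn\<close>.\<close>

lemma xlat_iso:
  assumes k: "odd k" and bc: "b > 0" "c > 0"
  shows "didicosm\<lparr>carrier := xlat (k, b, c) (z, x, y)\<rparr> \<cong> dicosm"
proof -
  let ?K = "xlat (k, b, c) (z, x, y)"
  have "k > 0" using k by (rule odd_pos)
  note iff = xlat_even_iff[OF \<open>k > 0\<close>, where b = b and c = c and z = z and x = x and y = y]
    xlat_odd_iff[OF \<open>k > 0\<close>, where b = b and c = c and z = z and x = x and y = y]
  let ?f = "\<lambda>(i, j, l). (int k * i, (i mod 2) * (2 * int x + 1) + 2 * (int b * j),
    2 * ((i mod 2) * int y + (int z * j + int c * l)))"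
  have f_even: "?f (2 * i, j, l) = (2 * (int k * i), 2 * (int b * j), 2 * (int z * j + int c * l))"
    and f_odd: "?f (2 * i + 1, j, l) = (int k * (2 * i + 1), 2 * (int x + int b * j) + 1,
      2 * (int y + (int z * j + int c * l)))" for i j l
    by (simp_all add: algebra_simps)
  have par: "\<exists>i'. i = 2 * i' \<or> i = 2 * i' + 1" for i :: int by presburger
  have mem: "?f (i, j, l) \<in> ?K" for i j l
  proof -
    obtain i' where "i = 2 * i' \<or> i = 2 * i' + 1" using par by blast
    then show ?thesis
      by (elim disjE; simp only: f_even f_odd iff add_diff_cancel_left' lat2I)
  qed
  have "?f \<in> hom dicosm (didicosm\<lparr>carrier := ?K\<rparr>)"
  proof (rule homI)
    show "?f v \<in> carrier (didicosm\<lparr>carrier := ?K\<rparr>)" for v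
      by (cases v) (use mem in auto)
    fix u v :: "int \<times> int \<times> int"
    obtain i j l i' j' l' where uv: "u = (i, j, l)" "v = (i', j', l')" by (cases u; cases v) auto
    have sum: "(i + i') mod 2 = (if even i then i' mod 2 else 1 - i' mod 2)" by presburger
    show "?f (u \<otimes>\<^bsub>dicosm\<^esub> v) = ?f u \<otimes>\<^bsub>didicosm\<lparr>carrier := ?K\<rparr>\<^esub> ?f v"
    proof (cases "even i")
      case True
      then show ?thesis
        using k by (simp add: uv dicosm_simps didicosm_simps sum) (simp add: algebra_simps)
    next
      case False
      then have "i mod 2 = 1" by presburger
      then show ?thesis
        using k False by (simp add: uv dicosm_simps didicosm_simps sum) (simp add: algebra_simps)
    qed
  qed
  moreover have "bij_betw ?f (carrier dicosm) ?K"
  proof (rule bij_betw_imageI)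
    show "inj_on ?f (carrier dicosm)" using \<open>k > 0\<close> bc by (auto simp: inj_on_def)
    show "?f ` carrier dicosm = ?K"
    proof
      show "?f ` carrier dicosm \<subseteq> ?K" using mem by auto
      show "?K \<subseteq> ?f ` carrier dicosm"
      proof
        fix v assume "v \<in> ?K"
        then show "v \<in> ?f ` carrier dicosm"
        proof (cases rule: xlat_cases)
          case (even i p q)
          then obtain j l where "p = int b * j" "q = int z * j + int c * l" by (auto simp: lat2_def)
          then have "v = ?f (2 * i, j, l)" unfolding f_even even(1) by simp
          then show ?thesis using dicosm_simps(1) by (rule image_eqI)
        next
          case (odd i p q)
          then obtain j l where "p - int x = int b * j" "q - int y = int z * j + int c * l"
            by (auto simp: lat2_def)
          then have "p = int x + int b * j" "q = int y + (int z * j + int c * l)" by simp_all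
          then have "v = ?f (2 * i + 1, j, l)" unfolding f_odd odd(1) by simp
          then show ?thesis using dicosm_simps(1) by (rule image_eqI)
        qed
      qed
    qed
  qed
  ultimately have "?f \<in> iso dicosm (didicosm\<lparr>carrier := ?K\<rparr>)" by (simp add: iso_def)
  then show ?thesis using group.iso_sym[OF group_dicosm] is_isoI by blast
qed

text \<open>With all third coordinates even, the first coordinate is additive. An element outside
  \<open>transl\<close> has odd first coordinate, so the generator \<open>k\<close> of the image is
  odd, and an element over \<open>k\<close> is a half turn with square \<open>(2 k, 0, 0)\<close>.
  What remains is the plane lattice and one coset of it.\<close>

lemma x_subgroup_eq_xlat:
  assumes K: "subgroup K didicosm" "card (rcosets\<^bsub>didicosm\<^esub> K) > 0"
    and X: "\<And>a b c. (a, b, c) \<in> K \<Longrightarrow> even c" and T: "\<not> K \<subseteq> transl"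
  obtains k b c z x y where "odd k" "b > 0" "c > 0" "z < c" "x < b" "y < c"
    "K = xlat (k, b, c) (z, x, y)"
proof -
  note m = subgroup.m_closed[OF K(1)] and inv = subgroup.m_inv_closed[OF K(1)]
  have Kc: "even (u + v + w)" if "(u, v, w) \<in> K" for u v w
    using subgroup.subset[OF K(1)] that by (auto simp: didicosm_def)
  obtain b z c where bzc: "b > 0" "z < c" "{(p, q). (0, 2 * p, 2 * q) \<in> K} = lat2 b z c"
    using finite_index_lat2[OF K] .
  then have c: "c > 0" by simp
  have M: "(p, q) \<in> lat2 b z c \<longleftrightarrow> (0, 2 * p, 2 * q) \<in> K" for p q
    unfolding bzc(3)[symmetric] by simp
  define I where "I = {u. \<exists>v w. (u, v, w) \<in> K}"
  have diff: "u - u' \<in> I" if uu': "u \<in> I" "u' \<in> I" for u u'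
  proof -
    obtain v w v' w' where K2: "(u, v, w) \<in> K" "(u', v', w') \<in> K" using uu' by (auto simp: I_def)
    then have "(u, v, w) \<otimes>\<^bsub>didicosm\<^esub> inv\<^bsub>didicosm\<^esub> (u', v', w') \<in> K" using m inv by blast
    then show ?thesis
      using K2 X Kc by (auto simp: inv_didicosm didicosm_simps I_def)
  qed
  obtain u v w where t: "(u, v, w) \<in> K" "(u, v, w) \<notin> transl" using T by auto
  have "odd u" using t X[OF t(1)] Kc[OF t(1)] by (auto simp: transl_def)
  have "u \<in> I" using t by (auto simp: I_def)
  have "u \<noteq> 0" using \<open>odd u\<close> by auto
  obtain k where k: "k > 0" "I = {i. int k dvd i}"
    using int_subgroup_multiples[of I u, OF diff \<open>u \<in> I\<close> \<open>u \<noteq> 0\<close>] by blast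
  have "int k dvd u" using \<open>u \<in> I\<close> unfolding k(2) by simp
  then have "odd k" using \<open>odd u\<close> by (metis dvd_trans even_of_nat)
  have "int k \<in> I" by (simp add: k(2))
  then obtain g2 g3 where g0: "(int k, g2, g3) \<in> K" by (auto simp: I_def)
  have "even g3" using X g0 by blast
  moreover have "odd g2" using Kc[OF g0] \<open>even g3\<close> \<open>odd k\<close> by simp
  ultimately obtain P Q where PQ: "g2 = 2 * P + 1" "g3 = 2 * Q" by (auto elim!: evenE oddE)
  obtain x y where xy: "x < b" "y < c" "(P - int x, Q - int y) \<in> lat2 b z c"
    using lat2_reduce[OF bzc(1) c] by metis
  \<comment> \<open>Correcting the chosen element over \<open>k\<close> by a vector of the plane
    lattice moves its offset into the box.\<close>
  have "(2 * - 0, 2 * - (P - int x), 2 * - (Q - int y)) \<in> K"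
    by (rule subgroup_transl_minus[OF K(1)]) (use xy(3) in \<open>simp add: M\<close>)
  from subgroup_transl_add[OF K(1) this g0] have g: "(int k, 2 * int x + 1, 2 * int y) \<in> K"
    by (simp add: PQ)
  have kj: "(2 * (j * int k), 2 * (j * 0), 2 * (j * 0)) \<in> K" for j
    by (rule subgroup_transl_mult[OF K(1)])
      (use m[OF g g] \<open>odd k\<close> in \<open>simp add: didicosm_simps\<close>)
  have even: "(2 * (int k * j), 2 * p, 2 * q) \<in> K \<longleftrightarrow> (p, q) \<in> lat2 b z c" for j p q
  proof
    assume "(2 * (int k * j), 2 * p, 2 * q) \<in> K"
    from subgroup_transl_diff[OF K(1) this kj[of j]] show "(p, q) \<in> lat2 b z c"
      by (simp add: M mult.commute)
  next
    assume "(p, q) \<in> lat2 b z c"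
    then have "(2 * 0, 2 * p, 2 * q) \<in> K" by (simp add: M)
    from subgroup_transl_add[OF K(1) this kj[of j]] show "(2 * (int k * j), 2 * p, 2 * q) \<in> K"
      by (simp add: mult.commute)
  qed
  have odd: "(int k * (2 * j + 1), 2 * p + 1, 2 * q) \<in> K \<longleftrightarrow> (p - int x, q - int y) \<in> lat2 b z c"
    for j p q
  proof
    assume "(int k * (2 * j + 1), 2 * p + 1, 2 * q) \<in> K"
    from m[OF this inv[OF g]]
    have "(2 * (int k * j), 2 * (p - int x), 2 * (q - int y)) \<in> K"
      using \<open>odd k\<close> by (simp add: inv_didicosm didicosm_simps algebra_simps)
    then show "(p - int x, q - int y) \<in> lat2 b z c" by (simp only: even)
  next
    assume "(p - int x, q - int y) \<in> lat2 b z c"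
    then have "(2 * (int k * j), 2 * (p - int x), 2 * (q - int y)) \<in> K" by (simp only: even)
    from subgroup_transl_add[OF K(1) this g] show "(int k * (2 * j + 1), 2 * p + 1, 2 * q) \<in> K"
      by (simp add: algebra_simps)
  qed
  have "K = xlat (k, b, c) (z, x, y)"
  proof
    show "xlat (k, b, c) (z, x, y) \<subseteq> K" by (auto simp: even odd elim!: xlat_cases)
    show "K \<subseteq> xlat (k, b, c) (z, x, y)"
    proof
      fix v assume v: "v \<in> K"
      obtain v1 v2 v3 where v': "v = (v1, v2, v3)" by (cases v)
      have "v1 \<in> I" using v v' by (auto simp: I_def)
      then obtain i where i: "v1 = int k * i" unfolding k(2) by (auto elim: dvdE)
      obtain q where q: "v3 = 2 * q" using X v v' by (blast elim: evenE)
      have "even v1 \<longleftrightarrow> even v2" using Kc v v' q by auto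
      then have "even i \<longleftrightarrow> even v2" using i \<open>odd k\<close> by simp
      then consider j p where "i = 2 * j" "v2 = 2 * p" | j p where "i = 2 * j + 1" "v2 = 2 * p + 1"
        by (metis evenE oddE)
      then show "v \<in> xlat (k, b, c) (z, x, y)"
      proof cases
        case (1 j p)
        have v: "v = (2 * (int k * j), 2 * p, 2 * q)" by (simp add: v' i q 1)
        show ?thesis using \<open>v \<in> K\<close> unfolding v xlat_even_iff[OF k(1)] even .
      next
        case (2 j p)
        have v: "v = (int k * (2 * j + 1), 2 * p + 1, 2 * q)" by (simp add: v' i q 2)
        show ?thesis using \<open>v \<in> K\<close> unfolding v xlat_odd_iff[OF k(1)] odd .
      qed
    qed
  qed
  then show thesis using that \<open>odd k\<close> bzc(1,2) c xy(1,2) by blast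
qed

lemma xlat_fst:
  assumes "odd k"
  shows "fst ` xlat (k, b, c) (z, x, y) = {i. int k dvd i}"
proof
  show "fst ` xlat (k, b, c) (z, x, y) \<subseteq> {i. int k dvd i}"
    by (auto elim!: xlat_cases)
  show "{i. int k dvd i} \<subseteq> fst ` xlat (k, b, c) (z, x, y)"
  proof
    fix v1 assume "v1 \<in> {i. int k dvd i}"
    then obtain i where i: "v1 = int k * i" by (auto elim: dvdE)
    have L: "(0, 0) \<in> lat2 b z c" by (rule lattice2_zero[OF lattice2_lat2])
    have k: "k > 0" using assms by (rule odd_pos)
    obtain j where "i = 2 * j \<or> i = 2 * j + 1" by (metis evenE oddE)
    then show "v1 \<in> fst ` xlat (k, b, c) (z, x, y)"
    proof
      assume j: "i = 2 * j"
      have "(2 * (int k * j), 2 * 0, 2 * 0) \<in> xlat (k, b, c) (z, x, y)"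
        unfolding xlat_even_iff[OF k] by (rule L)
      then show ?thesis by (intro image_eqI[of _ fst]) (simp_all add: i j)
    next
      assume j: "i = 2 * j + 1"
      have "(int k * (2 * j + 1), 2 * int x + 1, 2 * int y) \<in> xlat (k, b, c) (z, x, y)"
        unfolding xlat_odd_iff[OF k] using L by simp
      then show ?thesis by (intro image_eqI[of _ fst]) (simp_all add: i j)
    qed
  qed
qed

lemma xlat_lat2:
  assumes "odd k"
  shows "{(p, q). (0, 2 * p, 2 * q) \<in> xlat (k, b, c) (z, x, y)} = lat2 b z c"
  using xlat_even_iff[OF odd_pos[OF assms], of 0] by auto

lemma xlat_inj:
  assumes eq: "xlat (k, b, c) (z, x, y) = xlat (k', b', c') (z', x', y')"
    and k: "odd k" "odd k'" and bc: "b > 0" "b' > 0"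
    and less: "z < c" "x < b" "y < c" "z' < c'" "x' < b'" "y' < c'"
  shows "k = k' \<and> b = b' \<and> c = c' \<and> z = z' \<and> x = x' \<and> y = y'"
proof -
  have kk: "k = k'" using xlat_fst k eq by (metis multiples_eq_imp_eq)
  have "lat2 b z c = lat2 b' z' c'"
    using xlat_lat2[OF k(1), of b c z x y] xlat_lat2[OF k(2), of b' c' z' x' y'] eq by simp
  then have bzc: "b = b' \<and> z = z' \<and> c = c'" using lat2_inj bc less by blast
  have "(int x - int x, int y - int y) \<in> lat2 b z c"
    by (simp add: lattice2_zero lattice2_lat2)
  then have "(int k * (2 * 0 + 1), 2 * int x + 1, 2 * int y) \<in> xlat (k, b, c) (z, x, y)"
    by (simp only: xlat_odd_iff[OF odd_pos[OF k(1)]])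
  then have "(int x - int x', int y - int y') \<in> lat2 b' z' c'"
    using xlat_odd_iff[OF odd_pos[OF k(2)]] eq kk by metis
  then have "x = x' \<and> y = y'"
    by (rule lat2_reduce_unique[OF bc(2)]) (use less bzc in simp_all)
  then show ?thesis using kk bzc by simp
qed

text \<open>Even third coordinates admit only the linear parts of the identity and of
  \<open>x\<close>; the last condition makes sure that the second one occurs.\<close>

definition x_subgroups :: "nat \<Rightarrow> (int \<times> int \<times> int) set set" where
  "x_subgroups n = {K. subgroup K didicosm \<and> card (rcosets\<^bsub>didicosm\<^esub> K) = n \<and>
    (\<forall>(a, b, c)\<in>K. even c) \<and> \<not> K \<subseteq> transl}"

definition xlat_params :: "nat \<Rightarrow> ((nat \<times> nat \<times> nat) \<times> (nat \<times> nat \<times> nat)) set" where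
  "xlat_params m = (SIGMA t:{(k, b, c) \<in> triples m. odd k}. case t of (k, b, c) \<Rightarrow> {..<c} \<times> {..<b} \<times> {..<c})"

lemma finite_triples_odd_fst: "m > 0 \<Longrightarrow> finite {(k, b, c) \<in> triples m. odd k}"
  by (rule finite_subset[OF _ finite_triples]) auto

lemma finite_xlat_params: "m > 0 \<Longrightarrow> finite (xlat_params m)"
  unfolding xlat_params_def by (intro finite_SigmaI finite_triples_odd_fst) auto

lemma xlat_paramsE:
  assumes "tr \<in> xlat_params m" "m > 0"
  obtains k b c z x y where "tr = ((k, b, c), (z, x, y))" "odd k" "b > 0" "c > 0"
    "k * b * c = m" "z < c" "x < b" "y < c"
proof -
  obtain k b c z x y where tr: "tr = ((k, b, c), (z, x, y))" by (cases tr) auto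
  then have t: "(k, b, c) \<in> triples m" and k: "odd k" and r: "z < c" "x < b" "y < c"
    using assms(1) by (simp_all add: xlat_params_def)
  show thesis
    by (rule that[OF tr k triples_pos(2,3)[OF t assms(2)] _ r]) (use t in \<open>simp add: triples_def\<close>)
qed

lemma xlat_mem_x_subgroups:
  assumes "odd k" "b > 0" "c > 0"
  shows "xlat (k, b, c) (z, x, y) \<in> x_subgroups (2 * (k * b * c))"
proof -
  have "\<not> xlat (k, b, c) (z, x, y) \<subseteq> transl"
  proof
    assume "xlat (k, b, c) (z, x, y) \<subseteq> transl"
    moreover have "int k \<in> fst ` xlat (k, b, c) (z, x, y)" by (simp add: xlat_fst assms)
    ultimately have "int k \<in> fst ` transl" by blast
    then obtain v where "v \<in> transl" "int k = fst v" by (elim imageE) simp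
    then have "even (int k)" by (cases v) (simp add: transl_def)
    then show False using assms(1) by simp
  qed
  then show ?thesis
    using subgroup_xlat[OF assms(1)] index_xlat[OF assms]
    by (auto simp: x_subgroups_def elim!: xlat_cases)
qed

lemma x_subgroups_eq:
  assumes "m > 0"
  shows "x_subgroups (2 * m) = (\<lambda>(t, r). xlat t r) ` xlat_params m"
proof
  show "x_subgroups (2 * m) \<subseteq> (\<lambda>(t, r). xlat t r) ` xlat_params m"
  proof
    fix K assume "K \<in> x_subgroups (2 * m)"
    then have K: "subgroup K didicosm" "card (rcosets\<^bsub>didicosm\<^esub> K) = 2 * m"
      "\<And>a b c. (a, b, c) \<in> K \<Longrightarrow> even c" "\<not> K \<subseteq> transl"
      by (auto simp: x_subgroups_def)
    have pos: "card (rcosets\<^bsub>didicosm\<^esub> K) > 0" using K(2) assms by simp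
    obtain k b c z x y where p: "odd k" "b > 0" "c > 0" "z < c" "x < b" "y < c"
      "K = xlat (k, b, c) (z, x, y)"
      using x_subgroup_eq_xlat[OF K(1) pos K(3,4)] .
    then have "((k, b, c), (z, x, y)) \<in> xlat_params m"
      using index_xlat[OF p(1-3), of z x y] K(2) by (simp add: xlat_params_def triples_def)
    then show "K \<in> (\<lambda>(t, r). xlat t r) ` xlat_params m" using p(7) by force
  qed
  show "(\<lambda>(t, r). xlat t r) ` xlat_params m \<subseteq> x_subgroups (2 * m)"
  proof
    fix K assume "K \<in> (\<lambda>(t, r). xlat t r) ` xlat_params m"
    then obtain tr where tr: "tr \<in> xlat_params m" "K = (\<lambda>(t, r). xlat t r) tr" by blast
    obtain k b c z x y where p: "tr = ((k, b, c), (z, x, y))" "odd k" "b > 0" "c > 0" "k * b * c = m"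
      using tr(1) assms by (rule xlat_paramsE)
    show "K \<in> x_subgroups (2 * m)"
      using xlat_mem_x_subgroups[OF p(2-4)] by (simp add: tr(2) p(1,5))
  qed
qed

lemma x_subgroups_odd:
  assumes "odd n"
  shows "x_subgroups n = {}"
proof (rule equals0I)
  fix K assume "K \<in> x_subgroups n"
  then have K: "subgroup K didicosm" "card (rcosets\<^bsub>didicosm\<^esub> K) = n"
    "\<And>a b c. (a, b, c) \<in> K \<Longrightarrow> even c" "\<not> K \<subseteq> transl"
    by (auto simp: x_subgroups_def)
  have pos: "card (rcosets\<^bsub>didicosm\<^esub> K) > 0" using K(2) assms by (simp add: odd_pos)
  obtain k b c z x y where p: "odd k" "b > 0" "c > 0" "z < c" "x < b" "y < c"
    "K = xlat (k, b, c) (z, x, y)"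
    using x_subgroup_eq_xlat[OF K(1) pos K(3,4)] .
  have "n = 2 * (k * b * c)" using index_xlat[OF p(1-3), of z x y] K(2) p(7) by simp
  then show False using assms by simp
qed

lemma xlat_params_inj:
  assumes "m > 0"
  shows "inj_on (\<lambda>(t, r). xlat t r) (xlat_params m)"
proof (rule inj_onI)
  fix u v assume uv: "u \<in> xlat_params m" "v \<in> xlat_params m"
    and eq: "(\<lambda>(t, r). xlat t r) u = (\<lambda>(t, r). xlat t r) v"
  obtain k b c z x y where u: "u = ((k, b, c), (z, x, y))" "odd k" "b > 0" "z < c" "x < b" "y < c"
    using uv(1) assms by (rule xlat_paramsE)
  obtain k' b' c' z' x' y' where v: "v = ((k', b', c'), (z', x', y'))" "odd k'" "b' > 0"
    "z' < c'" "x' < b'" "y' < c'"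
    using uv(2) assms by (rule xlat_paramsE)
  have "xlat (k, b, c) (z, x, y) = xlat (k', b', c') (z', x', y')"
    using eq by (simp add: u(1) v(1))
  from xlat_inj[OF this u(2) v(2) u(3) v(3) u(4-6) v(4-6)] show "u = v" by (simp add: u(1) v(1))
qed

lemma finite_x_subgroups:
  assumes "n > 0"
  shows "finite (x_subgroups n)"
proof (cases "even n")
  case True
  then obtain m where "n = 2 * m" by (elim evenE)
  then show ?thesis using assms by (simp add: x_subgroups_eq finite_xlat_params)
qed (simp add: x_subgroups_odd)

lemma sum_triples_odd_fst:
  assumes "m > 0"
  shows "sum f {(k, b, c) \<in> triples m. odd k} = (\<Sum>(k, b, c)\<in>triples m. of_bool (odd k) * (f (k, b, c) :: nat))"
proof -
  have "{(k, b, c) \<in> triples m. odd k} = {t \<in> triples m. odd (fst t)}" by auto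
  then have "sum f {(k, b, c) \<in> triples m. odd k} = (\<Sum>t\<in>triples m. if odd (fst t) then f t else 0)"
    by (simp only: sum.inter_filter[OF finite_triples[OF assms]])
  also have "\<dots> = (\<Sum>(k, b, c)\<in>triples m. of_bool (odd k) * f (k, b, c))"
    by (rule sum.cong) auto
  finally show ?thesis .
qed

lemma card_x_subgroups:
  assumes "m > 0"
  shows "card (x_subgroups (2 * m)) = (\<Sum>(k, b, c)\<in>triples m. of_bool (odd k) * (b * c * c))"
proof -
  have "card (x_subgroups (2 * m)) = card (xlat_params m)"
    unfolding x_subgroups_eq[OF assms] by (rule card_image[OF xlat_params_inj[OF assms]])
  also have "\<dots> = (\<Sum>t\<in>{(k, b, c) \<in> triples m. odd k}.
      card (case t of (k, b, c) \<Rightarrow> {..<c} \<times> {..<b} \<times> {..<c}))"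
    unfolding xlat_params_def by (rule card_SigmaI) (auto simp: finite_triples_odd_fst assms)
  also have "\<dots> = (\<Sum>(k, b, c)\<in>triples m. of_bool (odd k) * (b * c * c))"
    unfolding sum_triples_odd_fst[OF assms]
    by (rule sum.cong) (auto simp: card_cartesian_product)
  finally show ?thesis .
qed

section \<open>Conjugacy and a conjugacy invariant for holonomy generated by
  \<open>x\<close>\<close>

context group
begin

lemma conj_iso:
  assumes g: "g \<in> carrier G"
  shows "(\<lambda>v. g \<otimes> v \<otimes> inv g) \<in> iso G G"
proof (rule isoI)
  have cancel: "inv g \<otimes> (g \<otimes> w) = w" "g \<otimes> (inv g \<otimes> w) = w" if "w \<in> carrier G" for w
    using that g by (simp_all flip: m_assoc)
  show "(\<lambda>v. g \<otimes> v \<otimes> inv g) \<in> hom G G"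
    by (rule homI) (simp_all add: g m_assoc cancel)
  show "bij_betw (\<lambda>v. g \<otimes> v \<otimes> inv g) (carrier G) (carrier G)"
    by (rule bij_betw_byWitness[of _ "\<lambda>v. inv g \<otimes> v \<otimes> g"]) (use g in \<open>auto simp: m_assoc cancel\<close>)
qed

lemma conj_coset_eq: "g <# K #> inv g = (\<lambda>v. g \<otimes> v \<otimes> inv g) ` K"
  unfolding l_coset_def r_coset_def by blast

lemma conjugacy_class_self: "K \<subseteq> carrier G \<Longrightarrow> K \<in> conjugacy_class G K"
proof -
  assume "K \<subseteq> carrier G"
  then have "(\<lambda>v. \<one> \<otimes> v \<otimes> inv \<one>) ` K = K" by (force simp: subset_iff image_iff)
  then show ?thesis unfolding conjugacy_class_def conj_coset_eq by blast
qed

lemma conjugacy_class_eq: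
  assumes K: "K \<subseteq> carrier G" and L: "L \<in> conjugacy_class G K"
  shows "conjugacy_class G L = conjugacy_class G K"
proof -
  obtain g where g: "g \<in> carrier G" "L = (\<lambda>v. g \<otimes> v \<otimes> inv g) ` K"
    using L unfolding conjugacy_class_def conj_coset_eq by blast
  have comp: "(\<lambda>v. h \<otimes> v \<otimes> inv h) ` L = (\<lambda>v. (h \<otimes> g) \<otimes> v \<otimes> inv (h \<otimes> g)) ` K"
    if h: "h \<in> carrier G" for h
    unfolding g(2) image_image
  proof (rule image_cong)
    fix v assume "v \<in> K"
    then have "v \<in> carrier G" using K by blast
    then show "h \<otimes> (g \<otimes> v \<otimes> inv g) \<otimes> inv h = (h \<otimes> g) \<otimes> v \<otimes> inv (h \<otimes> g)"
      using g h by (simp add: inv_mult_group m_assoc)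
  qed simp
  show ?thesis
  proof
    show "conjugacy_class G L \<subseteq> conjugacy_class G K"
    proof
      fix M assume "M \<in> conjugacy_class G L"
      then obtain h where h: "h \<in> carrier G" "M = (\<lambda>v. h \<otimes> v \<otimes> inv h) ` L"
        unfolding conjugacy_class_def conj_coset_eq by blast
      have "h \<otimes> g \<in> carrier G" using h g by simp
      then show "M \<in> conjugacy_class G K"
        unfolding h(2) comp[OF h(1)] conjugacy_class_def conj_coset_eq by blast
    qed
    show "conjugacy_class G K \<subseteq> conjugacy_class G L"
    proof
      fix M assume "M \<in> conjugacy_class G K"
      then obtain h where h: "h \<in> carrier G" "M = (\<lambda>v. h \<otimes> v \<otimes> inv h) ` K"
        unfolding conjugacy_class_def conj_coset_eq by blast
      have hg: "h \<otimes> inv g \<in> carrier G" "h \<otimes> inv g \<otimes> g = h" using h g by (simp_all add: m_assoc)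
      have "M = (\<lambda>v. (h \<otimes> inv g) \<otimes> v \<otimes> inv (h \<otimes> inv g)) ` L"
        unfolding comp[OF hg(1)] hg(2) by (rule h(2))
      then show "M \<in> conjugacy_class G L"
        unfolding conjugacy_class_def conj_coset_eq using hg(1) by blast
    qed
  qed
qed

end

text \<open>The conjugacy class of \<open>K\<close> among the subgroups with holonomy generated by \<open>x\<close> is determined by
  this invariant up to \<open>twist\<close>: translations move the coset of lattice vectors seen by the elements
  of type \<open>x\<close> by twice the integer lattice, so that only its reduction modulo 2 survives.\<close>

definition xinv :: "(int \<times> int \<times> int) set \<Rightarrow> int set \<times> (int \<times> int) set \<times> (bool \<times> bool) set" where
  "xinv K = (fst ` K, {(p, q). (0, 2 * p, 2 * q) \<in> K},
    {(odd p, odd q) | p q. \<exists>a. (a, 2 * p + 1, 2 * q) \<in> K})"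

text \<open>The effect of conjugation by an element with odd third coordinate, such as the generator
  \<open>y\<close>: the plane lattice is reflected and both parities of the offset flip.\<close>

definition twist ::
  "int set \<times> (int \<times> int) set \<times> (bool \<times> bool) set \<Rightarrow> int set \<times> (int \<times> int) set \<times> (bool \<times> bool) set"
  where "twist = (\<lambda>(I, M, V). (I, (\<lambda>(p, q). (p, - q)) ` M, (\<lambda>(e, f). (\<not> e, \<not> f)) ` V))"

lemma twist_twist: "twist (twist q) = q"
  by (cases q) (simp add: twist_def image_image case_prod_unfold)

text \<open>The coset of \<open>(x, y)\<close> modulo \<open>L\<close>, reduced modulo 2; it carries
  the same information as the coset modulo L + 2Z^2.\<close>

definition pcoset :: "(int \<times> int) set \<Rightarrow> int \<Rightarrow> int \<Rightarrow> (bool \<times> bool) set" where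
  "pcoset L x y = {(odd p, odd q) | p q. (p - x, q - y) \<in> L}"

lemma xinv_xlat:
  assumes "odd k"
  shows "xinv (xlat (k, b, c) (z, x, y)) =
    ({i. int k dvd i}, lat2 b z c, pcoset (lat2 b z c) (int x) (int y))"
proof -
  have k: "k > 0" using assms by (rule odd_pos)
  have "(\<exists>a. (a, 2 * p + 1, 2 * q) \<in> xlat (k, b, c) (z, x, y)) \<longleftrightarrow>
      (p - int x, q - int y) \<in> lat2 b z c" for p q
  proof
    assume "\<exists>a. (a, 2 * p + 1, 2 * q) \<in> xlat (k, b, c) (z, x, y)"
    then obtain a where "(a, 2 * p + 1, 2 * q) \<in> xlat (k, b, c) (z, x, y)" by blast
    then show "(p - int x, q - int y) \<in> lat2 b z c"
    proof (cases rule: xlat_cases)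
      case (even j p' q')
      then have "2 * p + 1 = 2 * p'" by simp
      then have False by presburger
      then show ?thesis ..
    qed simp
  next
    assume "(p - int x, q - int y) \<in> lat2 b z c"
    then show "\<exists>a. (a, 2 * p + 1, 2 * q) \<in> xlat (k, b, c) (z, x, y)"
      using xlat_odd_iff[OF k] by blast
  qed
  then show ?thesis
    unfolding xinv_def pcoset_def by (simp add: xlat_fst xlat_lat2 assms)
qed

text \<open>The element \<open>(g, h, l)\<close> acts on the plane with the signs
  \<open>psgn g\<close> and \<open>psgn h\<close>. As \<open>g + h + l\<close> is even, they agree
  exactly for even \<open>l\<close>, and a common sign is absorbed by the lattice. The parities of
  the offset change by those of \<open>g + h\<close> and of \<open>l\<close>, which
  coincide.\<close>

lemma conj_xinv:
  assumes K: "K \<in> x_subgroups n" and g: "(g, h, l) \<in> carrier didicosm"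
  shows "xinv ((g, h, l) <#\<^bsub>didicosm\<^esub> K #>\<^bsub>didicosm\<^esub> inv\<^bsub>didicosm\<^esub> (g, h, l)) =
    (if even l then xinv K else twist (xinv K))"
proof -
  let ?f = "\<lambda>(a, b, c). (psgn l * a + (1 - psgn c) * g, psgn g * b + (1 - psgn a) * h,
      psgn h * c + (1 - psgn b) * l)"
  let ?K = "?f ` K"
  have sub: "subgroup K didicosm" and third: "\<And>a b c. (a, b, c) \<in> K \<Longrightarrow> even c"
    using K by (auto simp: x_subgroups_def)
  have Kc: "K \<subseteq> carrier didicosm" using sub by (rule subgroup.subset)
  have par: "even a \<longleftrightarrow> even b" if "(a, b, c) \<in> K" for a b c
    using that Kc third[OF that] by (auto simp: didicosm_def)
  have ghl: "even (g + h + l)" using g by (simp only: didicosm_simps)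
  \<comment> \<open>For odd \<open>l\<close> conjugation negates first coordinates. The set of these
    is symmetric, since an inverse in \<open>K\<close> has the opposite first coordinate.\<close>
  have fst_neg: "- a \<in> fst ` K" if a: "a \<in> fst ` K" for a
  proof -
    obtain b c where abc: "(a, b, c) \<in> K" using a by auto
    have "inv\<^bsub>didicosm\<^esub> (a, b, c) \<in> K" using subgroup.m_inv_closed[OF sub abc] .
    then show ?thesis using third[OF abc] abc Kc
      by (subst (asm) inv_didicosm) (auto simp: didicosm_def intro!: image_eqI[of _ fst])
  qed
  have 1: "fst ` ?K = fst ` K"
  proof -
    have "fst ` ?K = (\<lambda>a. psgn l * a) ` fst ` K"
      unfolding image_image using third by (intro image_cong) auto
    also have "\<dots> = fst ` K"
    proof (cases "even l")
      case False
      have "uminus ` fst ` K = fst ` K"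
      proof
        show "uminus ` fst ` K \<subseteq> fst ` K" using fst_neg by blast
        show "fst ` K \<subseteq> uminus ` fst ` K"
        proof
          fix a assume "a \<in> fst ` K"
          then show "a \<in> uminus ` fst ` K" using fst_neg by (intro image_eqI[of _ _ "- a"]) simp_all
        qed
      qed
      then show ?thesis using False by simp
    qed simp
    finally show ?thesis .
  qed
  have L: "lattice2 {(p, q). (0, 2 * p, 2 * q) \<in> K}" by (rule subgroup_didicosm_lattice2[OF sub])
  have M: "(0, 2 * p, 2 * q) \<in> ?K \<longleftrightarrow> (0, 2 * (psgn g * p), 2 * (psgn h * q)) \<in> K" for p q
  proof
    assume "(0, 2 * p, 2 * q) \<in> ?K"
    then obtain a b c where abc: "(a, b, c) \<in> K" "(0, 2 * p, 2 * q) = ?f (a, b, c)" by auto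
    have "a = 0" using abc(2) third[OF abc(1)] by (auto simp: psgn_def split: if_splits)
    moreover have "even b" using par[OF abc(1)] \<open>a = 0\<close> by simp
    ultimately have "b = 2 * (psgn g * p)" "c = 2 * (psgn h * q)"
      using abc(2) by (auto simp: psgn_def split: if_splits)
    then show "(0, 2 * (psgn g * p), 2 * (psgn h * q)) \<in> K" using abc(1) \<open>a = 0\<close> by simp
  next
    assume *: "(0, 2 * (psgn g * p), 2 * (psgn h * q)) \<in> K"
    have "(0, 2 * p, 2 * q) = ?f (0, 2 * (psgn g * p), 2 * (psgn h * q))"
      by (auto simp: psgn_def)
    then show "(0, 2 * p, 2 * q) \<in> ?K" using * by (rule image_eqI)
  qed
  have neg: "(0, 2 * - p, 2 * - q) \<in> K \<longleftrightarrow> (0, 2 * p, 2 * q) \<in> K" for p q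
    using lattice2_minus_iff[OF L, of p q] by simp
  have 2: "{(p, q). (0, 2 * p, 2 * q) \<in> ?K} =
    (if even l then {(p, q). (0, 2 * p, 2 * q) \<in> K}
     else (\<lambda>(p, q). (p, - q)) ` {(p, q). (0, 2 * p, 2 * q) \<in> K})"
  proof (cases "even l")
    case True
    then have "even g \<longleftrightarrow> even h" using ghl by auto
    then have "(0, 2 * p, 2 * q) \<in> ?K \<longleftrightarrow> (0, 2 * p, 2 * q) \<in> K" for p q
      unfolding M using neg[of p q] by (cases "even g") simp_all
    then show ?thesis using True by simp
  next
    case False
    then have "even g \<longleftrightarrow> odd h" using ghl by auto
    then have *: "(0, 2 * p, 2 * q) \<in> ?K \<longleftrightarrow> (0, 2 * p, 2 * - q) \<in> K" for p q
      unfolding M using neg[of p "- q"] by (cases "even g") simp_all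
    have "{(p, q). (0, 2 * p, 2 * - q) \<in> K} = (\<lambda>(p, q). (p, - q)) ` {(p, q). (0, 2 * p, 2 * q) \<in> K}"
    proof
      show "{(p, q). (0, 2 * p, 2 * - q) \<in> K} \<subseteq> (\<lambda>(p, q). (p, - q)) ` {(p, q). (0, 2 * p, 2 * q) \<in> K}"
      proof
        fix t assume "t \<in> {(p, q). (0, 2 * p, 2 * - q) \<in> K}"
        then obtain p q where t: "t = (p, q)" "(0, 2 * p, 2 * - q) \<in> K" by blast
        then show "t \<in> (\<lambda>(p, q). (p, - q)) ` {(p, q). (0, 2 * p, 2 * q) \<in> K}"
          by (intro image_eqI[of _ _ "(p, - q)"]) simp_all
      qed
    qed auto
    then show ?thesis using False by (simp only: * if_False)
  qed
  \<comment> \<open>The coordinates come from solving \<open>2 * p + 1 = psgn g * b + 2 * h\<close>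
    for \<open>b\<close> and \<open>2 * q = psgn h * c + 2 * l\<close> for \<open>c\<close>. The
    term \<open>of_bool (odd g)\<close> arises because the negative of \<open>2 * r + 1\<close> is
    \<open>2 * (- r - 1) + 1\<close>.\<close>
  have V: "(\<exists>a. (a, 2 * p + 1, 2 * q) \<in> ?K) \<longleftrightarrow>
    (\<exists>a. (a, 2 * (psgn g * (p - h) - of_bool (odd g)) + 1, 2 * (psgn h * (q - l))) \<in> K)" for p q
  proof
    assume "\<exists>a. (a, 2 * p + 1, 2 * q) \<in> ?K"
    then obtain a' a b c where abc: "(a, b, c) \<in> K" "(a', 2 * p + 1, 2 * q) = ?f (a, b, c)" by auto
    have "2 * p + 1 = psgn g * b + (1 - psgn a) * h" using abc(2) by simp
    moreover have "odd (2 * p + 1)" by simp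
    ultimately have "odd (psgn g * b + (1 - psgn a) * h)" by metis
    then have "odd b" by (auto simp: psgn_def split: if_splits)
    then have "odd a" using par[OF abc(1)] by simp
    have "b = 2 * (psgn g * (p - h) - of_bool (odd g)) + 1" "c = 2 * (psgn h * (q - l))"
      using abc(2) \<open>odd a\<close> \<open>odd b\<close> by (auto simp: psgn_def split: if_splits)
    then show "\<exists>a. (a, 2 * (psgn g * (p - h) - of_bool (odd g)) + 1, 2 * (psgn h * (q - l))) \<in> K"
      using abc(1) by blast
  next
    assume "\<exists>a. (a, 2 * (psgn g * (p - h) - of_bool (odd g)) + 1, 2 * (psgn h * (q - l))) \<in> K"
    then obtain a where a: "(a, 2 * (psgn g * (p - h) - of_bool (odd g)) + 1, 2 * (psgn h * (q - l))) \<in> K"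
      by blast
    have "odd a" using par[OF a] by simp
    then have "(psgn l * a, 2 * p + 1, 2 * q) =
        ?f (a, 2 * (psgn g * (p - h) - of_bool (odd g)) + 1, 2 * (psgn h * (q - l)))"
      by (auto simp: psgn_def)
    then have "(psgn l * a, 2 * p + 1, 2 * q) \<in> ?K" using a by (rule image_eqI)
    then show "\<exists>a. (a, 2 * p + 1, 2 * q) \<in> ?K" by blast
  qed
  let ?V = "{(odd p, odd q) | p q. \<exists>a. (a, 2 * p + 1, 2 * q) \<in> K}"
  have 3: "{(odd p, odd q) | p q. \<exists>a. (a, 2 * p + 1, 2 * q) \<in> ?K} =
    (if even l then ?V else (\<lambda>(e, f). (\<not> e, \<not> f)) ` ?V)"
  proof -
    have "{(odd p, odd q) | p q. \<exists>a. (a, 2 * p + 1, 2 * q) \<in> ?K} =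
        {(odd p \<noteq> odd l, odd q \<noteq> odd l) | p q. \<exists>a. (a, 2 * p + 1, 2 * q) \<in> K}" (is "?A = ?B")
    proof
      show "?A \<subseteq> ?B"
      proof
        fix t assume "t \<in> ?A"
        then obtain p q where t: "t = (odd p, odd q)"
          "\<exists>a. (a, 2 * (psgn g * (p - h) - of_bool (odd g)) + 1, 2 * (psgn h * (q - l))) \<in> K"
          unfolding V by blast
        have "odd p \<longleftrightarrow> odd (psgn g * (p - h) - of_bool (odd g)) \<noteq> odd l"
          "odd q \<longleftrightarrow> odd (psgn h * (q - l)) \<noteq> odd l"
          using ghl by (auto simp: psgn_def)
        then show "t \<in> ?B" using t by blast
      qed
      show "?B \<subseteq> ?A"
      proof
        fix t assume "t \<in> ?B"
        then obtain a p q where t: "t = (odd p \<noteq> odd l, odd q \<noteq> odd l)" "(a, 2 * p + 1, 2 * q) \<in> K"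
          by blast
        let ?p = "psgn g * (p + of_bool (odd g)) + h" and ?q = "psgn h * q + l"
        have e: "psgn g * (?p - h) - of_bool (odd g) = p" "psgn h * (?q - l) = q"
          by (auto simp: psgn_def)
        have "\<exists>a. (a, 2 * ?p + 1, 2 * ?q) \<in> ?K" unfolding V e using t(2) by blast
        moreover have "odd ?p \<longleftrightarrow> odd p \<noteq> odd l" "odd ?q \<longleftrightarrow> odd q \<noteq> odd l"
          using ghl by (auto simp: psgn_def)
        ultimately show "t \<in> ?A" unfolding t(1) by blast
      qed
    qed
    also have "\<dots> = (if even l then ?V else (\<lambda>(e, f). (\<not> e, \<not> f)) ` ?V)"
    proof (cases "even l")
      case False
      have "(\<not> odd p, \<not> odd q) \<in> (\<lambda>(e, f). (\<not> e, \<not> f)) ` ?V"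
        if "(a, 2 * p + 1, 2 * q) \<in> K" for a p q
        using that by (intro image_eqI[of _ _ "(odd p, odd q)"]) auto
      then show ?thesis using False by auto
    qed simp
    finally show ?thesis .
  qed
  show ?thesis
    unfolding didicosm_conj_set[OF g Kc] xinv_def twist_def prod.case 1 2 3 by simp
qed

lemma conj_x_subgroups:
  assumes K: "K \<in> x_subgroups n" and g: "(g, h, l) \<in> carrier didicosm"
  shows "(g, h, l) <#\<^bsub>didicosm\<^esub> K #>\<^bsub>didicosm\<^esub> inv\<^bsub>didicosm\<^esub> (g, h, l) \<in> x_subgroups n"
    (is "?K \<in> _")
proof -
  have sub: "subgroup K didicosm" and third: "\<And>a b c. (a, b, c) \<in> K \<Longrightarrow> even c"
    and T: "\<not> K \<subseteq> transl"
    using K by (auto simp: x_subgroups_def)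
  have Kc: "K \<subseteq> carrier didicosm" using sub by (rule subgroup.subset)
  have 1: "subgroup ?K didicosm" "card (rcosets\<^bsub>didicosm\<^esub> ?K) = n"
    unfolding group.conj_coset_eq[OF group_didicosm]
    using image_subgroup_iso(1,2)[OF group_didicosm group_didicosm group.conj_iso[OF group_didicosm g] sub]
      K by (simp_all add: x_subgroups_def)
  have eq: "?K = (\<lambda>(a, b, c). (psgn l * a + (1 - psgn c) * g, psgn g * b + (1 - psgn a) * h,
      psgn h * c + (1 - psgn b) * l)) ` K" (is "_ = ?f ` K")
    by (rule didicosm_conj_set[OF g Kc])
  have "even w" if "(u, v, w) \<in> ?K" for u v w
    using that third unfolding eq by (auto simp: psgn_def split: if_splits)
  moreover obtain a b c where abc: "(a, b, c) \<in> K" "(a, b, c) \<notin> transl" using T by auto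
  then have "odd a" using third[OF abc(1)] Kc by (auto simp: transl_def didicosm_def)
  have "?f (a, b, c) \<in> ?K" unfolding eq using abc(1) by (rule imageI)
  moreover have "?f (a, b, c) \<notin> transl" using \<open>odd a\<close> by (auto simp: transl_def psgn_def)
  ultimately show ?thesis using 1 by (auto simp: x_subgroups_def)
qed

text \<open>On a half turn about the first axis, conjugation by the translation
  \<open>(0, g, h)\<close> adds \<open>(0, 2 * g, 2 * h)\<close>, which is \<open>(g, h)\<close> on
  the halved offset. As \<open>g\<close> and \<open>h\<close> are even, the offset moves by twice an
  integer vector.\<close>

lemma conj_xlat:
  assumes k: "odd k" and g: "even (g :: int)" "even h"
    and L: "(int x' - g - int x, int y' - h - int y) \<in> lat2 b z c"
  shows "(0, g, h) <#\<^bsub>didicosm\<^esub> xlat (k, b, c) (z, x, y) #>\<^bsub>didicosm\<^esub> inv\<^bsub>didicosm\<^esub> (0, g, h) =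
    xlat (k, b, c) (z, x', y')" (is "?L = ?R")
proof -
  have kp: "k > 0" using k by (rule odd_pos)
  let ?f = "\<lambda>(u, v, w). (u, v + (1 - psgn u) * g, w + (1 - psgn v) * h)"
  have "?L = ?f ` xlat (k, b, c) (z, x, y)"
  proof (subst didicosm_conj_set)
    show "xlat (k, b, c) (z, x, y) \<subseteq> carrier didicosm" by (rule subgroup.subset[OF subgroup_xlat[OF k]])
  qed (use g in \<open>simp_all add: didicosm_simps\<close>)
  also have "\<dots> = ?R"
  proof
    show "?f ` xlat (k, b, c) (z, x, y) \<subseteq> ?R"
    proof
      fix t assume "t \<in> ?f ` xlat (k, b, c) (z, x, y)"
      then obtain v where v: "v \<in> xlat (k, b, c) (z, x, y)" "t = ?f v" by blast
      show "t \<in> ?R"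
        using v(1)
      proof (cases rule: xlat_cases)
        case (even j p q)
        then have "t = (2 * (int k * j), 2 * p, 2 * q)" by (simp add: v(2))
        then show ?thesis using even(2) by (simp only: xlat_even_iff[OF kp])
      next
        case (odd j p q)
        have t: "t = (int k * (2 * j + 1), 2 * (p + g) + 1, 2 * (q + h))"
          using k by (simp add: v(2) odd(1))
        have "((p - int x) - (int x' - g - int x), (q - int y) - (int y' - h - int y)) \<in> lat2 b z c"
          by (rule lattice2_diff[OF lattice2_lat2 odd(2) L])
        then show ?thesis unfolding t xlat_odd_iff[OF kp] by (simp add: algebra_simps)
      qed
    qed
    show "?R \<subseteq> ?f ` xlat (k, b, c) (z, x, y)"
    proof
      fix t assume "t \<in> ?R"
      then show "t \<in> ?f ` xlat (k, b, c) (z, x, y)"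
      proof (cases rule: xlat_cases)
        case (even j p q)
        then have "t = ?f (2 * (int k * j), 2 * p, 2 * q)" by simp
        moreover have "(2 * (int k * j), 2 * p, 2 * q) \<in> xlat (k, b, c) (z, x, y)"
          using even(2) by (simp only: xlat_even_iff[OF kp])
        ultimately show ?thesis by (rule image_eqI)
      next
        case (odd j p q)
        then have "t = ?f (int k * (2 * j + 1), 2 * (p - g) + 1, 2 * (q - h))" using k by simp
        moreover have "(int k * (2 * j + 1), 2 * (p - g) + 1, 2 * (q - h)) \<in> xlat (k, b, c) (z, x, y)"
          unfolding xlat_odd_iff[OF kp]
          using lattice2_add[OF lattice2_lat2 odd(2) L] by (simp add: algebra_simps)
        ultimately show ?thesis by (rule image_eqI)
      qed
    qed
  qed
  finally show ?thesis .
qed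

text \<open>Equal invariants provide a vector \<open>(p, q)\<close> in the coset of \<open>K\<close>
  with the parities of \<open>(x', y')\<close>. The difference is even, so it is a translation to
  which \<open>conj_xlat\<close> applies.\<close>

lemma x_subgroups_conj_of_xinv_eq:
  assumes m: "m > 0" and K: "K \<in> x_subgroups (2 * m)" and L: "L \<in> x_subgroups (2 * m)"
    and eq: "xinv K = xinv L"
  shows "L \<in> conjugacy_class didicosm K"
proof -
  obtain s t where st: "s \<in> xlat_params m" "K = (\<lambda>(t, r). xlat t r) s"
    "t \<in> xlat_params m" "L = (\<lambda>(t, r). xlat t r) t"
    using K L unfolding x_subgroups_eq[OF m] by blast
  obtain k b c z x y where s: "s = ((k, b, c), (z, x, y))" "odd k" "b > 0" "c > 0" "z < c"
    using st(1) m by (rule xlat_paramsE)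
  obtain k' b' c' z' x' y' where t: "t = ((k', b', c'), (z', x', y'))" "odd k'" "b' > 0" "c' > 0" "z' < c'"
    using st(3) m by (rule xlat_paramsE)
  have K': "K = xlat (k, b, c) (z, x, y)" and L': "L = xlat (k', b', c') (z', x', y')"
    using st s t by simp_all
  have "{i. int k dvd i} = {i. int k' dvd i}" and lat: "lat2 b z c = lat2 b' z' c'"
    and V: "pcoset (lat2 b z c) (int x) (int y) = pcoset (lat2 b' z' c') (int x') (int y')"
    using eq unfolding K' L' xinv_xlat[OF s(2)] xinv_xlat[OF t(2)] prod.inject by blast+
  then have kk: "k' = k" using multiples_eq_imp_eq by metis
  have bzc: "b' = b \<and> z' = z \<and> c' = c" using lat2_inj[OF s(3) t(3) s(5) t(5) lat] by simp
  have "(int x' - int x', int y' - int y') \<in> lat2 b z c"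
    by (simp add: lattice2_zero lattice2_lat2)
  then have "(odd x', odd y') \<in> pcoset (lat2 b z c) (int x') (int y')"
    unfolding pcoset_def by (intro CollectI exI[of _ "int x'"] exI[of _ "int y'"]) simp
  then have "(odd x', odd y') \<in> pcoset (lat2 b z c) (int x) (int y)" using V bzc by simp
  then obtain p q where pq: "odd p \<longleftrightarrow> odd x'" "odd q \<longleftrightarrow> odd y'" "(p - int x, q - int y) \<in> lat2 b z c"
    unfolding pcoset_def by auto
  have g: "(0, int x' - p, int y' - q) \<in> carrier didicosm"
    using pq(1,2) by (auto simp: didicosm_simps)
  have "(0, int x' - p, int y' - q) <#\<^bsub>didicosm\<^esub> K #>\<^bsub>didicosm\<^esub>
      inv\<^bsub>didicosm\<^esub> (0, int x' - p, int y' - q) = xlat (k, b, c) (z, x', y')"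
    unfolding K' by (rule conj_xlat[OF s(2)]) (use pq in auto)
  then have "L = (0, int x' - p, int y' - q) <#\<^bsub>didicosm\<^esub> K #>\<^bsub>didicosm\<^esub>
      inv\<^bsub>didicosm\<^esub> (0, int x' - p, int y' - q)"
    using L' kk bzc by simp
  then show ?thesis unfolding conjugacy_class_def using g by blast
qed

lemma xinv_twist_mem:
  assumes "q \<in> xinv ` x_subgroups n"
  shows "twist q \<in> xinv ` x_subgroups n"
proof -
  obtain K where K: "q = xinv K" "K \<in> x_subgroups n" using assms by blast
  have g: "(0, 1, 1) \<in> carrier didicosm" by (simp add: didicosm_simps)
  show ?thesis using conj_xinv[OF K(2) g] conj_x_subgroups[OF K(2) g] K(1) by (metis image_eqI odd_one)
qed

lemma x_subgroups_conjugacy_iff: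
  assumes m: "m > 0" and K: "K \<in> x_subgroups (2 * m)" and L: "L \<in> x_subgroups (2 * m)"
  shows "conjugacy_class didicosm K = conjugacy_class didicosm L \<longleftrightarrow>
    {xinv K, twist (xinv K)} = {xinv L, twist (xinv L)}"
proof -
  have Kc: "K \<subseteq> carrier didicosm" "L \<subseteq> carrier didicosm"
    using K L by (auto simp: x_subgroups_def dest: subgroup.subset)
  note self = group.conjugacy_class_self[OF group_didicosm]
  note cong = group.conjugacy_class_eq[OF group_didicosm]
  show ?thesis
  proof
    assume "conjugacy_class didicosm K = conjugacy_class didicosm L"
    then have "L \<in> conjugacy_class didicosm K" using self[OF Kc(2)] by simp
    then obtain g h l where g: "(g, h, l) \<in> carrier didicosm"
      and L: "L = (g, h, l) <#\<^bsub>didicosm\<^esub> K #>\<^bsub>didicosm\<^esub> inv\<^bsub>didicosm\<^esub> (g, h, l)"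
      unfolding conjugacy_class_def by auto
    have "xinv L = xinv K \<or> xinv L = twist (xinv K)"
      unfolding L conj_xinv[OF K g] by simp
    then show "{xinv K, twist (xinv K)} = {xinv L, twist (xinv L)}"
      using twist_twist[of "xinv K"] by (elim disjE) (simp_all add: insert_commute)
  next
    assume "{xinv K, twist (xinv K)} = {xinv L, twist (xinv L)}"
    then have "xinv L = xinv K \<or> xinv L = twist (xinv K)" by blast
    then show "conjugacy_class didicosm K = conjugacy_class didicosm L"
    proof
      assume "xinv L = xinv K"
      then show ?thesis using x_subgroups_conj_of_xinv_eq[OF m K L] cong[OF Kc(1)] by simp
    next
      assume tw: "xinv L = twist (xinv K)"
      \<comment> \<open>The generator \<open>y\<close> has odd third coordinate and so realises
        \<open>twist\<close>.\<close>
      have g: "(0, 1, 1) \<in> carrier didicosm" by (simp add: didicosm_simps)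
      define K' where "K' = (0, 1, 1) <#\<^bsub>didicosm\<^esub> K #>\<^bsub>didicosm\<^esub> inv\<^bsub>didicosm\<^esub> (0, 1, 1)"
      have K': "K' \<in> x_subgroups (2 * m)" "xinv K' = xinv L" "K' \<in> conjugacy_class didicosm K"
        using conj_x_subgroups[OF K g] conj_xinv[OF K g] tw g
        unfolding K'_def conjugacy_class_def by auto
      have "K' \<subseteq> carrier didicosm" using K'(1) by (auto simp: x_subgroups_def dest: subgroup.subset)
      then show ?thesis
        using cong[OF Kc(1) K'(3)] cong[of K' L] x_subgroups_conj_of_xinv_eq[OF m K'(1) L K'(2)] by simp
    qed
  qed
qed

text \<open>Classes correspond to the orbits of the involution \<open>twist\<close> on the set of
  invariants. Burnside's lemma counts them with stabilisers of order 1 or 2.\<close>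

lemma card_conjugacy_classes_x_subgroups:
  assumes m: "m > 0"
  defines "Q \<equiv> xinv ` x_subgroups (2 * m)"
  shows "2 * card (conjugacy_class didicosm ` x_subgroups (2 * m)) =
    card Q + card {q \<in> Q. twist q = q}"
proof -
  have fin: "finite Q" using finite_x_subgroups[of "2 * m"] m by (simp add: Q_def)
  have "card (conjugacy_class didicosm ` x_subgroups (2 * m)) =
      card ((\<lambda>K. {xinv K, twist (xinv K)}) ` x_subgroups (2 * m))"
    by (rule card_image_eq_iff) (rule x_subgroups_conjugacy_iff[OF m])
  also have "(\<lambda>K. {xinv K, twist (xinv K)}) ` x_subgroups (2 * m) = (\<lambda>q. {q, twist q}) ` Q"
    by (simp add: Q_def image_image)
  also have "2 * card \<dots> = (\<Sum>q\<in>Q. 1 + of_bool (twist q = q))"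
  proof (rule card_partition_weighted[OF fin])
    fix q r assume q: "q \<in> Q"
    show "{q, twist q} \<subseteq> Q" using q xinv_twist_mem unfolding Q_def by blast
    show "card {q, twist q} * (1 + of_bool (twist q = q)) = 2" by (simp add: card_insert_if)
    show "{r, twist r} = {q, twist q}" if "r \<in> {q, twist q}"
      using that twist_twist[of q] by (auto simp: insert_commute)
  qed simp
  also have "\<dots> = card Q + card {q \<in> Q. twist q = q}"
    unfolding sum.distrib using fin by (simp add: Int_def)
  finally show ?thesis .
qed

text \<open>\<open>pgroup (odd b) (odd z) (odd c)\<close> is the reduction of \<open>lat2 b z c\<close> modulo 2, and \<open>pcosets\<close> are its
  cosets in \<open>(\<int>/2)\<^sup>2\<close>.\<close>

definition pgroup :: "bool \<Rightarrow> bool \<Rightarrow> bool \<Rightarrow> (bool \<times> bool) set" where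
  "pgroup B D C = {(False, False), (False, C), (B, D), (B, D \<noteq> C)}"

definition pshift :: "bool \<Rightarrow> bool \<Rightarrow> (bool \<times> bool) set \<Rightarrow> (bool \<times> bool) set" where
  "pshift e f H = (\<lambda>(u, v). (u \<noteq> e, v \<noteq> f)) ` H"

lemma pcoset_lat2: "pcoset (lat2 b z c) x y = pshift (odd x) (odd y) (pgroup (odd b) (odd z) (odd c))"
proof -
  have "pgroup (odd b) (odd z) (odd c) = {(odd p, odd q) | p q. (p, q) \<in> lat2 b z c}" (is "?L = ?R")
  proof
    have "(odd p, odd q) \<in> ?L" if "(p, q) \<in> lat2 b z c" for p q
      using that by (auto simp: lat2_def pgroup_def)
    then show "?R \<subseteq> ?L" by blast
    have 1: "(odd (int b * i), odd (int z * i + int c * j)) \<in> ?R" for i j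
      using lat2I by blast
    show "?L \<subseteq> ?R"
      using 1[of 0 0] 1[of 0 1] 1[of 1 0] 1[of 1 1] by (auto simp: pgroup_def)
  qed
  moreover have "pcoset (lat2 b z c) x y =
      (\<lambda>(u, v). (u \<noteq> odd x, v \<noteq> odd y)) ` {(odd p, odd q) | p q. (p, q) \<in> lat2 b z c}"
    (is "_ = ?f ` ?R")
  proof
    show "pcoset (lat2 b z c) x y \<subseteq> ?f ` ?R"
    proof
      fix t assume "t \<in> pcoset (lat2 b z c) x y"
      then obtain p q where pq: "t = (odd p, odd q)" "(p - x, q - y) \<in> lat2 b z c"
        by (auto simp: pcoset_def)
      have "(odd (p - x), odd (q - y)) \<in> ?R" using pq(2) by blast
      moreover have "t = ?f (odd (p - x), odd (q - y))" using pq(1) by auto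
      ultimately show "t \<in> ?f ` ?R" by (rule rev_image_eqI)
    qed
    show "?f ` ?R \<subseteq> pcoset (lat2 b z c) x y"
    proof
      fix t assume "t \<in> ?f ` ?R"
      then obtain p q where pq: "t = ?f (odd p, odd q)" "(p, q) \<in> lat2 b z c" by blast
      then have "t = (odd (p + x), odd (q + y))" "(p + x - x, q + y - y) \<in> lat2 b z c" by auto
      then show "t \<in> pcoset (lat2 b z c) x y" unfolding pcoset_def by blast
    qed
  qed
  ultimately show ?thesis unfolding pshift_def by (simp only:)
qed

definition pcosets :: "bool \<Rightarrow> bool \<Rightarrow> bool \<Rightarrow> (bool \<times> bool) set set" where
  "pcosets B D C = {pshift e f (pgroup B D C) | e f. True}"

lemma pcosets_eq: "pcosets B D C = {pshift False False (pgroup B D C), pshift False True (pgroup B D C),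
    pshift True False (pgroup B D C), pshift True True (pgroup B D C)}"
proof -
  have "pshift e f (pgroup B D C) \<in> {pshift False False (pgroup B D C), pshift False True (pgroup B D C),
    pshift True False (pgroup B D C), pshift True True (pgroup B D C)}" for e f
    by (cases e; cases f) simp_all
  then show ?thesis unfolding pcosets_def by blast
qed

text \<open>Four divided by the order of the span of \<open>(B, D)\<close> and
  \<open>(False, C)\<close> over the field with two elements.\<close>

lemma card_pcosets:
  "card (pcosets B D C) = (if B then if C then 1 else 2 else if C \<or> D then 2 else 4)"
proof -
  show ?thesis
    unfolding pcosets_eq pshift_def pgroup_def
    by (cases B; cases D; cases C; simp add: insert_commute card_insert_if doubleton_eq_iff)
qed

text \<open>Negating both bits adds \<open>(True, True)\<close>, which fixes a coset exactly when
  this vector lies in the span of \<open>(B, D)\<close> and \<open>(False, C)\<close>.\<close>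

lemma pcosets_negate:
  assumes "V \<in> pcosets B D C"
  shows "(\<lambda>(e, f). (\<not> e, \<not> f)) ` V = V \<longleftrightarrow> B \<and> (C \<or> D)"
proof -
  obtain e f where "V = pshift e f (pgroup B D C)" using assms by (auto simp: pcosets_def)
  then show ?thesis
    unfolding pshift_def pgroup_def
    by (cases B; cases D; cases C; cases e; cases f; simp add: insert_commute doubleton_eq_iff)
qed

lemma pcosets_lat2:
  assumes "b > 0" "c > 0"
  shows "pcosets (odd b) (odd z) (odd c) = {pcoset (lat2 b z c) (int x) (int y) | x y. x < b \<and> y < c}"
    (is "?L = ?R")
proof
  show "?R \<subseteq> ?L" unfolding pcosets_def pcoset_lat2 by blast
  have shift: "pcoset (lat2 b z c) x y \<in> ?R" for x y
  proof -
    obtain x' y' where xy: "x' < b" "y' < c" "(x - int x', y - int y') \<in> lat2 b z c"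
      using lat2_reduce[OF assms] by metis
    have "(p - x, q - y) \<in> lat2 b z c \<longleftrightarrow> (p - int x', q - int y') \<in> lat2 b z c" for p q
      using lattice2_add[OF lattice2_lat2 _ xy(3), of "p - x" "q - y"]
        lattice2_diff[OF lattice2_lat2 _ xy(3), of "p - int x'" "q - int y'"] by auto
    then have "pcoset (lat2 b z c) x y = pcoset (lat2 b z c) (int x') (int y')"
      unfolding pcoset_def by simp
    then show ?thesis using xy by blast
  qed
  show "?L \<subseteq> ?R"
  proof
    fix V assume "V \<in> ?L"
    then obtain e f where V: "V = pshift e f (pgroup (odd b) (odd z) (odd c))" by (auto simp: pcosets_def)
    have "V = pcoset (lat2 b z c) (of_bool e) (of_bool f)"
      unfolding V pcoset_lat2 by (cases e; cases f) simp_all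
    then show "V \<in> ?R" using shift by simp
  qed
qed

section \<open>Counting the invariants and the invariants fixed by \<open>twist\<close>\<close>

definition xinv_params :: "nat \<Rightarrow> ((nat \<times> nat \<times> nat) \<times> nat \<times> (bool \<times> bool) set) set" where
  "xinv_params m = (SIGMA t:{(k, b, c) \<in> triples m. odd k}. case t of (k, b, c) \<Rightarrow>
    SIGMA z:{..<c}. pcosets (odd b) (odd z) (odd c))"

definition xinv_of ::
  "(nat \<times> nat \<times> nat) \<times> nat \<times> (bool \<times> bool) set \<Rightarrow> int set \<times> (int \<times> int) set \<times> (bool \<times> bool) set"
  where "xinv_of = (\<lambda>((k, b, c), z, V). ({i. int k dvd i}, lat2 b z c, V))"

lemma xinv_image:
  assumes m: "m > 0"
  shows "xinv ` x_subgroups (2 * m) = xinv_of ` xinv_params m"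
proof
  show "xinv ` x_subgroups (2 * m) \<subseteq> xinv_of ` xinv_params m"
  proof
    fix q assume "q \<in> xinv ` x_subgroups (2 * m)"
    then obtain s where s': "s \<in> xlat_params m" "q = xinv ((\<lambda>(t, r). xlat t r) s)"
      unfolding x_subgroups_eq[OF m] by blast
    obtain k b c z x y where s: "s = ((k, b, c), (z, x, y))" "odd k" "b > 0" "c > 0" "k * b * c = m"
      "z < c" "x < b" "y < c" using s'(1) m by (rule xlat_paramsE)
    have "q = xinv_of ((k, b, c), z, pcoset (lat2 b z c) (int x) (int y))"
      using s'(2) by (simp add: s(1) xinv_xlat[OF s(2)] xinv_of_def)
    moreover have "pcoset (lat2 b z c) (int x) (int y) \<in> pcosets (odd b) (odd z) (odd c)"
      unfolding pcosets_lat2[OF s(3,4)] using s(7,8) by blast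
    then have "((k, b, c), z, pcoset (lat2 b z c) (int x) (int y)) \<in> xinv_params m"
      using s by (simp add: xinv_params_def triples_def)
    ultimately show "q \<in> xinv_of ` xinv_params m" by (rule image_eqI)
  qed
  show "xinv_of ` xinv_params m \<subseteq> xinv ` x_subgroups (2 * m)"
  proof
    fix q assume "q \<in> xinv_of ` xinv_params m"
    then obtain s where s': "s \<in> xinv_params m" "q = xinv_of s" by blast
    obtain k b c z V where s: "s = ((k, b, c), z, V)" by (cases s) auto
    have t: "(k, b, c) \<in> triples m" "odd k" "z < c" "V \<in> pcosets (odd b) (odd z) (odd c)"
      using s'(1) by (simp_all add: s xinv_params_def)
    have bc: "b > 0" "c > 0" using triples_pos[OF t(1) m] by simp_all
    obtain x y where xy: "x < b" "y < c" "V = pcoset (lat2 b z c) (int x) (int y)"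
      using t(4) unfolding pcosets_lat2[OF bc] by blast
    have "q = xinv (xlat (k, b, c) (z, x, y))"
      by (simp add: s'(2) s xy(3) xinv_xlat[OF t(2)] xinv_of_def)
    moreover have "xlat (k, b, c) (z, x, y) \<in> x_subgroups (2 * m)"
      using xlat_mem_x_subgroups[OF t(2) bc, of z x y] t(1) by (simp add: triples_def)
    ultimately show "q \<in> xinv ` x_subgroups (2 * m)" by (rule image_eqI)
  qed
qed

lemma xinv_of_inj:
  assumes m: "m > 0"
  shows "inj_on xinv_of (xinv_params m)"
proof (rule inj_onI)
  fix s s' assume ss: "s \<in> xinv_params m" "s' \<in> xinv_params m" and eq: "xinv_of s = xinv_of s'"
  obtain k b c z V where s: "s = ((k, b, c), z, V)" by (cases s) auto
  obtain k' b' c' z' V' where s': "s' = ((k', b', c'), z', V')" by (cases s') auto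
  have t: "(k, b, c) \<in> triples m" "z < c" "(k', b', c') \<in> triples m" "z' < c'"
    using ss by (simp_all add: s s' xinv_params_def)
  have "{i. int k dvd i} = {i. int k' dvd i}" "lat2 b z c = lat2 b' z' c'" "V = V'"
    using eq unfolding s s' xinv_of_def prod.case prod.inject by blast+
  then show "s = s'"
    using multiples_eq_imp_eq[of k k'] lat2_inj[of b b' z c z' c'] t triples_pos[OF t(1) m]
      triples_pos[OF t(3) m] by (simp add: s s')
qed

lemma finite_pcosets: "finite (pcosets B D C)"
  by (simp add: pcosets_eq)

text \<open>Only when \<open>b\<close> and \<open>c\<close> are both even does the number of cosets
  depend on \<open>z\<close>; odd and even \<open>z\<close> then contribute 2 and 4, on average
  3.\<close>

lemma sum_card_pcosets:
  assumes "c > 0"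
  shows "(\<Sum>z<c. card (pcosets (odd b) (odd z) (odd c))) =
    c * (1 + of_bool (even c) + of_bool (even (b :: nat)))"
proof -
  have "(\<Sum>z<2 * d. if odd z then 2 else 4 :: nat) = 6 * d" for d
    by (induction d) simp_all
  then have "(\<Sum>z<c. if odd z then 2 else 4 :: nat) = 3 * c" if "even c"
    using that by (auto elim!: evenE)
  then show ?thesis by (cases "odd b"; cases "odd c") (simp_all add: card_pcosets)
qed

lemma card_xinv_image:
  assumes m: "m > 0"
  shows "card (xinv ` x_subgroups (2 * m)) =
    (\<Sum>(k, b, c)\<in>triples m. of_bool (odd k) * (c * (1 + of_bool (even c) + of_bool (even b))))"
proof -
  have "card (xinv ` x_subgroups (2 * m)) = card (xinv_params m)"
    unfolding xinv_image[OF m] by (rule card_image[OF xinv_of_inj[OF m]])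
  also have "\<dots> = (\<Sum>t\<in>{(k, b, c) \<in> triples m. odd k}. card (case t of (k, b, c) \<Rightarrow>
      SIGMA z:{..<c}. pcosets (odd b) (odd z) (odd c)))"
    unfolding xinv_params_def
    by (rule card_SigmaI) (auto simp: finite_triples_odd_fst m intro!: finite_SigmaI finite_pcosets)
  also have "\<dots> = (\<Sum>(k, b, c)\<in>triples m. of_bool (odd k) *
      (c * (1 + of_bool (even c) + of_bool (even b))))"
    unfolding sum_triples_odd_fst[OF m]
  proof (rule sum.cong)
    fix t assume t: "t \<in> triples m"
    obtain k b c where kbc: "t = (k, b, c)" by (cases t)
    then have c: "c > 0" using t triples_pos m by blast
    have "card (SIGMA z:{..<c}. pcosets (odd b) (odd z) (odd c)) =
        (\<Sum>z<c. card (pcosets (odd b) (odd z) (odd c)))"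
      by (rule card_SigmaI) (simp_all add: finite_pcosets)
    then show "(case t of (k, b, c) \<Rightarrow> of_bool (odd k) * card (case (k, b, c) of (k, b, c) \<Rightarrow>
        SIGMA z:{..<c}. pcosets (odd b) (odd z) (odd c))) =
      (case t of (k, b, c) \<Rightarrow> of_bool (odd k) * (c * (1 + of_bool (even c) + of_bool (even b))))"
      using sum_card_pcosets[OF c] by (simp only: kbc prod.case)
  qed simp
  finally show ?thesis .
qed

text \<open>The reflected row \<open>(b, - z)\<close> differs from \<open>(b, z)\<close> by
  \<open>(0, - 2 z)\<close>, while the row \<open>(0, c)\<close> only changes sign.\<close>

lemma lat2_reflect_iff:
  assumes "b > 0"
  shows "(\<lambda>(p, q). (p, - q)) ` lat2 b z c = lat2 b z c \<longleftrightarrow> c dvd 2 * z" (is "?f ` ?L = ?L \<longleftrightarrow> _")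
proof -
  have iff: "c dvd 2 * z \<longleftrightarrow> (int b, - int z) \<in> ?L"
  proof -
    have "(int b * 1, - int z) \<in> ?L \<longleftrightarrow> int c dvd - int z - int z * 1"
      using lat2_iff[OF assms] .
    also have "\<dots> \<longleftrightarrow> int c dvd - int (2 * z)" by simp
    also have "\<dots> \<longleftrightarrow> c dvd 2 * z" by (simp only: dvd_minus_iff int_dvd_int_iff)
    finally show ?thesis by simp
  qed
  show ?thesis
  proof
    assume "?f ` ?L = ?L"
    moreover have "(int b, int z) \<in> ?L" using lat2I[of b 1 z c 0] by simp
    then have "(int b, - int z) \<in> ?f ` ?L" by (intro image_eqI[of _ _ "(int b, int z)"]) simp_all
    ultimately show "c dvd 2 * z" unfolding iff by simp
  next
    assume "c dvd 2 * z"
    then have z: "(int b, - int z) \<in> ?L" by (simp only: iff)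
    have 1: "?f t \<in> ?L" if "t \<in> ?L" for t
    proof -
      obtain i j where t: "t = (int b * i, int z * i + int c * j)" using \<open>t \<in> ?L\<close> by (auto simp: lat2_def)
      have "(i * int b + 0, i * (- int z) + int c * (- j)) \<in> ?L"
        using lattice2_add[OF lattice2_lat2 lattice2_mult[OF lattice2_lat2 z, of i] lat2I[of b 0 z c "- j"]]
        by simp
      then show ?thesis by (simp add: t algebra_simps)
    qed
    have "t \<in> ?f ` ?L" if "t \<in> ?L" for t
      using 1[OF that] by (intro image_eqI[of _ _ "?f t"]) (auto split: prod.splits)
    then show "?f ` ?L = ?L" using 1 by blast
  qed
qed

text \<open>For \<open>z < c\<close>, \<open>c dvd 2 * z\<close> means \<open>z = 0\<close> or
  \<open>2 * z = c\<close>. Invariance of the coset requires \<open>b\<close> odd and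
  \<open>c\<close> or \<open>z\<close> odd. So an odd \<open>c\<close> leaves \<open>z = 0\<close>
  with one coset, and an even \<open>c\<close> leaves \<open>z = c div 2\<close>, which must be odd,
  with two cosets.\<close>

lemma card_twist_invariant_fibre:
  fixes b c :: nat
  assumes "b > 0" "c > 0"
  shows "card {(z, V) \<in> (SIGMA z:{..<c}. pcosets (odd b) (odd z) (odd c)).
      c dvd 2 * z \<and> (\<lambda>(e, f). (\<not> e, \<not> f)) ` V = V} =
    of_bool (odd b) * (of_bool (odd c) + 2 * of_bool (even c \<and> odd (c div 2)))" (is "card ?A = _")
proof -
  let ?D = "{z \<in> {..<c}. c dvd 2 * z \<and> odd b \<and> (odd c \<or> odd z)}"
  have "?A = (SIGMA z:?D. pcosets (odd b) (odd z) (odd c))"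
  proof (rule Set.set_eqI)
    fix s :: "nat \<times> (bool \<times> bool) set"
    obtain z V where "s = (z, V)" by (cases s)
    then show "s \<in> ?A \<longleftrightarrow> s \<in> (SIGMA z:?D. pcosets (odd b) (odd z) (odd c))"
      using pcosets_negate[of V "odd b" "odd z" "odd c"]
      by (cases "V \<in> pcosets (odd b) (odd z) (odd c)") simp_all
  qed
  then have "card ?A = (\<Sum>z\<in>?D. card (pcosets (odd b) (odd z) (odd c)))"
    by (simp only:) (rule card_SigmaI; simp add: finite_pcosets)
  also have "?D = (if odd b then if odd c then {0} else if odd (c div 2) then {c div 2} else {} else {})"
  proof (rule Set.set_eqI)
    fix z
    have "c dvd 2 * z \<longleftrightarrow> z = 0 \<or> (even c \<and> z = c div 2)" if "z < c"
    proof
      assume "c dvd 2 * z"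
      then obtain j where j: "2 * z = c * j" by (elim dvdE)
      then have "c * j < c * 2" using that by linarith
      then have "j < 2" using assms(2) by (metis mult_less_cancel1)
      then have "j = 0 \<or> j = 1" by auto
      then show "z = 0 \<or> (even c \<and> z = c div 2)"
      proof
        assume "j = 1"
        then have "c = 2 * z" using j by simp
        then show ?thesis by simp
      qed (use j in simp)
    qed auto
    then show "z \<in> ?D \<longleftrightarrow>
        z \<in> (if odd b then if odd c then {0} else if odd (c div 2) then {c div 2} else {} else {})"
      using assms(2) by auto
  qed
  also have "(\<Sum>z\<in>\<dots>. card (pcosets (odd b) (odd z) (odd c))) =
      of_bool (odd b) * (of_bool (odd c) + 2 * of_bool (even c \<and> odd (c div 2)))"
    by (simp add: card_pcosets)
  finally show ?thesis .
qed

lemma card_twist_invariant: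
  assumes m: "m > 0"
  shows "card {q \<in> xinv ` x_subgroups (2 * m). twist q = q} =
    (\<Sum>(k, b, c)\<in>triples m. of_bool (odd k) *
      (of_bool (odd b) * (of_bool (odd c) + 2 * of_bool (even c \<and> odd (c div 2)))))"
proof -
  let ?F = "\<lambda>(b :: nat) (c :: nat). {(z, V) \<in> (SIGMA z:{..<c}. pcosets (odd b) (odd z) (odd c)).
      c dvd 2 * z \<and> (\<lambda>(e, f). (\<not> e, \<not> f)) ` V = V}"
  let ?P = "{s \<in> xinv_params m. twist (xinv_of s) = xinv_of s}"
  have "{q \<in> xinv ` x_subgroups (2 * m). twist q = q} = xinv_of ` ?P"
    unfolding xinv_image[OF m] by blast
  then have "card {q \<in> xinv ` x_subgroups (2 * m). twist q = q} = card ?P"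
    by (simp only:) (rule card_image, rule inj_on_subset[OF xinv_of_inj[OF m]], blast)
  also have "?P = (SIGMA t:{(k, b, c) \<in> triples m. odd k}. case t of (k, b, c) \<Rightarrow> ?F b c)"
  proof (rule Set.set_eqI)
    fix s :: "(nat \<times> nat \<times> nat) \<times> nat \<times> (bool \<times> bool) set"
    obtain k b c z V where s: "s = ((k, b, c), z, V)" by (cases s) auto
    show "s \<in> ?P \<longleftrightarrow> s \<in> (SIGMA t:{(k, b, c) \<in> triples m. odd k}. case t of (k, b, c) \<Rightarrow> ?F b c)"
    proof (cases "(k, b, c) \<in> triples m")
      case True
      then have "b > 0" using triples_pos m by blast
      then show ?thesis
        by (simp add: s xinv_params_def xinv_of_def twist_def lat2_reflect_iff)
    qed (simp add: s xinv_params_def)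
  qed
  also have "card \<dots> = (\<Sum>t\<in>{(k, b, c) \<in> triples m. odd k}. card (case t of (k, b, c) \<Rightarrow> ?F b c))"
  proof (rule card_SigmaI)
    have "finite (?F b c)" for b c
      by (rule finite_subset[of _ "SIGMA z:{..<c}. pcosets (odd b) (odd z) (odd c)"])
        (auto intro: finite_SigmaI finite_pcosets)
    then show "\<forall>t\<in>{(k, b, c) \<in> triples m. odd k}. finite (case t of (k, b, c) \<Rightarrow> ?F b c)"
      by (simp add: case_prod_unfold)
  qed (simp add: finite_triples_odd_fst m)
  also have "\<dots> = (\<Sum>(k, b, c)\<in>triples m. of_bool (odd k) *
      (of_bool (odd b) * (of_bool (odd c) + 2 * of_bool (even c \<and> odd (c div 2)))))"
    unfolding sum_triples_odd_fst[OF m]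
  proof (rule sum.cong)
    fix t assume t: "t \<in> triples m"
    obtain k b c where kbc: "t = (k, b, c)" by (cases t)
    then have "b > 0" "c > 0" using t triples_pos m by blast+
    then show "(case t of (k, b, c) \<Rightarrow> of_bool (odd k) * card (case (k, b, c) of (k, b, c) \<Rightarrow> ?F b c)) =
      (case t of (k, b, c) \<Rightarrow> of_bool (odd k) *
        (of_bool (odd b) * (of_bool (odd c) + 2 * of_bool (even c \<and> odd (c div 2)))))"
      by (simp only: kbc prod.case card_twist_invariant_fibre)
  qed simp
  finally show ?thesis .
qed

section \<open>Subgroups with full holonomy\<close>

text \<open>On each axis the group acts by an infinite dihedral group. Elements with even third
  coordinate translate the first axis, those with odd third coordinate reflect it;
  \<open>flat\<close> prescribes the residue 0 for the former and \<open>p\<close> for the latter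
  modulo \<open>k\<close>, and cyclically for the other axes.\<close>

definition flat :: "nat \<times> nat \<times> nat \<Rightarrow> int \<times> int \<times> int \<Rightarrow> (int \<times> int \<times> int) set" where
  "flat = (\<lambda>(k, l, m) (p, q, r). {(a, b, c). even (a + b + c) \<and> int k dvd a - of_bool (odd c) * p \<and>
    int l dvd b - of_bool (odd a) * q \<and> int m dvd c - of_bool (odd b) * r})"

lemma flat_iff:
  "(a, b, c) \<in> flat (k, l, m) (p, q, r) \<longleftrightarrow> even (a + b + c) \<and> int k dvd a - of_bool (odd c) * p \<and>
    int l dvd b - of_bool (odd a) * q \<and> int m dvd c - of_bool (odd b) * r"
  by (simp add: flat_def)

text \<open>Odd factors preserve parities and hence all signs, so scaling the three axes separately
  is compatible with the product.\<close>

lemma flat_scaling_iso: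
  assumes odd: "odd k" "odd l" "odd m"
  shows "(\<lambda>(a, b, c). (int k * a, int l * b, int m * c)) \<in>
    iso didicosm (didicosm\<lparr>carrier := flat (k, l, m) (0, 0, 0)\<rparr>)"
proof (rule isoI)
  let ?f = "\<lambda>(a, b, c). (int k * a, int l * b, int m * c)"
  have pos: "k > 0" "l > 0" "m > 0" using odd odd_pos by blast+
  have par: "even (int k * a) \<longleftrightarrow> even a" "even (int l * a) \<longleftrightarrow> even a" "even (int m * a) \<longleftrightarrow> even a" for a
    using odd by simp_all
  show "?f \<in> hom didicosm (didicosm\<lparr>carrier := flat (k, l, m) (0, 0, 0)\<rparr>)"
  proof (rule homI)
    fix u assume "u \<in> carrier didicosm"
    then show "?f u \<in> carrier (didicosm\<lparr>carrier := flat (k, l, m) (0, 0, 0)\<rparr>)"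
      using odd by (auto simp: didicosm_def flat_def)
  next
    fix u v
    show "?f (u \<otimes>\<^bsub>didicosm\<^esub> v) = ?f u \<otimes>\<^bsub>didicosm\<lparr>carrier := flat (k, l, m) (0, 0, 0)\<rparr>\<^esub> ?f v"
      using odd by (cases u; cases v) (simp add: didicosm_simps psgn_def algebra_simps)
  qed
  show "bij_betw ?f (carrier didicosm) (carrier (didicosm\<lparr>carrier := flat (k, l, m) (0, 0, 0)\<rparr>))"
  proof (rule bij_betw_imageI)
    show "inj_on ?f (carrier didicosm)" using pos by (auto simp: inj_on_def)
    show "?f ` carrier didicosm = carrier (didicosm\<lparr>carrier := flat (k, l, m) (0, 0, 0)\<rparr>)"
    proof
      show "?f ` carrier didicosm \<subseteq> carrier (didicosm\<lparr>carrier := flat (k, l, m) (0, 0, 0)\<rparr>)"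
        using odd by (auto simp: didicosm_def flat_def)
      show "carrier (didicosm\<lparr>carrier := flat (k, l, m) (0, 0, 0)\<rparr>) \<subseteq> ?f ` carrier didicosm"
      proof
        fix v assume v: "v \<in> carrier (didicosm\<lparr>carrier := flat (k, l, m) (0, 0, 0)\<rparr>)"
        then obtain a b c where abc: "v = (int k * a, int l * b, int m * c)"
          by (auto simp: flat_def elim!: dvdE)
        then have "(a, b, c) \<in> carrier didicosm" using v odd by (simp add: flat_def didicosm_simps)
        then show "v \<in> ?f ` carrier didicosm" using abc by (intro image_eqI) auto
      qed
    qed
  qed
qed

lemma subgroup_flat_zero:
  assumes "odd k" "odd l" "odd m"
  shows "subgroup (flat (k, l, m) (0, 0, 0)) didicosm" (is "subgroup ?K _")
proof (rule group.subgroupI[OF group_didicosm])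
  show "?K \<subseteq> carrier didicosm" by (auto simp: flat_def didicosm_def)
  have "(0, 0, 0) \<in> ?K" by (simp add: flat_iff)
  then show "?K \<noteq> {}" by blast
  fix u v assume u: "u \<in> ?K"
  obtain a b c where abc: "u = (a, b, c)" by (cases u)
  then have "even (a + b + c)" using u by (simp add: flat_def)
  then show "inv\<^bsub>didicosm\<^esub> u \<in> ?K" using u by (simp only: abc inv_didicosm) (auto simp: flat_def psgn_def)
  assume v: "v \<in> ?K"
  obtain a' b' c' where "v = (a', b', c')" by (cases v)
  then show "u \<otimes>\<^bsub>didicosm\<^esub> v \<in> ?K" using u v abc by (auto simp: flat_def didicosm_simps psgn_def)
qed

text \<open>A residue and its shift by the odd number \<open>k\<close> have different parities, so
  one of them is even.\<close>

lemma even_residue: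
  assumes "odd k"
  obtains s :: int where "even s" "0 \<le> s" "s < 2 * int k" "int k dvd x - s"
proof -
  have r: "x mod int k < int k" "0 \<le> x mod int k" using odd_pos[OF assms] by simp_all
  show thesis
  proof (cases "even (x mod int k)")
    case True
    then show thesis using that[of "x mod int k"] r by (simp add: dvd_minus_mod)
  next
    case False
    have "int k dvd (x - x mod int k) - int k"
      by (rule dvd_diff) (simp_all add: dvd_minus_mod)
    then have "int k dvd x - (x mod int k + int k)" by (simp add: diff_diff_eq)
    then show thesis using that[of "x mod int k + int k"] False assms r by simp
  qed
qed

text \<open>Even translations suffice as representatives: since \<open>k\<close>, \<open>l\<close>,
  \<open>m\<close> are odd, even numbers below twice the modulus reach every residue.\<close>

lemma index_flat_zero:
  assumes odd: "odd k" "odd l" "odd m"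
  shows "card (rcosets\<^bsub>didicosm\<^esub> (flat (k, l, m) (0, 0, 0))) = k * l * m"
proof -
  let ?K = "flat (k, l, m) (0, 0, 0)"
  let ?S = "(\<lambda>(i, j, h). (2 * i, 2 * j, 2 * h)) ` ({0..<int k} \<times> {0..<int l} \<times> {0..<int m})"
  have memS: "(a, b, c) \<in> ?S \<longleftrightarrow> even a \<and> even b \<and> even c \<and> 0 \<le> a \<and> a < 2 * int k \<and>
    0 \<le> b \<and> b < 2 * int l \<and> 0 \<le> c \<and> c < 2 * int m" for a b c
  proof
    assume "even a \<and> even b \<and> even c \<and> 0 \<le> a \<and> a < 2 * int k \<and>
      0 \<le> b \<and> b < 2 * int l \<and> 0 \<le> c \<and> c < 2 * int m"
    then show "(a, b, c) \<in> ?S"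
      by (intro image_eqI[of _ _ "(a div 2, b div 2, c div 2)"]) auto
  qed auto
  have "card (rcosets\<^bsub>didicosm\<^esub> ?K) = card ?S"
  proof (rule group.card_rcosets_transversal[OF group_didicosm subgroup_flat_zero[OF odd]])
    show "?S \<subseteq> carrier didicosm" by (auto simp: didicosm_simps)
  next
    fix v assume "v \<in> carrier didicosm"
    then obtain a b c where v: "v = (a, b, c)" "even (a + b + c)"
      by (cases v) (auto simp: didicosm_simps)
    obtain s1 where s1: "even s1" "0 \<le> s1" "s1 < 2 * int k" "int k dvd psgn c * a - s1"
      using even_residue[OF odd(1)] .
    obtain s2 where s2: "even s2" "0 \<le> s2" "s2 < 2 * int l" "int l dvd psgn a * b - s2"
      using even_residue[OF odd(2)] .
    obtain s3 where s3: "even s3" "0 \<le> s3" "s3 < 2 * int m" "int m dvd psgn b * c - s3"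
      using even_residue[OF odd(3)] .
    let ?s = "(s1, s2, s3)" and ?g = "(a - psgn c * s1, b - psgn a * s2, c - psgn b * s3)"
    have flip: "int n dvd x - psgn y * s" if "int n dvd psgn y * x - s" for n x y s
      using that dvd_minus_iff[of "int n" "- x - s"] by (cases "even y") (simp_all add: add.commute)
    have "?g \<in> ?K"
      unfolding flat_iff using s1 s2 s3 v(2) flip by simp
    moreover have "?s \<in> ?S" unfolding memS using s1 s2 s3 by simp
    moreover have "v = ?g \<otimes>\<^bsub>didicosm\<^esub> ?s"
      using s1(1) s2(1) s3(1) by (simp add: v didicosm_simps psgn_def)
    ultimately show "\<exists>s\<in>?S. \<exists>g\<in>?K. v = g \<otimes>\<^bsub>didicosm\<^esub> s" by blast
  next
    fix s s' g assume s: "s \<in> ?S" "s' \<in> ?S" and g: "g \<in> ?K" and eq: "s = g \<otimes>\<^bsub>didicosm\<^esub> s'"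
    obtain g1 g2 g3 where g': "g = (g1, g2, g3)" by (cases g)
    obtain u v w where s': "s' = (u, v, w)" by (cases s')
    obtain u' v' w' where s'': "s = (u', v', w')" by (cases s)
    note S = s(1)[unfolded s'' memS] s(2)[unfolded s' memS]
    have e: "u' = g1 + psgn g3 * u" "v' = g2 + psgn g1 * v" "w' = g3 + psgn g2 * w"
      using eq by (simp_all add: s'' g' s' didicosm_simps)
    then have ev: "even g1" "even g2" "even g3" using S by (auto simp: psgn_def split: if_splits)
    \<comment> \<open>An even multiple of an odd \<open>n\<close> is a multiple of
      \<open>2 * n\<close>, so it cannot be nonzero and this short.\<close>
    have "x = 0" if "int n dvd x" "even x" "\<bar>x\<bar> < 2 * int n" "odd n" for n and x :: int
    proof -
      obtain y where y: "x = 2 * y" using \<open>even x\<close> by (elim evenE)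
      have "coprime (int n) 2" using \<open>odd n\<close> by simp
      then have "int n dvd y" using that(1) y by (simp add: coprime_dvd_mult_right_iff)
      moreover have "\<bar>y\<bar> < int n" using that(3) y by simp
      ultimately show "x = 0" using y by (simp add: abs_less_dvd_imp_0)
    qed
    note zero = this
    have "g1 = 0" using g ev e(1) S odd(1) by (intro zero[of k]) (auto simp: g' flat_iff)
    moreover have "g2 = 0" using g ev e(2) S odd(2) by (intro zero[of l]) (auto simp: g' flat_iff)
    moreover have "g3 = 0" using g ev e(3) S odd(3) by (intro zero[of m]) (auto simp: g' flat_iff)
    ultimately show "s = s'" using e by (simp add: s' s'')
  qed
  also have "card ?S = k * l * m"
  proof -
    have "inj_on (\<lambda>(i, j, h). (2 * i, 2 * j, 2 * h :: int)) ({0..<int k} \<times> {0..<int l} \<times> {0..<int m})"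
      by (auto simp: inj_on_def)
    then show ?thesis by (simp add: card_image)
  qed
  finally show ?thesis .
qed

text \<open>Conjugation by a translation adds twice its vector on the negated axes, here
  \<open>4 * \<alpha>\<close> to the first coordinate of the elements with odd third coordinate, and
  cyclically.\<close>

lemma conj_flat_zero:
  "(2 * \<alpha>, 2 * \<beta>, 2 * \<gamma>) <#\<^bsub>didicosm\<^esub> flat (k, l, m) (0, 0, 0) #>\<^bsub>didicosm\<^esub>
     inv\<^bsub>didicosm\<^esub> (2 * \<alpha>, 2 * \<beta>, 2 * \<gamma>) = flat (k, l, m) (4 * \<alpha>, 4 * \<beta>, 4 * \<gamma>)" (is "?L = ?R")
proof -
  let ?K = "flat (k, l, m) (0, 0, 0)"
  let ?f = "\<lambda>(a, b, c). (a + of_bool (odd c) * (4 * \<alpha>), b + of_bool (odd a) * (4 * \<beta>),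
    c + of_bool (odd b) * (4 * \<gamma>))"
  have "?L = ?f ` ?K"
  proof (subst didicosm_conj_set)
    show "?K \<subseteq> carrier didicosm" by (auto simp: flat_def didicosm_def)
  qed (auto simp: didicosm_simps psgn_def intro!: image_cong)
  also have "\<dots> = ?R"
  proof
    show "?f ` ?K \<subseteq> ?R" by (auto simp: flat_def)
    show "?R \<subseteq> ?f ` ?K"
    proof
      fix v assume v: "v \<in> ?R"
      obtain a b c where abc: "v = (a, b, c)" by (cases v)
      let ?v = "(a - of_bool (odd c) * (4 * \<alpha>), b - of_bool (odd a) * (4 * \<beta>),
        c - of_bool (odd b) * (4 * \<gamma>))"
      have "?v \<in> ?K" using v unfolding abc flat_iff by simp
      moreover have "v = ?f ?v" by (simp add: abc)
      ultimately show "v \<in> ?f ` ?K" by (rule rev_image_eqI)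
    qed
  qed
  finally show ?thesis .
qed

lemma flat_cong:
  assumes "int k dvd p - p'" "int l dvd q - q'" "int m dvd r - r'"
  shows "flat (k, l, m) (p, q, r) = flat (k, l, m) (p', q', r')"
proof -
  have "int k dvd x - of_bool P * p \<longleftrightarrow> int k dvd x - of_bool P * p'" if "int k dvd p - p'"
    for k x P p p'
    using that dvd_add_right_iff[of "int k" "p - p'" "x - p"] by (cases P) simp_all
  then show ?thesis unfolding flat_def using assms by simp
qed

text \<open>Modulo \<open>k = 2 * j + 1\<close> the inverse of 2 is \<open>j + 1\<close>, so that of
  4 is its square.\<close>

lemma quarter_mod_odd:
  assumes "odd k"
  obtains \<alpha> :: int where "int k dvd p - 4 * \<alpha>"
proof -
  obtain j where j: "k = 2 * j + 1" using assms by (elim oddE)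
  have "p - 4 * (p * (int j + 1)^2) = int k * (- p * (int k + 2))"
    by (simp add: j power2_eq_square algebra_simps)
  then show thesis using that[of "p * (int j + 1)^2"] by simp
qed

text \<open>Every residue modulo an odd number is a multiple of 4, so conjugation by a translation
  removes \<open>p\<close>, \<open>q\<close> and \<open>r\<close>. This is why the conjugacy classes
  depend on \<open>k\<close>, \<open>l\<close>, \<open>m\<close> alone.\<close>

lemma flat_conj_flat_zero:
  assumes "odd k" "odd l" "odd m"
  obtains g where "g \<in> carrier didicosm"
    "flat (k, l, m) (p, q, r) = g <#\<^bsub>didicosm\<^esub> flat (k, l, m) (0, 0, 0) #>\<^bsub>didicosm\<^esub> inv\<^bsub>didicosm\<^esub> g"
proof -
  obtain \<alpha> \<beta> \<gamma> where "int k dvd p - 4 * \<alpha>" "int l dvd q - 4 * \<beta>" "int m dvd r - 4 * \<gamma>"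
    using quarter_mod_odd assms by metis
  then have "flat (k, l, m) (p, q, r) = flat (k, l, m) (4 * \<alpha>, 4 * \<beta>, 4 * \<gamma>)" by (rule flat_cong)
  then show thesis using that[of "(2 * \<alpha>, 2 * \<beta>, 2 * \<gamma>)"] conj_flat_zero
    by (simp add: didicosm_simps)
qed

lemma flat_properties:
  assumes odd: "odd k" "odd l" "odd m"
  shows "subgroup (flat (k, l, m) (p, q, r)) didicosm"
    and "card (rcosets\<^bsub>didicosm\<^esub> (flat (k, l, m) (p, q, r))) = k * l * m"
    and "didicosm\<lparr>carrier := flat (k, l, m) (p, q, r)\<rparr> \<cong> didicosm"
proof -
  let ?K = "flat (k, l, m) (0, 0, 0)"
  obtain g where g: "g \<in> carrier didicosm"
    "flat (k, l, m) (p, q, r) = g <#\<^bsub>didicosm\<^esub> ?K #>\<^bsub>didicosm\<^esub> inv\<^bsub>didicosm\<^esub> g"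
    using flat_conj_flat_zero[OF odd] .
  note img = image_subgroup_iso[OF group_didicosm group_didicosm group.conj_iso[OF group_didicosm g(1)]
      subgroup_flat_zero[OF odd], folded group.conj_coset_eq[OF group_didicosm] g(2)]
  show sub: "subgroup (flat (k, l, m) (p, q, r)) didicosm" by (rule img(1))
  show "card (rcosets\<^bsub>didicosm\<^esub> (flat (k, l, m) (p, q, r))) = k * l * m"
    unfolding img(2) by (rule index_flat_zero[OF odd])
  have "didicosm \<cong> didicosm\<lparr>carrier := flat (k, l, m) (p, q, r)\<rparr>"
    using is_isoI[OF flat_scaling_iso[OF odd]] img(3) by (rule iso_trans)
  then show "didicosm\<lparr>carrier := flat (k, l, m) (p, q, r)\<rparr> \<cong> didicosm"
    by (rule group.iso_sym[OF group_didicosm])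
qed

text \<open>Elements with even third coordinate translate the first axis, so their first coordinates
  form a group, generated by \<open>k\<close>; the element \<open>x\<close> makes \<open>k\<close>
  odd. The quotient of two elements with odd third coordinate is such a translation, so their first
  coordinates agree modulo \<open>k\<close>.\<close>

lemma full_subgroup_first_coordinate:
  assumes K: "subgroup K didicosm" and x: "(x1, x2, x3) \<in> K" "odd x1" "even x3"
    and y: "(y1, y2, y3) \<in> K" "odd y3"
  obtains k where "odd k" "(2 * int k, 0, 0) \<in> K"
    "\<And>a b c. (a, b, c) \<in> K \<Longrightarrow> int k dvd a - of_bool (odd c) * y1"
proof -
  note m = subgroup.m_closed[OF K] and inv = subgroup.m_inv_closed[OF K]
  have Kc: "even (a + b + c)" if "(a, b, c) \<in> K" for a b c
    using subgroup.subset[OF K] that by (auto simp: didicosm_def)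
  define I where "I = {a. \<exists>b c. (a, b, c) \<in> K \<and> even c}"
  have quot: "a - a' \<in> I" if K2: "(a, b, c) \<in> K" "(a', b', c') \<in> K" and par: "even c = even c'"
    for a b c a' b' c'
  proof -
    have "(a, b, c) \<otimes>\<^bsub>didicosm\<^esub> inv\<^bsub>didicosm\<^esub> (a', b', c') =
        (a - a', b + psgn a * (- psgn a' * b'), c + psgn b * (- psgn b' * c'))"
      using par by (cases "even c") (simp_all add: inv_didicosm[OF Kc[OF K2(2)]] didicosm_simps)
    moreover have "even (c + psgn b * (- psgn b' * c'))" using par by (simp add: psgn_def)
    ultimately have "\<exists>b c. (a - a', b, c) \<in> K \<and> even c" using m[OF K2(1) inv[OF K2(2)]] by metis
    then show ?thesis by (simp add: I_def)
  qed
  have diff: "a - a' \<in> I" if I2: "a \<in> I" "a' \<in> I" for a a'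
    using I2 quot unfolding I_def by blast
  have "x1 \<in> I" "x1 \<noteq> 0" using x by (auto simp: I_def)
  obtain k where k: "k > 0" "I = {i. int k dvd i}"
    using int_subgroup_multiples[of I x1, OF diff \<open>x1 \<in> I\<close> \<open>x1 \<noteq> 0\<close>] by blast
  have "int k dvd x1" using \<open>x1 \<in> I\<close> unfolding k(2) by simp
  then have "odd k" using x(2) by (metis dvd_trans even_of_nat)
  have "int k \<in> I" by (simp add: k(2))
  then obtain b c where g: "(int k, b, c) \<in> K" "even c" by (auto simp: I_def)
  have "odd b" using Kc[OF g(1)] g(2) \<open>odd k\<close> by simp
  \<comment> \<open>An element over \<open>k\<close> with even third coordinate is a half turn about
    the first axis; squaring it cancels the other two coordinates.\<close>
  then have "(2 * int k, 0, 0) \<in> K"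
    using m[OF g(1) g(1)] g(2) \<open>odd k\<close> by (simp add: didicosm_simps)
  moreover have "int k dvd a - of_bool (odd c) * y1" if abc: "(a, b, c) \<in> K" for a b c
  proof (cases "even c")
    case True
    then have "a \<in> I" using abc by (auto simp: I_def)
    then show ?thesis unfolding k(2) using True by simp
  next
    case False
    then have "a - y1 \<in> I" using quot[OF abc y(1)] y(2) by simp
    then show ?thesis unfolding k(2) using False by simp
  qed
  ultimately show thesis using that \<open>odd k\<close> by blast
qed

text \<open>The analysis of one axis, applied to \<open>K\<close> and its two rotations, gives
  \<open>K \<subseteq> ?F\<close>. Conversely, an element of \<open>?F\<close> has the parities of
  some element of \<open>K\<close>, and their quotient is a translation by even multiples of
  \<open>k\<close>, \<open>l\<close>, \<open>m\<close>, which lies in \<open>K\<close>.\<close>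

lemma full_subgroup_eq_flat:
  assumes K: "subgroup K didicosm"
    and full: "(a1, b1, c1) \<in> K" "odd a1" "(a2, b2, c2) \<in> K" "odd b2" "(a3, b3, c3) \<in> K" "odd c3"
  obtains k l m p q r where "odd k" "odd l" "odd m" "K = flat (k, l, m) (p, q, r)"
proof -
  note mult = subgroup.m_closed[OF K] and inv = subgroup.m_inv_closed[OF K]
  have Kc: "even (a + b + c)" if "(a, b, c) \<in> K" for a b c
    using subgroup.subset[OF K] that by (auto simp: didicosm_def)
  have mult': "\<exists>a'' b'' c''. (a'', b'', c'') \<in> K \<and> even a'' = (even a = even a') \<and>
      even b'' = (even b = even b') \<and> even c'' = (even c = even c')"
    if "(a, b, c) \<in> K" "(a', b', c') \<in> K" for a b c a' b' c'
  proof -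
    have "(a + psgn c * a', b + psgn a * b', c + psgn b * c') \<in> K"
      using mult[OF that] by (simp add: didicosm_simps)
    moreover have "even (u + psgn w * v) \<longleftrightarrow> even u = even v" for u v w
      by (auto simp: psgn_def)
    ultimately show ?thesis by metis
  qed
  \<comment> \<open>Odd \<open>a1\<close> means type \<open>x\<close> or \<open>z\<close>, odd
    \<open>b2\<close> means type \<open>x\<close> or \<open>y\<close>: one of the two elements is of
    type \<open>x\<close>, or their product is.\<close>
  have "\<exists>a b c. (a, b, c) \<in> K \<and> odd a \<and> odd b \<and> even c"
    using full(1-4) Kc[OF full(1)] Kc[OF full(3)] mult'[OF full(1,3)] by auto
  then obtain x1 x2 x3 where x: "(x1, x2, x3) \<in> K" "odd x1" "odd x2" "even x3" by blast
  have "\<exists>a b c. (a, b, c) \<in> K \<and> even a \<and> odd b \<and> odd c"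
    using full(3-6) Kc[OF full(3)] Kc[OF full(5)] mult'[OF full(3,5)] by auto
  then obtain y1 y2 y3 where y: "(y1, y2, y3) \<in> K" "even y1" "odd y2" "odd y3" by blast
  have "\<exists>a b c. (a, b, c) \<in> K \<and> odd a \<and> even b \<and> odd c"
    using full(1,2,5,6) Kc[OF full(1)] Kc[OF full(5)] mult'[OF full(1,5)] by auto
  then obtain z1 z2 z3 where z: "(z1, z2, z3) \<in> K" "odd z1" "even z2" "odd z3" by blast
  have rotK: "subgroup (rot ` K) didicosm"
    by (rule image_subgroup_iso(1)[OF group_didicosm group_didicosm rot_iso K])
  have rotrotK: "subgroup (rot ` rot ` K) didicosm"
    by (rule image_subgroup_iso(1)[OF group_didicosm group_didicosm rot_iso rotK])
  have rot1: "(c, a, b) \<in> rot ` S \<longleftrightarrow> (a, b, c) \<in> S" for a b c S by (force simp: rot_def)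
  have rot2: "(b, c, a) \<in> rot ` rot ` K \<longleftrightarrow> (a, b, c) \<in> K" for a b c by (simp only: rot1)
  obtain k where k: "odd k" "(2 * int k, 0, 0) \<in> K"
    "\<And>a b c. (a, b, c) \<in> K \<Longrightarrow> int k dvd a - of_bool (odd c) * y1"
    by (rule full_subgroup_first_coordinate[OF K x(1,2,4) y(1,4)]) blast
  obtain m where m: "odd m" "(2 * int m, 0, 0) \<in> rot ` K"
    "\<And>a b c. (a, b, c) \<in> rot ` K \<Longrightarrow> int m dvd a - of_bool (odd c) * x3"
    using full_subgroup_first_coordinate[OF rotK, of z3 z1 z2 x3 x1 x2] x z rot1 by metis
  obtain l where l: "odd l" "(2 * int l, 0, 0) \<in> rot ` rot ` K"
    "\<And>a b c. (a, b, c) \<in> rot ` rot ` K \<Longrightarrow> int l dvd a - of_bool (odd c) * z2"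
    using full_subgroup_first_coordinate[OF rotrotK, of y2 y3 y1 z2 z3 z1] y z rot2 by metis
  let ?F = "flat (k, l, m) (y1, z2, x3)"
  have KF: "K \<subseteq> ?F"
  proof
    fix v assume v: "v \<in> K"
    obtain a b c where "v = (a, b, c)" by (cases v)
    then show "v \<in> ?F" using v Kc k(3) l(3) m(3) by (simp add: flat_iff rot1 rot2)
  qed
  have L: "(2 * i, 2 * j, 2 * h) \<in> K" if dvd: "int k dvd 2 * i" "int l dvd 2 * j" "int m dvd 2 * h" for i j h
  proof -
    have half: "\<exists>y. x = y * int n" if "odd n" "int n dvd 2 * x" for n x
    proof -
      have "coprime (int n) 2" using \<open>odd n\<close> by simp
      then have "int n dvd x" using that(2) by (simp add: coprime_dvd_mult_right_iff)
      then show ?thesis by (metis dvdE mult.commute)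
    qed
    obtain i' j' h' where ijh: "i = i' * int k" "j = j' * int l" "h = h' * int m"
      using half[OF k(1) dvd(1)] half[OF l(1) dvd(2)] half[OF m(1) dvd(3)] by blast
    have "(2 * int k, 2 * 0, 2 * 0) \<in> K" "(2 * 0, 2 * int l, 2 * 0) \<in> K" "(2 * 0, 2 * 0, 2 * int m) \<in> K"
      using k(2) l(2) m(2) rot1[of "2 * int m" 0 0] rot2[of "2 * int l" 0 0] by simp_all
    from this[THEN subgroup_transl_mult[OF K]] have
      "(2 * (i' * int k), 2 * (i' * 0), 2 * (i' * 0)) \<in> K" "(2 * (j' * 0), 2 * (j' * int l), 2 * (j' * 0)) \<in> K"
      "(2 * (h' * 0), 2 * (h' * 0), 2 * (h' * int m)) \<in> K" by blast+
    from subgroup_transl_add[OF K this(1) subgroup_transl_add[OF K this(2,3)]]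
    show ?thesis by (simp add: ijh)
  qed
  have FK: "?F \<subseteq> K"
  proof
    fix v assume v: "v \<in> ?F"
    obtain a b c where abc: "v = (a, b, c)" by (cases v)
    have sub: "subgroup ?F didicosm" using flat_properties(1) k(1) l(1) m(1) by blast
    have "even (a + b + c)" using v by (simp add: abc flat_iff)
    then have "\<exists>a' b' c'. (a', b', c') \<in> K \<and> even a' = even a \<and> even b' = even b \<and> even c' = even c"
    proof (cases rule: even_sum_cases)
      case T
      have "(0, 0, 0) \<in> K" using subgroup.one_closed[OF K] by (simp add: didicosm_simps)
      then show ?thesis using T by (intro exI[of _ 0]) simp
    next
      case X
      then show ?thesis using x by (intro exI[of _ x1] exI[of _ x2] exI[of _ x3]) simp
    next
      case Y
      then show ?thesis using y by (intro exI[of _ y1] exI[of _ y2] exI[of _ y3]) simp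
    next
      case Z
      then show ?thesis using z by (intro exI[of _ z1] exI[of _ z2] exI[of _ z3]) simp
    qed
    then obtain a' b' c' where w: "(a', b', c') \<in> K" "even a' = even a" "even b' = even b" "even c' = even c"
      by blast
    let ?u = "v \<otimes>\<^bsub>didicosm\<^esub> inv\<^bsub>didicosm\<^esub> (a', b', c')"
    have u: "?u \<in> ?F" using subgroup.m_closed[OF sub v subgroup.m_inv_closed[OF sub]] w(1) KF by blast
    have ueq: "?u = (a - a', b - b', c - c')"
      unfolding abc inv_didicosm[OF Kc[OF w(1)]] using w(2-4) by (auto simp: didicosm_simps psgn_def)
    have "even (a - a')" "even (b - b')" "even (c - c')" using w(2-4) by simp_all
    then obtain i j h where "a - a' = 2 * i" "b - b' = 2 * j" "c - c' = 2 * h"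
      by (elim evenE) blast
    then have "?u \<in> K" using u L[of i j h] by (simp add: ueq flat_iff)
    then have "?u \<otimes>\<^bsub>didicosm\<^esub> (a', b', c') \<in> K" using mult w(1) by blast
    moreover have "?u \<otimes>\<^bsub>didicosm\<^esub> (a', b', c') = v"
    proof -
      have "v \<in> carrier didicosm" "(a', b', c') \<in> carrier didicosm"
        using subgroup.subset[OF sub] v w(1) subgroup.subset[OF K] by blast+
      then show ?thesis
        by (simp add: group.inv_closed[OF group_didicosm] group.l_inv[OF group_didicosm]
            monoid.r_one[OF group.is_monoid[OF group_didicosm]]
            monoid.m_assoc[OF group.is_monoid[OF group_didicosm]])
    qed
    ultimately show "v \<in> K" by simp
  qed
  show thesis using that[OF k(1) l(1) m(1)] KF FK by blast
qed

text \<open>The translations of \<open>K\<close> along the three axes. Conjugation changes them at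
  most by signs, and they determine the moduli of a \<open>flat\<close> subgroup; as the residues
  can be conjugated away, this is a complete invariant there.\<close>

definition axis_invariant :: "(int \<times> int \<times> int) set \<Rightarrow> int set \<times> int set \<times> int set" where
  "axis_invariant K = ({i. (2 * i, 0, 0) \<in> K}, {i. (0, 2 * i, 0) \<in> K}, {i. (0, 0, 2 * i) \<in> K})"

lemma axis_invariant_flat:
  assumes "odd k" "odd l" "odd m"
  shows "axis_invariant (flat (k, l, m) s) = ({i. int k dvd i}, {i. int l dvd i}, {i. int m dvd i})"
proof -
  have "int n dvd 2 * x \<longleftrightarrow> int n dvd x" if "odd n" for n and x :: int
  proof -
    have "coprime (int n) 2" using that by simp
    then show ?thesis by (simp add: coprime_dvd_mult_right_iff)
  qed
  then show ?thesis using assms by (cases s) (simp add: axis_invariant_def flat_iff)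
qed

lemma axis_invariant_conj:
  assumes K: "subgroup K didicosm" and L: "L \<in> conjugacy_class didicosm K"
  shows "axis_invariant L = axis_invariant K"
proof -
  obtain g h l where g: "(g, h, l) \<in> carrier didicosm"
    and L': "L = (g, h, l) <#\<^bsub>didicosm\<^esub> K #>\<^bsub>didicosm\<^esub> inv\<^bsub>didicosm\<^esub> (g, h, l)"
    using L unfolding conjugacy_class_def by auto
  let ?f = "\<lambda>(a, b, c). (psgn l * a + (1 - psgn c) * g, psgn g * b + (1 - psgn a) * h,
      psgn h * c + (1 - psgn b) * l)"
  have L: "L = ?f ` K"
    unfolding L' by (rule didicosm_conj_set[OF g subgroup.subset[OF K]])
  have iff: "(2 * i, 2 * j, 2 * k) \<in> L \<longleftrightarrow> (2 * (psgn l * i), 2 * (psgn g * j), 2 * (psgn h * k)) \<in> K" for i j k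
  proof
    assume "(2 * i, 2 * j, 2 * k) \<in> L"
    then obtain a b c where abc: "(a, b, c) \<in> K" "(2 * i, 2 * j, 2 * k) = ?f (a, b, c)"
      unfolding L by auto
    have eqs: "2 * i = psgn l * a + (1 - psgn c) * g" "2 * j = psgn g * b + (1 - psgn a) * h"
      "2 * k = psgn h * c + (1 - psgn b) * l" using abc(2) by simp_all
    have "even (psgn l * a + (1 - psgn c) * g)" "even (psgn g * b + (1 - psgn a) * h)"
      "even (psgn h * c + (1 - psgn b) * l)" unfolding eqs[symmetric] by simp_all
    then have ev: "even a" "even b" "even c" by (auto simp: psgn_def split: if_splits)
    then have "a = 2 * (psgn l * i)" "b = 2 * (psgn g * j)" "c = 2 * (psgn h * k)"
      using eqs by (auto simp: psgn_def split: if_splits)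
    then show "(2 * (psgn l * i), 2 * (psgn g * j), 2 * (psgn h * k)) \<in> K" using abc(1) by simp
  next
    assume *: "(2 * (psgn l * i), 2 * (psgn g * j), 2 * (psgn h * k)) \<in> K"
    have "(2 * i, 2 * j, 2 * k) = ?f (2 * (psgn l * i), 2 * (psgn g * j), 2 * (psgn h * k))"
      by (auto simp: psgn_def)
    then show "(2 * i, 2 * j, 2 * k) \<in> L" unfolding L using * by (rule image_eqI)
  qed
  have neg: "(2 * - i, 2 * - j, 2 * - k) \<in> K \<longleftrightarrow> (2 * i, 2 * j, 2 * k) \<in> K" for i j k
    using subgroup_transl_minus[OF K, of i j k] subgroup_transl_minus[OF K, of "- i" "- j" "- k"] by auto
  have "(2 * i, 0, 0) \<in> L \<longleftrightarrow> (2 * i, 0, 0) \<in> K" "(0, 2 * i, 0) \<in> L \<longleftrightarrow> (0, 2 * i, 0) \<in> K"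
    "(0, 0, 2 * i) \<in> L \<longleftrightarrow> (0, 0, 2 * i) \<in> K" for i
    using iff[of i 0 0] iff[of 0 i 0] iff[of 0 0 i] neg[of i 0 0] neg[of 0 i 0] neg[of 0 0 i]
    by (auto simp: psgn_def split: if_splits)
  then show ?thesis by (simp add: axis_invariant_def)
qed

text \<open>If the linear parts form a proper subgroup of the Klein four-group, some coordinate is
  even throughout \<open>K\<close>; so the three odd entries express full holonomy.\<close>

definition full_subgroups :: "nat \<Rightarrow> (int \<times> int \<times> int) set set" where
  "full_subgroups n = {K. subgroup K didicosm \<and> card (rcosets\<^bsub>didicosm\<^esub> K) = n \<and>
    (\<exists>(a, b, c)\<in>K. odd a) \<and> (\<exists>(a, b, c)\<in>K. odd b) \<and> (\<exists>(a, b, c)\<in>K. odd c)}"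

definition odd_triples :: "nat \<Rightarrow> (nat \<times> nat \<times> nat) set" where
  "odd_triples n = {(k, l, m) \<in> triples n. odd k \<and> odd l \<and> odd m}"

definition flat_params :: "nat \<Rightarrow> ((nat \<times> nat \<times> nat) \<times> (nat \<times> nat \<times> nat)) set" where
  "flat_params n = (SIGMA t:odd_triples n. case t of (k, l, m) \<Rightarrow> {..<k} \<times> {..<l} \<times> {..<m})"

definition flat_of :: "(nat \<times> nat \<times> nat) \<times> (nat \<times> nat \<times> nat) \<Rightarrow> (int \<times> int \<times> int) set" where
  "flat_of = (\<lambda>(t, (p, q, r)). flat t (int p, int q, int r))"

lemma odd_congruent:
  assumes "odd k"
  obtains s :: int where "odd s" "int k dvd s - x"
  using assms that[of x] that[of "x + int k"] by (cases "even x") simp_all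

lemma even_congruent:
  assumes "odd k"
  obtains s :: int where "even s" "int k dvd s - x"
  using assms that[of x] that[of "x + int k"] by (cases "even x") simp_all

text \<open>An element of type \<open>x\<close> exposes the residues \<open>q\<close> and
  \<open>r\<close>, and the element of type \<open>y\<close> in \<open>flat_y_type\<close> exposes
  \<open>p\<close>. Together they make the parameters recoverable.\<close>

lemma flat_x_type:
  assumes "odd k" "odd l" "odd m"
  obtains b c where "odd b" "even c" "int l dvd b - q" "int m dvd c - r"
    "(int k, b, c) \<in> flat (k, l, m) (p, q, r)"
proof -
  obtain b where b: "odd b" "int l dvd b - q" using odd_congruent[OF assms(2)] .
  obtain c where c: "even c" "int m dvd c - r" using even_congruent[OF assms(3)] .
  show thesis using that[OF b(1) c(1) b(2) c(2)] b c assms by (simp add: flat_iff)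
qed

lemma flat_y_type:
  assumes "odd k" "odd l" "odd m"
  obtains a c where "even a" "odd c" "int k dvd a - p" "(a, int l, c) \<in> flat (k, l, m) (p, q, r)"
proof -
  obtain a where a: "even a" "int k dvd a - p" using even_congruent[OF assms(1)] .
  obtain c where c: "odd c" "int m dvd c - r" using odd_congruent[OF assms(3)] .
  show thesis using that[OF a(1) c(1) a(2)] a c assms by (simp add: flat_iff)
qed

lemma flat_full:
  assumes "odd k" "odd l" "odd m"
  shows "flat (k, l, m) (p, q, r) \<in> full_subgroups (k * l * m)"
proof -
  obtain b c where x: "odd b" "(int k, b, c) \<in> flat (k, l, m) (p, q, r)"
    using flat_x_type[OF assms] by metis
  obtain a c' where y: "odd c'" "(a, int l, c') \<in> flat (k, l, m) (p, q, r)"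
    using flat_y_type[OF assms] by metis
  have "odd (int k)" using assms by simp
  then show ?thesis
    using flat_properties[OF assms] x y unfolding full_subgroups_def by blast
qed

lemma full_subgroups_eq: "full_subgroups n = flat_of ` flat_params n"
proof
  show "full_subgroups n \<subseteq> flat_of ` flat_params n"
  proof
    fix K assume "K \<in> full_subgroups n"
    then obtain a1 b1 c1 a2 b2 c2 a3 b3 c3 where K: "subgroup K didicosm"
      "card (rcosets\<^bsub>didicosm\<^esub> K) = n"
      "(a1, b1, c1) \<in> K" "odd a1" "(a2, b2, c2) \<in> K" "odd b2" "(a3, b3, c3) \<in> K" "odd c3"
      unfolding full_subgroups_def by blast
    obtain k l m p q r where F: "odd k" "odd l" "odd m" "K = flat (k, l, m) (p, q, r)"
      using full_subgroup_eq_flat[OF K(1,3-8)] .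
    have pos: "k > 0" "l > 0" "m > 0" using F odd_pos by blast+
    let ?p = "nat (p mod int k)" and ?q = "nat (q mod int l)" and ?r = "nat (r mod int m)"
    have "K = flat (k, l, m) (int ?p, int ?q, int ?r)"
      unfolding F(4) by (rule flat_cong) (use pos in \<open>simp_all add: dvd_minus_mod\<close>)
    then have "K = flat_of ((k, l, m), (?p, ?q, ?r))" by (simp add: flat_of_def)
    moreover have "k * l * m = n" using flat_properties(2)[OF F(1-3), of p q r] K(2) F(4) by simp
    then have "((k, l, m), (?p, ?q, ?r)) \<in> flat_params n"
      using F(1-3) pos by (simp add: flat_params_def odd_triples_def triples_def nat_less_iff)
    ultimately show "K \<in> flat_of ` flat_params n" by (rule image_eqI)
  qed
  show "flat_of ` flat_params n \<subseteq> full_subgroups n"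
    using flat_full by (auto simp: flat_params_def flat_of_def odd_triples_def triples_def)
qed

lemma flat_of_inj: "inj_on flat_of (flat_params n)"
proof (rule inj_onI)
  fix s s' assume ss: "s \<in> flat_params n" "s' \<in> flat_params n" and eq: "flat_of s = flat_of s'"
  obtain k l m p q r where s: "s = ((k, l, m), (p, q, r))" by (cases s) auto
  obtain k' l' m' p' q' r' where s': "s' = ((k', l', m'), (p', q', r'))" by (cases s') auto
  have o: "odd k" "odd l" "odd m" "p < k" "q < l" "r < m"
    and o': "odd k'" "odd l'" "odd m'" "p' < k'" "q' < l'" "r' < m'"
    using ss by (auto simp: s s' flat_params_def odd_triples_def)
  have eq': "flat (k, l, m) (int p, int q, int r) = flat (k', l', m') (int p', int q', int r')"
    using eq by (simp add: s s' flat_of_def)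
  have "{i. int k dvd i} = {i. int k' dvd i}" "{i. int l dvd i} = {i. int l' dvd i}"
    "{i. int m dvd i} = {i. int m' dvd i}"
    using arg_cong[OF eq', of axis_invariant]
    unfolding axis_invariant_flat[OF o(1-3)] axis_invariant_flat[OF o'(1-3)] prod.inject by blast+
  then have t: "k' = k" "l' = l" "m' = m" using multiples_eq_imp_eq by metis+
  have diff: "x = x'" if "int n dvd a - int x" "int n dvd a - int x'" "x < n" "x' < n" for n a x x'
  proof -
    have "int n dvd int x - int x'" using dvd_diff[OF that(2,1)] by simp
    then show ?thesis using that(3,4) by (rule int_less_eq_of_dvd_diff)
  qed
  obtain b c where x: "odd b" "even c" "int l dvd b - int q" "int m dvd c - int r"
    "(int k, b, c) \<in> flat (k, l, m) (int p, int q, int r)" using flat_x_type[OF o(1-3)] .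
  obtain a c' where y: "even a" "odd c'" "int k dvd a - int p"
    "(a, int l, c') \<in> flat (k, l, m) (int p, int q, int r)" using flat_y_type[OF o(1-3)] .
  have "int l dvd b - int q'" "int m dvd c - int r'"
    using x(1,2,5) o(1) unfolding eq' t flat_iff by simp_all
  moreover have "int k dvd a - int p'"
    using y(1,2,4) unfolding eq' t flat_iff by simp
  ultimately have "p = p'" "q = q'" "r = r'"
    using diff x(3,4) y(3) o(4-6) o'(4-6) t by blast+
  then show "s = s'" by (simp add: s s' t)
qed

lemma finite_odd_triples: "n > 0 \<Longrightarrow> finite (odd_triples n)"
  unfolding odd_triples_def by (rule finite_subset[OF _ finite_triples]) auto

lemma sum_odd_triples:
  assumes "n > 0"
  shows "sum f (odd_triples n) =
    (\<Sum>(k, l, m)\<in>triples n. of_bool (odd k) * of_bool (odd l) * of_bool (odd m) * (f (k, l, m) :: nat))"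
proof -
  have "odd_triples n = {t \<in> triples n. case t of (k, l, m) \<Rightarrow> odd k \<and> odd l \<and> odd m}"
    by (auto simp: odd_triples_def)
  then have "sum f (odd_triples n) =
      (\<Sum>t\<in>triples n. if case t of (k, l, m) \<Rightarrow> odd k \<and> odd l \<and> odd m then f t else 0)"
    by (simp only: sum.inter_filter[OF finite_triples[OF assms]])
  also have "\<dots> = (\<Sum>(k, l, m)\<in>triples n.
      of_bool (odd k) * of_bool (odd l) * of_bool (odd m) * f (k, l, m))"
    by (rule sum.cong) auto
  finally show ?thesis .
qed

lemma card_full_subgroups:
  assumes "n > 0"
  shows "card (full_subgroups n) = (\<Sum>(k, l, m)\<in>triples n.
    of_bool (odd k) * of_bool (odd l) * of_bool (odd m) * (k * l * m))"
proof -
  have "card (full_subgroups n) = card (flat_params n)"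
    unfolding full_subgroups_eq by (rule card_image[OF flat_of_inj])
  also have "\<dots> = (\<Sum>t\<in>odd_triples n. card (case t of (k, l, m) \<Rightarrow> {..<k} \<times> {..<l} \<times> {..<m}))"
    unfolding flat_params_def by (rule card_SigmaI) (auto simp: finite_odd_triples assms)
  also have "\<dots> = (\<Sum>(k, l, m)\<in>triples n.
      of_bool (odd k) * of_bool (odd l) * of_bool (odd m) * (k * l * m))"
    unfolding sum_odd_triples[OF assms]
    by (rule sum.cong) (auto simp: card_cartesian_product)
  finally show ?thesis .
qed

lemma full_subgroups_conjugacy_iff:
  assumes K: "K \<in> full_subgroups n" and L: "L \<in> full_subgroups n"
  shows "conjugacy_class didicosm K = conjugacy_class didicosm L \<longleftrightarrow> axis_invariant K = axis_invariant L"
proof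
  have sub: "subgroup K didicosm" "subgroup L didicosm" using K L by (simp_all add: full_subgroups_def)
  assume "conjugacy_class didicosm K = conjugacy_class didicosm L"
  then have "L \<in> conjugacy_class didicosm K"
    using group.conjugacy_class_self[OF group_didicosm subgroup.subset[OF sub(2)]] by simp
  then show "axis_invariant K = axis_invariant L" using axis_invariant_conj[OF sub(1)] by simp
next
  assume eq: "axis_invariant K = axis_invariant L"
  obtain k l m p q r where s: "odd k" "odd l" "odd m" "K = flat (k, l, m) (p, q, r)"
    using K unfolding full_subgroups_eq
    by (auto simp: flat_params_def odd_triples_def flat_of_def)
  obtain k' l' m' p' q' r' where s': "odd k'" "odd l'" "odd m'" "L = flat (k', l', m') (p', q', r')"
    using L unfolding full_subgroups_eq
    by (auto simp: flat_params_def odd_triples_def flat_of_def)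
  have "{i. int k dvd i} = {i. int k' dvd i}" "{i. int l dvd i} = {i. int l' dvd i}"
    "{i. int m dvd i} = {i. int m' dvd i}"
    using eq unfolding s(4) s'(4) axis_invariant_flat[OF s(1-3)] axis_invariant_flat[OF s'(1-3)]
      prod.inject by blast+
  then have t: "k' = k" "l' = l" "m' = m" using multiples_eq_imp_eq by metis+
  let ?K = "flat (k, l, m) (0, 0, 0)"
  have base: "conjugacy_class didicosm (flat (k, l, m) (u, v, w)) = conjugacy_class didicosm ?K" for u v w
  proof (rule group.conjugacy_class_eq[OF group_didicosm])
    show "?K \<subseteq> carrier didicosm" by (rule subgroup.subset[OF flat_properties(1)[OF s(1-3)]])
    show "flat (k, l, m) (u, v, w) \<in> conjugacy_class didicosm ?K"
      using flat_conj_flat_zero[OF s(1-3), of u v w] unfolding conjugacy_class_def by blast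
  qed
  show "conjugacy_class didicosm K = conjugacy_class didicosm L"
    unfolding s(4) s'(4) t base[of p q r] base[of p' q' r'] ..
qed

lemma card_conjugacy_classes_full:
  assumes "n > 0"
  shows "card (conjugacy_class didicosm ` full_subgroups n) =
    (\<Sum>(k, l, m)\<in>triples n. of_bool (odd k) * of_bool (odd l) * of_bool (odd m))"
proof -
  let ?g = "\<lambda>(k, l, m). ({i. int k dvd i}, {i. int l dvd i}, {i. int m dvd i})"
  have "card (conjugacy_class didicosm ` full_subgroups n) = card (axis_invariant ` full_subgroups n)"
    by (rule card_image_eq_iff) (rule full_subgroups_conjugacy_iff)
  also have "axis_invariant ` full_subgroups n = ?g ` odd_triples n"
  proof
    show "axis_invariant ` full_subgroups n \<subseteq> ?g ` odd_triples n"
    proof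
      fix I assume "I \<in> axis_invariant ` full_subgroups n"
      then obtain s where s: "s \<in> flat_params n" "I = axis_invariant (flat_of s)"
        unfolding full_subgroups_eq by blast
      obtain k l m p q r where s': "s = ((k, l, m), (p, q, r))" by (cases s) auto
      have t: "(k, l, m) \<in> odd_triples n" "odd k" "odd l" "odd m"
        using s(1) by (auto simp: s' flat_params_def odd_triples_def)
      have "I = ?g (k, l, m)" using s(2) by (simp add: s' flat_of_def axis_invariant_flat t)
      then show "I \<in> ?g ` odd_triples n" using t(1) by (rule image_eqI)
    qed
    show "?g ` odd_triples n \<subseteq> axis_invariant ` full_subgroups n"
    proof
      fix I assume "I \<in> ?g ` odd_triples n"
      then obtain k l m where t: "I = ?g (k, l, m)" "odd k" "odd l" "odd m" "k * l * m = n"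
        by (auto simp: odd_triples_def triples_def)
      have "I = axis_invariant (flat (k, l, m) (0, 0, 0))" using t by (simp add: axis_invariant_flat)
      moreover have "flat (k, l, m) (0, 0, 0) \<in> full_subgroups n"
        using flat_full[OF t(2-4)] t(5) by simp
      ultimately show "I \<in> axis_invariant ` full_subgroups n" by (rule image_eqI)
    qed
  qed
  also have "card \<dots> = card (odd_triples n)"
  proof (rule card_image, rule inj_onI)
    fix s t assume eq: "?g s = ?g t"
    obtain k l m where s: "s = (k, l, m)" by (cases s)
    obtain k' l' m' where t: "t = (k', l', m')" by (cases t)
    have "{i. int k dvd i} = {i. int k' dvd i}" "{i. int l dvd i} = {i. int l' dvd i}"
      "{i. int m dvd i} = {i. int m' dvd i}"
      using eq unfolding s t prod.case prod.inject by blast+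
    then show "s = t" unfolding s t prod.inject using multiples_eq_imp_eq by blast
  qed
  also have "\<dots> = (\<Sum>t\<in>odd_triples n. 1)" by simp
  also have "\<dots> = (\<Sum>(k, l, m)\<in>triples n. of_bool (odd k) * of_bool (odd l) * of_bool (odd m))"
    unfolding sum_odd_triples[OF assms] by (rule sum.cong) auto
  finally show ?thesis .
qed

section \<open>Isomorphism types of the finite-index subgroups\<close>

lemma iso_commutative:
  assumes "G \<cong> H"
    and comm: "\<And>u v. u \<in> carrier G \<Longrightarrow> v \<in> carrier G \<Longrightarrow> u \<otimes>\<^bsub>G\<^esub> v = v \<otimes>\<^bsub>G\<^esub> u"
    and uv: "u \<in> carrier H" "v \<in> carrier H"
  shows "u \<otimes>\<^bsub>H\<^esub> v = v \<otimes>\<^bsub>H\<^esub> u"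
proof -
  obtain h where h: "h \<in> hom G H" "h ` carrier G = carrier H"
    using assms(1) by (auto simp: is_iso_def iso_def bij_betw_def)
  obtain a b where ab: "a \<in> carrier G" "b \<in> carrier G" "u = h a" "v = h b" using uv h(2) by blast
  then show ?thesis using comm[of a b] hom_mult[OF h(1)] by metis
qed

lemma iso_central:
  assumes "G \<cong> H" "group G" "group H"
    and u: "u \<in> carrier G" "u \<noteq> \<one>\<^bsub>G\<^esub>" "\<And>v. v \<in> carrier G \<Longrightarrow> u \<otimes>\<^bsub>G\<^esub> v = v \<otimes>\<^bsub>G\<^esub> u"
  obtains w where "w \<in> carrier H" "w \<noteq> \<one>\<^bsub>H\<^esub>" "\<And>v. v \<in> carrier H \<Longrightarrow> w \<otimes>\<^bsub>H\<^esub> v = v \<otimes>\<^bsub>H\<^esub> w"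
proof -
  obtain h where h: "h \<in> hom G H" "h ` carrier G = carrier H" "inj_on h (carrier G)"
    using assms(1) by (auto simp: is_iso_def iso_def bij_betw_def)
  have "h \<one>\<^bsub>G\<^esub> = \<one>\<^bsub>H\<^esub>" by (rule hom_one[OF h(1) assms(2,3)])
  then have "h u \<noteq> \<one>\<^bsub>H\<^esub>"
    using h(3) u(1,2) group.is_monoid[OF assms(2)] by (metis inj_on_def monoid.one_closed)
  moreover have "h u \<otimes>\<^bsub>H\<^esub> v = v \<otimes>\<^bsub>H\<^esub> h u" if "v \<in> carrier H" for v
  proof -
    obtain b where "b \<in> carrier G" "v = h b" using \<open>v \<in> carrier H\<close> h(2) by blast
    then show ?thesis using u(1) u(3)[of b] hom_mult[OF h(1)] by metis
  qed
  moreover have "h u \<in> carrier H" using u(1) h(2) by blast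
  ultimately show thesis using that by blast
qed

lemma group_pi1_G1: "group pi1_G1"
  by (simp add: pi1_G1_def DirProd_group)

lemma pi1_G1_not_dicosm: "\<not> pi1_G1 \<cong> dicosm"
proof
  assume "pi1_G1 \<cong> dicosm"
  then have "(1, 0, 0) \<otimes>\<^bsub>dicosm\<^esub> (0, 1, 0) = (0, 1, 0) \<otimes>\<^bsub>dicosm\<^esub> (1, 0, 0)"
    by (rule iso_commutative)
      (auto simp: pi1_G1_def dicosm_simps add.commute)
  then show False by (simp add: dicosm_simps)
qed

text \<open>Each generator has one zero coordinate, and negates that coordinate of the element it
  multiplies on the left. So commuting with \<open>x\<close>, \<open>y\<close>, \<open>z\<close>
  forces \<open>c = 0\<close>, \<open>a = 0\<close>, \<open>b = 0\<close>.\<close>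

lemma didicosm_centre_trivial:
  assumes "w \<in> carrier didicosm"
    and comm: "\<And>v. v \<in> carrier didicosm \<Longrightarrow> w \<otimes>\<^bsub>didicosm\<^esub> v = v \<otimes>\<^bsub>didicosm\<^esub> w"
  shows "w = \<one>\<^bsub>didicosm\<^esub>"
proof -
  obtain a b c where w: "w = (a, b, c)" by (cases w)
  have x: "w \<otimes>\<^bsub>didicosm\<^esub> (1, 1, 0) = (1, 1, 0) \<otimes>\<^bsub>didicosm\<^esub> w"
    and y: "w \<otimes>\<^bsub>didicosm\<^esub> (0, 1, 1) = (0, 1, 1) \<otimes>\<^bsub>didicosm\<^esub> w"
    and z: "w \<otimes>\<^bsub>didicosm\<^esub> (1, 0, 1) = (1, 0, 1) \<otimes>\<^bsub>didicosm\<^esub> w"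
    by (rule comm, simp add: didicosm_simps)+
  have "c = 0" using x by (auto simp: w didicosm_simps psgn_def split: if_splits)
  moreover have "a = 0" using y by (auto simp: w didicosm_simps psgn_def split: if_splits)
  moreover have "b = 0" using z by (auto simp: w didicosm_simps psgn_def split: if_splits)
  ultimately show ?thesis by (simp add: w didicosm_simps)
qed

text \<open>The centre of \<open>didicosm\<close> is trivial, whereas \<open>pi1_G1\<close> is
  commutative and \<open>dicosm\<close> has the central element \<open>(2, 0, 0)\<close>, the square
  of the half turn.\<close>

lemma not_iso_didicosm:
  shows "\<not> pi1_G1 \<cong> didicosm" and "\<not> dicosm \<cong> didicosm"
proof -
  show "\<not> pi1_G1 \<cong> didicosm"
  proof
    assume iso: "pi1_G1 \<cong> didicosm"
    obtain w where "w \<in> carrier didicosm" "w \<noteq> \<one>\<^bsub>didicosm\<^esub>"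
      "\<And>v. v \<in> carrier didicosm \<Longrightarrow> w \<otimes>\<^bsub>didicosm\<^esub> v = v \<otimes>\<^bsub>didicosm\<^esub> w"
      by (rule iso_central[OF iso group_pi1_G1 group_didicosm, of "(1, 0, 0)"])
        (auto simp: pi1_G1_def add.commute)
    then show False using didicosm_centre_trivial by blast
  qed
  show "\<not> dicosm \<cong> didicosm"
  proof
    assume iso: "dicosm \<cong> didicosm"
    obtain w where "w \<in> carrier didicosm" "w \<noteq> \<one>\<^bsub>didicosm\<^esub>"
      "\<And>v. v \<in> carrier didicosm \<Longrightarrow> w \<otimes>\<^bsub>didicosm\<^esub> v = v \<otimes>\<^bsub>didicosm\<^esub> w"
      by (rule iso_central[OF iso group_dicosm group_didicosm, of "(2, 0, 0)"])
        (auto simp: dicosm_def add.commute)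
    then show False using didicosm_centre_trivial by blast
  qed
qed

section \<open>Subgroups with rotation about the second or third axis, and the
  classification\<close>

definition y_subgroups :: "nat \<Rightarrow> (int \<times> int \<times> int) set set" where
  "y_subgroups n = image rot ` x_subgroups n"

definition z_subgroups :: "nat \<Rightarrow> (int \<times> int \<times> int) set set" where
  "z_subgroups n = image rot ` y_subgroups n"

lemma rot_subgroup:
  assumes "subgroup K didicosm"
  shows "subgroup (rot ` K) didicosm" "card (rcosets\<^bsub>didicosm\<^esub> (rot ` K)) = card (rcosets\<^bsub>didicosm\<^esub> K)"
    "didicosm\<lparr>carrier := K\<rparr> \<cong> didicosm\<lparr>carrier := rot ` K\<rparr>"
  by (rule image_subgroup_iso[OF group_didicosm group_didicosm rot_iso assms])+

lemma rot_transl_iff: "rot ` K \<subseteq> transl \<longleftrightarrow> K \<subseteq> transl"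
  by (force simp: transl_def rot_def)

lemma y_subgroups_eq:
  "y_subgroups n = {K. subgroup K didicosm \<and> card (rcosets\<^bsub>didicosm\<^esub> K) = n \<and>
    (\<forall>(a, b, c)\<in>K. even a) \<and> \<not> K \<subseteq> transl}" (is "_ = ?R")
proof
  show "y_subgroups n \<subseteq> ?R"
    unfolding y_subgroups_def using rot_subgroup rot_transl_iff
    by (auto simp: x_subgroups_def rot_def)
  show "?R \<subseteq> y_subgroups n"
  proof
    fix K assume K: "K \<in> ?R"
    then have "rot ` rot ` K \<in> x_subgroups n"
      using rot_subgroup[of K] rot_subgroup[of "rot ` K"] rot_transl_iff
      by (auto simp: x_subgroups_def rot_def)
    then show "K \<in> y_subgroups n" unfolding y_subgroups_def using rot_rot_rot by (metis imageI)
  qed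
qed

lemma z_subgroups_eq:
  "z_subgroups n = {K. subgroup K didicosm \<and> card (rcosets\<^bsub>didicosm\<^esub> K) = n \<and>
    (\<forall>(a, b, c)\<in>K. even b) \<and> \<not> K \<subseteq> transl}" (is "_ = ?R")
proof
  show "z_subgroups n \<subseteq> ?R"
    unfolding z_subgroups_def y_subgroups_eq using rot_subgroup rot_transl_iff
    by (auto simp: rot_def)
  show "?R \<subseteq> z_subgroups n"
  proof
    fix K assume K: "K \<in> ?R"
    then have "rot ` rot ` K \<in> y_subgroups n"
      using rot_subgroup[of K] rot_subgroup[of "rot ` K"] rot_transl_iff
      by (auto simp: y_subgroups_eq rot_def)
    then show "K \<in> z_subgroups n" unfolding z_subgroups_def using rot_rot_rot by (metis imageI)
  qed
qed

text \<open>If no coordinate is even throughout \<open>K\<close>, the holonomy is full. Otherwise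
  \<open>K\<close> belongs to the family of an even coordinate or consists of translations.\<close>

lemma finite_index_cases:
  assumes K: "subgroup K didicosm" "card (rcosets\<^bsub>didicosm\<^esub> K) = n"
  shows "K \<in> transl_subgroups n \<or> K \<in> x_subgroups n \<union> y_subgroups n \<union> z_subgroups n \<or> K \<in> full_subgroups n"
  using K unfolding transl_subgroups_def x_subgroups_def y_subgroups_eq z_subgroups_eq full_subgroups_def
  by (auto split: prod.splits)

lemma transl_subgroups_iso_type:
  assumes "K \<in> transl_subgroups n" "n > 0"
  shows "didicosm\<lparr>carrier := K\<rparr> \<cong> pi1_G1"
proof -
  have K: "subgroup K didicosm" "card (rcosets\<^bsub>didicosm\<^esub> K) > 0" "K \<subseteq> transl"
    using assms by (simp_all add: transl_subgroups_def)
  obtain a b c x y z where "a > 0" "b > 0" "c > 0" "x < b" "y < c" "z < c"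
    "K = tlat (a, b, c) (x, y, z)" using transl_subgroup_eq_tlat[OF K] .
  then show ?thesis using tlat_iso by simp
qed

lemma x_subgroups_iso_type:
  assumes "K \<in> x_subgroups n" "n > 0"
  shows "didicosm\<lparr>carrier := K\<rparr> \<cong> dicosm"
proof -
  have K: "subgroup K didicosm" "card (rcosets\<^bsub>didicosm\<^esub> K) > 0"
    "\<And>a b c. (a, b, c) \<in> K \<Longrightarrow> even c" "\<not> K \<subseteq> transl"
    using assms by (auto simp: x_subgroups_def)
  obtain k b c z x y where "odd k" "b > 0" "c > 0" "z < c" "x < b" "y < c"
    "K = xlat (k, b, c) (z, x, y)" using x_subgroup_eq_xlat[OF K] .
  then show ?thesis using xlat_iso by simp
qed

lemma rot_iso_type:
  assumes K: "subgroup K didicosm" and "didicosm\<lparr>carrier := K\<rparr> \<cong> H"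
  shows "didicosm\<lparr>carrier := rot ` K\<rparr> \<cong> H"
proof -
  have "group (didicosm\<lparr>carrier := K\<rparr>)"
    using K group_didicosm by (rule subgroup.subgroup_is_group)
  then show ?thesis using rot_subgroup(3)[OF K] assms(2) by (meson group.iso_sym iso_trans)
qed

lemma axis_subgroups_iso_type:
  assumes "K \<in> x_subgroups n \<union> y_subgroups n \<union> z_subgroups n" "n > 0"
  shows "didicosm\<lparr>carrier := K\<rparr> \<cong> dicosm"
proof -
  have y: "didicosm\<lparr>carrier := K\<rparr> \<cong> dicosm" if "K \<in> y_subgroups n" for K
    using that x_subgroups_iso_type[OF _ assms(2)] rot_iso_type
    unfolding y_subgroups_def by (auto simp: x_subgroups_def)
  have z: "didicosm\<lparr>carrier := K\<rparr> \<cong> dicosm" if K: "K \<in> z_subgroups n" for K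
  proof -
    obtain L where L: "L \<in> y_subgroups n" "K = rot ` L" using K unfolding z_subgroups_def by blast
    then have "subgroup L didicosm" by (simp add: y_subgroups_eq)
    then show ?thesis unfolding L(2) using y[OF L(1)] by (rule rot_iso_type)
  qed
  show ?thesis using assms x_subgroups_iso_type y z by blast
qed

lemma full_subgroups_iso_type:
  assumes "K \<in> full_subgroups n"
  shows "didicosm\<lparr>carrier := K\<rparr> \<cong> didicosm"
  using assms flat_properties(3)
  by (auto simp: full_subgroups_eq flat_params_def odd_triples_def flat_of_def)

lemma subgroups_iso_didicosm:
  assumes n: "n > 0"
  shows "subgroups_iso pi1_G1 didicosm n = transl_subgroups n"
    and "subgroups_iso dicosm didicosm n = x_subgroups n \<union> y_subgroups n \<union> z_subgroups n"
    and "subgroups_iso didicosm didicosm n = full_subgroups n"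
proof -
  have sub: "subgroup K didicosm \<and> card (rcosets\<^bsub>didicosm\<^esub> K) = n"
    if "K \<in> transl_subgroups n \<or> K \<in> x_subgroups n \<union> y_subgroups n \<union> z_subgroups n \<or> K \<in> full_subgroups n" for K
    using that by (auto simp: transl_subgroups_def x_subgroups_def y_subgroups_eq z_subgroups_eq full_subgroups_def)
  have same: "H \<cong> H'" if K: "subgroup K didicosm" and "didicosm\<lparr>carrier := K\<rparr> \<cong> H"
    "didicosm\<lparr>carrier := K\<rparr> \<cong> H'"
    for K and H H' :: "(int \<times> int \<times> int) monoid"
  proof -
    have "group (didicosm\<lparr>carrier := K\<rparr>)"
      using K group_didicosm by (rule subgroup.subgroup_is_group)
    then show ?thesis using that(2,3) by (meson group.iso_sym iso_trans)
  qed
  have neq: "\<not> dicosm \<cong> pi1_G1" "\<not> didicosm \<cong> pi1_G1" "\<not> didicosm \<cong> dicosm"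
    using pi1_G1_not_dicosm not_iso_didicosm group.iso_sym group_dicosm group_didicosm by blast+
  note types = transl_subgroups_iso_type[OF _ n] axis_subgroups_iso_type[OF _ n] full_subgroups_iso_type
  note neq' = neq pi1_G1_not_dicosm not_iso_didicosm
  show "subgroups_iso pi1_G1 didicosm n = transl_subgroups n"
  proof
    show "subgroups_iso pi1_G1 didicosm n \<subseteq> transl_subgroups n"
    proof
      fix K assume "K \<in> subgroups_iso pi1_G1 didicosm n"
      then have K: "subgroup K didicosm" "card (rcosets\<^bsub>didicosm\<^esub> K) = n"
        "didicosm\<lparr>carrier := K\<rparr> \<cong> pi1_G1" by (auto simp: subgroups_iso_def)
      show "K \<in> transl_subgroups n"
        using finite_index_cases[OF K(1,2)] types(2,3)[of K] same[OF K(1) _ K(3)] neq' by blast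
    qed
    show "transl_subgroups n \<subseteq> subgroups_iso pi1_G1 didicosm n"
      using types(1) sub unfolding subgroups_iso_def by blast
  qed
  show "subgroups_iso dicosm didicosm n = x_subgroups n \<union> y_subgroups n \<union> z_subgroups n"
  proof
    show "subgroups_iso dicosm didicosm n \<subseteq> x_subgroups n \<union> y_subgroups n \<union> z_subgroups n"
    proof
      fix K assume "K \<in> subgroups_iso dicosm didicosm n"
      then have K: "subgroup K didicosm" "card (rcosets\<^bsub>didicosm\<^esub> K) = n"
        "didicosm\<lparr>carrier := K\<rparr> \<cong> dicosm" by (auto simp: subgroups_iso_def)
      show "K \<in> x_subgroups n \<union> y_subgroups n \<union> z_subgroups n"
        using finite_index_cases[OF K(1,2)] types(1,3)[of K] same[OF K(1) _ K(3)] neq' by blast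
    qed
    show "x_subgroups n \<union> y_subgroups n \<union> z_subgroups n \<subseteq> subgroups_iso dicosm didicosm n"
      using types(2) sub unfolding subgroups_iso_def by blast
  qed
  show "subgroups_iso didicosm didicosm n = full_subgroups n"
  proof
    show "subgroups_iso didicosm didicosm n \<subseteq> full_subgroups n"
    proof
      fix K assume "K \<in> subgroups_iso didicosm didicosm n"
      then have K: "subgroup K didicosm" "card (rcosets\<^bsub>didicosm\<^esub> K) = n"
        "didicosm\<lparr>carrier := K\<rparr> \<cong> didicosm" by (auto simp: subgroups_iso_def)
      show "K \<in> full_subgroups n"
        using finite_index_cases[OF K(1,2)] types(1,2)[of K] same[OF K(1) _ K(3)] neq' by blast
    qed
    show "full_subgroups n \<subseteq> subgroups_iso didicosm didicosm n"
      using types(3) sub unfolding subgroups_iso_def by blast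
  qed
qed

lemma inj_image_rot: "inj_on (image rot) S"
  by (rule inj_on_inverseI[of _ "\<lambda>K. rot ` rot ` K"]) (rule rot_rot_rot)

text \<open>Two even coordinates force the third to be even, so a common member of two families
  would consist of translations.\<close>

lemma axis_subgroups_disjoint:
  "x_subgroups n \<inter> y_subgroups n = {}" "x_subgroups n \<inter> z_subgroups n = {}"
  "y_subgroups n \<inter> z_subgroups n = {}"
proof -
  have *: "(a, b, c) \<in> transl" if "subgroup K didicosm" "(a, b, c) \<in> K"
    "even a \<and> even b \<or> even a \<and> even c \<or> even b \<and> even c" for K a b c
  proof -
    have "even (a + b + c)" using subgroup.subset[OF that(1)] that(2) by (auto simp: didicosm_def)
    then show ?thesis using that(3) by (auto simp: transl_def)
  qed
  show "x_subgroups n \<inter> y_subgroups n = {}" "x_subgroups n \<inter> z_subgroups n = {}"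
    "y_subgroups n \<inter> z_subgroups n = {}"
    unfolding x_subgroups_def y_subgroups_eq z_subgroups_eq using * by fast+
qed

lemma card_dicosm_subgroups:
  assumes n: "n > 0"
  shows "card (subgroups_iso dicosm didicosm n) = 3 * card (x_subgroups n)"
proof -
  have fin: "finite (x_subgroups n)" "finite (y_subgroups n)" "finite (z_subgroups n)"
    using finite_x_subgroups[OF n] by (simp_all add: y_subgroups_def z_subgroups_def)
  have "card (y_subgroups n) = card (x_subgroups n)" "card (z_subgroups n) = card (y_subgroups n)"
    unfolding z_subgroups_def by (simp_all add: y_subgroups_def card_image inj_image_rot)
  then show ?thesis
    unfolding subgroups_iso_didicosm(2)[OF n]
    using fin axis_subgroups_disjoint[of n] by (simp add: card_Un_disjoint Int_Un_distrib2)
qed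

text \<open>Each family is closed under conjugation, so no class meets two of them, and
  \<open>rot\<close> maps the classes of one family bijectively to those of the next.\<close>

lemma card_dicosm_conjugacy_classes:
  assumes n: "n > 0"
  shows "card (conjugacy_class didicosm ` subgroups_iso dicosm didicosm n) =
    3 * card (conjugacy_class didicosm ` x_subgroups n)"
proof -
  let ?c = "conjugacy_class didicosm"
  interpret rot: group_hom didicosm didicosm rot
    using rot_iso group_didicosm by (simp add: group_hom_def group_hom_axioms_def iso_def)
  have onto: "rot ` carrier didicosm = carrier didicosm"
    using rot_iso by (simp add: iso_def bij_betw_def)
  have sub: "K \<subseteq> carrier didicosm" if "K \<in> x_subgroups n \<union> y_subgroups n \<union> z_subgroups n" for K
    using that by (auto simp: x_subgroups_def y_subgroups_eq z_subgroups_eq dest: subgroup.subset)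
  have rot_c: "?c (rot ` K) = image rot ` ?c K" if "K \<in> x_subgroups n \<union> y_subgroups n \<union> z_subgroups n" for K
    by (rule rot.image_conjugacy_class[OF onto sub[OF that]])
  have cy: "?c ` y_subgroups n = image (image rot) ` ?c ` x_subgroups n"
    unfolding y_subgroups_def image_image by (intro image_cong refl rot_c) blast+
  have cz: "?c ` z_subgroups n = image (image rot) ` ?c ` y_subgroups n"
    unfolding z_subgroups_def image_image by (intro image_cong refl rot_c) blast+
  have inj: "inj_on (image (image rot)) S" for S
    by (rule inj_on_inverseI[of _ "\<lambda>C. image rot ` image rot ` C"])
      (simp add: image_image[of "image rot"] rot_rot_rot)
  have stable: "?c K \<subseteq> x_subgroups n" if "K \<in> x_subgroups n" for K
    unfolding conjugacy_class_def using conj_x_subgroups[OF that] by auto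
  have stable_y: "?c K \<subseteq> y_subgroups n" if K: "K \<in> y_subgroups n" for K
  proof -
    obtain L where L: "L \<in> x_subgroups n" "K = rot ` L" using K unfolding y_subgroups_def by blast
    have "?c K = image rot ` ?c L" unfolding L(2) by (rule rot_c) (use L in blast)
    also have "\<dots> \<subseteq> y_subgroups n" unfolding y_subgroups_def by (rule image_mono[OF stable[OF L(1)]])
    finally show ?thesis .
  qed
  have stable_z: "?c K \<subseteq> z_subgroups n" if K: "K \<in> z_subgroups n" for K
  proof -
    obtain L where L: "L \<in> y_subgroups n" "K = rot ` L" using K unfolding z_subgroups_def by blast
    have "?c K = image rot ` ?c L" unfolding L(2) by (rule rot_c) (use L in blast)
    also have "\<dots> \<subseteq> z_subgroups n" unfolding z_subgroups_def by (rule image_mono[OF stable_y[OF L(1)]])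
    finally show ?thesis .
  qed
  have self: "K \<in> ?c K" if "K \<in> x_subgroups n \<union> y_subgroups n \<union> z_subgroups n" for K
    by (rule group.conjugacy_class_self[OF group_didicosm sub[OF that]])
  have disj: "?c ` x_subgroups n \<inter> ?c ` y_subgroups n = {}" "?c ` x_subgroups n \<inter> ?c ` z_subgroups n = {}"
    "?c ` y_subgroups n \<inter> ?c ` z_subgroups n = {}"
  proof -
    have "?c ` A \<inter> ?c ` B = {}" if "\<And>K. K \<in> A \<Longrightarrow> K \<in> ?c K \<and> ?c K \<subseteq> A" "\<And>K. K \<in> B \<Longrightarrow> ?c K \<subseteq> B"
      "A \<inter> B = {}" for A B
      using that by fast
    note d = this
    show "?c ` x_subgroups n \<inter> ?c ` y_subgroups n = {}"
      by (rule d) (use self stable stable_y axis_subgroups_disjoint in auto)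
    show "?c ` x_subgroups n \<inter> ?c ` z_subgroups n = {}"
      by (rule d) (use self stable stable_z axis_subgroups_disjoint in auto)
    show "?c ` y_subgroups n \<inter> ?c ` z_subgroups n = {}"
      by (rule d) (use self stable_y stable_z axis_subgroups_disjoint in auto)
  qed
  have fin: "finite (?c ` x_subgroups n)" "finite (?c ` y_subgroups n)" "finite (?c ` z_subgroups n)"
    using finite_x_subgroups[OF n] by (simp_all add: y_subgroups_def z_subgroups_def)
  have "card (?c ` y_subgroups n) = card (?c ` x_subgroups n)"
    "card (?c ` z_subgroups n) = card (?c ` y_subgroups n)"
    unfolding cz by (simp_all add: cy card_image inj)
  then show ?thesis
    unfolding subgroups_iso_didicosm(2)[OF n] image_Un
    using fin disj by (simp add: card_Un_disjoint Int_Un_distrib2)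
qed

section \<open>Coefficients of Dirichlet series\<close>

lemma ds_coeff_add: "ds_coeff (A + B) n = ds_coeff A n + ds_coeff B n"
  by (cases "n = 0") (simp_all add: plus_dirichlet_series_def ds_coeff_dirichlet)

lemma ds_coeff_diff: "ds_coeff (A - B) n = ds_coeff A n - ds_coeff B n"
  by (cases "n = 0") (simp_all add: minus_dirichlet_series_def ds_coeff_dirichlet)

lemma ds_coeff_of_nat_mult:
  fixes A :: "'a::comm_ring_1 dirichlet_series"
  shows "ds_coeff (of_nat k * A) n = of_nat k * ds_coeff A n"
proof (induction k)
  case 0
  have "ds_coeff (0 :: 'a dirichlet_series) n = 0"
    by (simp add: zero_dirichlet_series_def ds_coeff_dirichlet)
  then show ?case by simp
next
  case (Suc k)
  have "of_nat (Suc k) * A = of_nat k * A + A" by (simp add: algebra_simps)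
  then show ?case by (simp only: ds_coeff_add Suc) (simp add: algebra_simps)
qed

lemma ds_coeff_numeral_mult: "ds_coeff (numeral k * A) n = numeral k * ds_coeff A n"
  using ds_coeff_of_nat_mult[of "numeral k" A n] by simp

text \<open>Covers \<open>ds_pow\<close> and \<open>ds_const\<close> together: both are series with
  a single term.\<close>

lemma ds_coeff_single_mult:
  assumes n: "n > 0" and single: "\<And>d. d \<noteq> m \<Longrightarrow> ds_coeff A d = 0"
  shows "ds_coeff (A * B) n = (if m dvd n then ds_coeff A m * ds_coeff B (n div m) else 0)"
proof -
  have "ds_coeff (A * B) n = (\<Sum>d | d dvd n. ds_coeff A d * ds_coeff B (n div d))"
    using n by (simp add: times_dirichlet_series_def ds_coeff_dirichlet)
  also have "\<dots> = (\<Sum>d | d dvd n. if d = m then ds_coeff A m * ds_coeff B (n div m) else 0)"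
    by (rule sum.cong) (auto simp: single)
  also have "\<dots> = (if m dvd n then ds_coeff A m * ds_coeff B (n div m) else 0)"
    using n by (subst sum.delta) auto
  finally show ?thesis .
qed

lemma ds_coeff_pow_mult:
  assumes "n > 0" "m > 0"
  shows "ds_coeff (ds_pow m * A) n = (if m dvd n then ds_coeff A (n div m) else 0)"
  using assms ds_coeff_single_mult[of n m "ds_pow m" A] by (simp add: ds_pow_def ds_coeff_dirichlet)

lemma ds_coeff_const_mult:
  assumes "n > 0"
  shows "ds_coeff (ds_const c * A) n = c * ds_coeff A n"
  using assms ds_coeff_single_mult[of n 1 "ds_const c" A] by (simp add: ds_const_def ds_coeff_dirichlet)

lemma ds_const_numeral_cancel:
  fixes A :: "complex dirichlet_series"
  shows "ds_const (1 / numeral k) * (numeral k * A) = A"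
  by (rule ds_eqI) (simp add: ds_coeff_const_mult ds_coeff_numeral_mult)

lemma ds_coeff_zeta: "n > 0 \<Longrightarrow> ds_coeff (ds_zeta j) n = of_nat n ^ j"
  by (simp add: ds_zeta_def ds_coeff_dirichlet)

lemma ds_coeff_dgf: "n > 0 \<Longrightarrow> ds_coeff (dgf f) n = of_nat (f n)"
  by (simp add: dgf_def ds_coeff_dirichlet)

text \<open>The part of \<open>ds_zeta j\<close> supported on even indices, because
  \<open>(2 m)^j (2 m)^(-s) = 2^j 2^(-s) m^j m^(-s)\<close>.\<close>

definition ds_even :: "nat \<Rightarrow> complex dirichlet_series" where
  "ds_even j = ds_pow 2 * (2 ^ j * ds_zeta j)"

definition ds_odd :: "nat \<Rightarrow> complex dirichlet_series" where
  "ds_odd j = ds_zeta j - ds_even j"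

lemma ds_coeff_even: "n > 0 \<Longrightarrow> ds_coeff (ds_even j) n = of_bool (even n) * of_nat n ^ j"
proof -
  assume n: "n > 0"
  have "2 ^ j * ds_zeta j = (of_nat (2 ^ j) * ds_zeta j :: complex dirichlet_series)" by simp
  then show ?thesis
    unfolding ds_even_def using n
    by (simp add: ds_coeff_pow_mult ds_coeff_of_nat_mult ds_coeff_zeta del: of_nat_power)
      (auto elim!: evenE simp: power_mult_distrib ds_coeff_zeta)
qed

lemma ds_coeff_odd: "n > 0 \<Longrightarrow> ds_coeff (ds_odd j) n = of_bool (odd n) * of_nat n ^ j"
  by (simp add: ds_odd_def ds_coeff_diff ds_coeff_zeta ds_coeff_even)

lemma ds_coeff_mult3:
  assumes n: "n > 0"
  shows "ds_coeff (A * B * C) n = (\<Sum>(a, b, c)\<in>triples n. ds_coeff A a * ds_coeff B b * ds_coeff C c)"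
proof -
  let ?P = "\<lambda>n. {(d, e). d * e = (n :: nat)}"
  have "ds_coeff (A * B * C) n =
      (\<Sum>p\<in>?P n. \<Sum>q\<in>?P (fst p). ds_coeff A (fst q) * ds_coeff B (snd q) * ds_coeff C (snd p))"
    unfolding ds_coeff_mult_pairs[OF n]
  proof (rule sum.cong)
    fix p assume "p \<in> ?P n"
    then have p: "fst p > 0" using n by (auto intro!: Nat.gr0I)
    show "(case p of (d, e) \<Rightarrow> ds_coeff (A * B) d * ds_coeff C e) =
      (\<Sum>q\<in>?P (fst p). ds_coeff A (fst q) * ds_coeff B (snd q) * ds_coeff C (snd p))"
      using ds_coeff_mult_pairs[OF p, of A B]
      by (simp add: case_prod_unfold sum_distrib_right)
  qed simp
  also have "\<dots> = (\<Sum>(p, q)\<in>(SIGMA p:?P n. ?P (fst p)).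
      ds_coeff A (fst q) * ds_coeff B (snd q) * ds_coeff C (snd p))"
    using n by (subst sum.Sigma) (auto simp: finite_divisor_pairs intro!: finite_divisor_pairs Nat.gr0I)
  also have "\<dots> = (\<Sum>(a, b, c)\<in>triples n. ds_coeff A a * ds_coeff B b * ds_coeff C c)"
    by (rule sum.reindex_bij_witness[of _ "\<lambda>(a, b, c). ((a * b, c), (a, b))"
          "\<lambda>((d, c), (a, b)). (a, b, c)"])
      (auto simp: triples_def)
  finally show ?thesis .
qed

lemma dgf_eq_triples:
  fixes A B C :: "complex dirichlet_series"
  assumes "\<And>n. n > 0 \<Longrightarrow> of_nat (f n) =
      (\<Sum>(a, b, c)\<in>triples n. ds_coeff A a * ds_coeff B b * ds_coeff C c)"
  shows "dgf f = A * B * C"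
  by (rule ds_eqI) (simp add: ds_coeff_dgf ds_coeff_mult3 assms)

lemma ds_eq_pow_mult:
  assumes m: "m > 0" and 0: "\<And>n. n > 0 \<Longrightarrow> \<not> m dvd n \<Longrightarrow> ds_coeff F n = 0"
    and 1: "\<And>n. n > 0 \<Longrightarrow> ds_coeff F (m * n) = ds_coeff A n"
  shows "F = ds_pow m * A"
proof (rule ds_eqI)
  fix n :: nat assume n: "n > 0"
  show "ds_coeff F n = ds_coeff (ds_pow m * A) n"
  proof (cases "m dvd n")
    case True
    then obtain k where "n = m * k" by (elim dvdE)
    then show ?thesis using n m 1[of k] by (simp add: ds_coeff_pow_mult)
  qed (use n m 0 in \<open>simp add: ds_coeff_pow_mult\<close>)
qed

lemma sum_triples_cong:
  assumes "n > 0" "\<And>a b c. a > 0 \<Longrightarrow> b > 0 \<Longrightarrow> c > 0 \<Longrightarrow> f a b c = g a b c"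
  shows "(\<Sum>(a, b, c)\<in>triples n. f a b c) = (\<Sum>(a, b, c)\<in>triples n. g a b c)"
  by (rule sum.cong) (use assms triples_pos[of _ _ _ n] in auto)

lemma group_pi1_G6: "group pi1_G6" and group_pi1_G2: "group pi1_G2"
  by (simp_all add: pi1_G6_def pi1_G2_def Let_def group_presented_group)

lemma counts_pi1_G6:
  assumes "group H" "group H'" "H \<cong> H'"
  shows "subgroup_count H pi1_G6 n = card (subgroups_iso H' didicosm n)"
    and "conj_class_count H pi1_G6 n = card (conjugacy_class didicosm ` subgroups_iso H' didicosm n)"
  using counts_iso_transfer[OF group_pi1_G6 group_didicosm pi1_G6_iso, of H n]
    subgroups_iso_cong[OF assms(3,1,2) group_didicosm, of n]
  by (simp_all add: subgroup_count_def conj_class_count_def)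

lemma iso_refl: "G \<cong> G"
  by (rule is_isoI[OF iso_set_refl])

lemmas ds_coeff_parity = ds_coeff_zeta ds_coeff_even ds_coeff_odd

lemma ds_even_eq: "ds_even 0 = ds_pow 2 * ds_zeta 0" "ds_even 1 = 2 * ds_pow 2 * ds_zeta 1"
  by (simp_all add: ds_even_def[of 0] ds_even_def[of 1] mult_ac del: One_nat_def)

lemma ds_odd_eq: "ds_odd 0 = (1 - ds_pow 2) * ds_zeta 0" "ds_odd 1 = (1 - 2 * ds_pow 2) * ds_zeta 1"
  by (simp_all only: ds_odd_def ds_even_eq) (simp_all add: algebra_simps)

section \<open>The six generating functions\<close>

lemma dgf_pi1_G1_subgroups:
  "dgf (subgroup_count pi1_G1 pi1_G6) = ds_pow 4 * (ds_zeta 0 * ds_zeta 1 * ds_zeta 2)"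
proof (rule ds_eq_pow_mult)
  note count = counts_pi1_G6(1)[OF group_pi1_G1 group_pi1_G1 iso_refl]
  fix n :: nat assume n: "n > 0"
  show "ds_coeff (dgf (subgroup_count pi1_G1 pi1_G6)) n = 0" if "\<not> 4 dvd n"
    using n that by (simp add: ds_coeff_dgf count subgroups_iso_didicosm transl_subgroups_dvd)
  have "ds_coeff (ds_zeta 0 * ds_zeta 1 * ds_zeta 2) n =
      (\<Sum>(a, b, c)\<in>triples n. complex_of_nat (b * c * c))"
    unfolding ds_coeff_mult3[OF n]
    by (rule sum_triples_cong[OF n]) (simp add: ds_coeff_zeta power2_eq_square)
  then show "ds_coeff (dgf (subgroup_count pi1_G1 pi1_G6)) (4 * n) =
      ds_coeff (ds_zeta 0 * ds_zeta 1 * ds_zeta 2) n"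
    using n by (simp add: ds_coeff_dgf count subgroups_iso_didicosm card_transl_subgroups
        case_prod_unfold del: of_nat_mult)
qed simp

text \<open>The first product counts all subgroups; the 3 stands for the three half turns. The three
  products in the last bracket encode the summands 1, \<open>of_bool (even c)\<close> and
  \<open>of_bool (even b)\<close> in the weight of the fixed points, each with the factor
  \<open>c\<close>.\<close>

lemma dgf_pi1_G1_classes:
  "4 * dgf (conj_class_count pi1_G1 pi1_G6) = ds_pow 4 * (ds_zeta 0 * ds_zeta 1 * ds_zeta 2 +
    3 * (ds_zeta 0 * ds_zeta 0 * ds_zeta 1 + ds_zeta 0 * ds_zeta 0 * ds_even 1 +
      ds_zeta 0 * ds_even 0 * ds_zeta 1))" (is "_ = _ * (?A + 3 * ?B)")
proof (rule ds_eq_pow_mult)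
  note count = counts_pi1_G6(2)[OF group_pi1_G1 group_pi1_G1 iso_refl]
  fix n :: nat assume n: "n > 0"
  show "ds_coeff (4 * dgf (conj_class_count pi1_G1 pi1_G6)) n = 0" if "\<not> 4 dvd n"
    using n that
    by (simp add: ds_coeff_numeral_mult ds_coeff_dgf count subgroups_iso_didicosm transl_subgroups_dvd)
  have A: "ds_coeff ?A n = of_nat (\<Sum>(a, b, c)\<in>triples n. b * c * c)"
    unfolding ds_coeff_mult3[OF n] of_nat_sum case_prod_unfold
    by (rule sum.cong) (use n triples_pos in \<open>auto simp: ds_coeff_zeta power2_eq_square\<close>)
  have B: "ds_coeff ?B n = of_nat (\<Sum>(a, b, c)\<in>triples n. c * (1 + of_bool (even c) + of_bool (even b)))"
    unfolding ds_coeff_add ds_coeff_mult3[OF n] of_nat_sum case_prod_unfold sum.distrib[symmetric]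
    by (rule sum.cong) (use n triples_pos in \<open>auto simp: ds_coeff_parity algebra_simps\<close>)
  have "ds_coeff (4 * dgf (conj_class_count pi1_G1 pi1_G6)) (4 * n) =
      of_nat (4 * card (conjugacy_class didicosm ` transl_subgroups (4 * n)))"
    using n by (simp add: ds_coeff_numeral_mult ds_coeff_dgf count subgroups_iso_didicosm)
  also have "\<dots> = ds_coeff (?A + 3 * ?B) n"
    unfolding card_conjugacy_classes_transl[OF n] ds_coeff_add[of ?A] ds_coeff_numeral_mult A B by simp
  finally show "ds_coeff (4 * dgf (conj_class_count pi1_G1 pi1_G6)) (4 * n) = ds_coeff (?A + 3 * ?B) n" .
qed simp

lemma dgf_pi1_G2_subgroups:
  "dgf (subgroup_count pi1_G2 pi1_G6) = ds_pow 2 * (3 * (ds_odd 0 * ds_zeta 1 * ds_zeta 2))"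
proof (rule ds_eq_pow_mult)
  note count = counts_pi1_G6(1)[OF group_pi1_G2 group_dicosm pi1_G2_iso]
  fix n :: nat assume n: "n > 0"
  show "ds_coeff (dgf (subgroup_count pi1_G2 pi1_G6)) n = 0" if "\<not> 2 dvd n"
    using n that by (simp add: ds_coeff_dgf count card_dicosm_subgroups x_subgroups_odd)
  have "ds_coeff (ds_odd 0 * ds_zeta 1 * ds_zeta 2) n =
      of_nat (\<Sum>(k, b, c)\<in>triples n. of_bool (odd k) * (b * c * c))"
    unfolding ds_coeff_mult3[OF n] of_nat_sum case_prod_unfold
    by (rule sum.cong) (use n triples_pos in \<open>auto simp: ds_coeff_parity power2_eq_square\<close>)
  then show "ds_coeff (dgf (subgroup_count pi1_G2 pi1_G6)) (2 * n) =
      ds_coeff (3 * (ds_odd 0 * ds_zeta 1 * ds_zeta 2)) n"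
    using n by (simp add: ds_coeff_dgf ds_coeff_numeral_mult count card_dicosm_subgroups
        card_x_subgroups del: of_nat_sum)
qed simp

text \<open>The 3 stands for the three axes. The first bracket counts the invariants, the last
  product those fixed by \<open>twist\<close>: its third factor gives odd \<open>c\<close> the
  weight 1 and twice an odd number the weight 2.\<close>

lemma dgf_pi1_G2_classes:
  "2 * dgf (conj_class_count pi1_G2 pi1_G6) = ds_pow 2 * (3 *
    ((ds_odd 0 * ds_zeta 0 * ds_zeta 1 + ds_odd 0 * ds_zeta 0 * ds_even 1 +
      ds_odd 0 * ds_even 0 * ds_zeta 1) +
     ds_odd 0 * ds_odd 0 * (ds_odd 0 + 2 * (ds_pow 2 * ds_odd 0))))" (is "_ = _ * (3 * (?A + ?B))")
proof (rule ds_eq_pow_mult)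
  note count = counts_pi1_G6(2)[OF group_pi1_G2 group_dicosm pi1_G2_iso]
  fix n :: nat assume n: "n > 0"
  show "ds_coeff (2 * dgf (conj_class_count pi1_G2 pi1_G6)) n = 0" if "\<not> 2 dvd n"
    using n that by (simp add: ds_coeff_numeral_mult ds_coeff_dgf count
        card_dicosm_conjugacy_classes x_subgroups_odd)
  have A: "ds_coeff ?A n = of_nat (\<Sum>(k, b, c)\<in>triples n.
      of_bool (odd k) * (c * (1 + of_bool (even c) + of_bool (even b))))"
    unfolding ds_coeff_add ds_coeff_mult3[OF n] of_nat_sum case_prod_unfold sum.distrib[symmetric]
    by (rule sum.cong) (use n triples_pos in \<open>auto simp: ds_coeff_parity algebra_simps\<close>)
  have C: "ds_coeff (ds_odd 0 + 2 * (ds_pow 2 * ds_odd 0)) c =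
      of_nat (of_bool (odd c) + 2 * of_bool (even c \<and> odd (c div 2)))" if "c > 0" for c
    using that by (auto simp: ds_coeff_add ds_coeff_numeral_mult ds_coeff_pow_mult ds_coeff_odd elim!: evenE)
  have B: "ds_coeff ?B n = of_nat (\<Sum>(k, b, c)\<in>triples n. of_bool (odd k) *
      (of_bool (odd b) * (of_bool (odd c) + 2 * of_bool (even c \<and> odd (c div 2)))))"
    unfolding ds_coeff_mult3[OF n] of_nat_sum case_prod_unfold
    by (rule sum.cong) (use n triples_pos in \<open>auto simp: ds_coeff_odd C\<close>)
  have "ds_coeff (2 * dgf (conj_class_count pi1_G2 pi1_G6)) (2 * n) =
      of_nat (3 * (2 * card (conjugacy_class didicosm ` x_subgroups (2 * n))))"
    using n by (simp add: ds_coeff_numeral_mult ds_coeff_dgf count card_dicosm_conjugacy_classes)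
  also have "\<dots> = ds_coeff (3 * (?A + ?B)) n"
    unfolding card_conjugacy_classes_x_subgroups[OF n] card_xinv_image[OF n] card_twist_invariant[OF n]
      ds_coeff_numeral_mult ds_coeff_add[of ?A] A B by simp
  finally show "ds_coeff (2 * dgf (conj_class_count pi1_G2 pi1_G6)) (2 * n) =
    ds_coeff (3 * (?A + ?B)) n" .
qed simp

lemma dgf_pi1_G6_subgroups:
  "dgf (subgroup_count pi1_G6 pi1_G6) = ds_odd 1 * ds_odd 1 * ds_odd 1"
proof (rule dgf_eq_triples)
  note count = counts_pi1_G6(1)[OF group_pi1_G6 group_didicosm pi1_G6_iso]
  fix n :: nat assume n: "n > 0"
  show "of_nat (subgroup_count pi1_G6 pi1_G6 n) =
      (\<Sum>(a, b, c)\<in>triples n. ds_coeff (ds_odd 1) a * ds_coeff (ds_odd 1) b * ds_coeff (ds_odd 1) c)"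
    unfolding count subgroups_iso_didicosm(3)[OF n] card_full_subgroups[OF n] of_nat_sum case_prod_unfold
    by (rule sum.cong) (use n triples_pos in \<open>auto simp: ds_coeff_odd\<close>)
qed

lemma dgf_pi1_G6_classes:
  "dgf (conj_class_count pi1_G6 pi1_G6) = ds_odd 0 * ds_odd 0 * ds_odd 0"
proof (rule dgf_eq_triples)
  note count = counts_pi1_G6(2)[OF group_pi1_G6 group_didicosm pi1_G6_iso]
  fix n :: nat assume n: "n > 0"
  show "of_nat (conj_class_count pi1_G6 pi1_G6 n) =
      (\<Sum>(a, b, c)\<in>triples n. ds_coeff (ds_odd 0) a * ds_coeff (ds_odd 0) b * ds_coeff (ds_odd 0) c)"
    unfolding count subgroups_iso_didicosm(3)[OF n] card_conjugacy_classes_full[OF n] of_nat_sum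
      case_prod_unfold
    by (rule sum.cong) (use n triples_pos in \<open>auto simp: ds_coeff_odd\<close>)
qed

theorem mainTheorem3:
  shows
    "dgf (subgroup_count pi1_G1 pi1_G6) = ds_pow 4 * ds_zeta 0 * ds_zeta 1 * ds_zeta 2 \<and>
     dgf (conj_class_count pi1_G1 pi1_G6) =
        ds_const (1/4) * ds_pow 4 * ds_zeta 0 * ds_zeta 1 *
          (ds_zeta 2 + 3 * (1 + 3 * ds_pow 2) * ds_zeta 0) \<and>
     dgf (subgroup_count pi1_G2 pi1_G6) =
        3 * ds_pow 2 * (1 - ds_pow 2) * ds_zeta 0 * ds_zeta 1 * ds_zeta 2 \<and>
     dgf (conj_class_count pi1_G2 pi1_G6) =
        3 * (ds_const (1/2) * ds_pow 2) * (1 - ds_pow 2) * ds_zeta 0 ^ 2 *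
          ((1 + 3 * ds_pow 2) * ds_zeta 1 +
           (1 - ds_pow 2) ^ 2 * (1 + 2 * ds_pow 2) * ds_zeta 0) \<and>
     dgf (subgroup_count pi1_G6 pi1_G6) = (1 - 2 * ds_pow 2) ^ 3 * ds_zeta 1 ^ 3 \<and>
     dgf (conj_class_count pi1_G6 pi1_G6) = (1 - ds_pow 2) ^ 3 * ds_zeta 0 ^ 3"
proof (intro conjI)
  show "dgf (subgroup_count pi1_G1 pi1_G6) = ds_pow 4 * ds_zeta 0 * ds_zeta 1 * ds_zeta 2"
    by (simp add: dgf_pi1_G1_subgroups mult.assoc)
  have "dgf (conj_class_count pi1_G1 pi1_G6) =
      ds_const (1/4) * (4 * dgf (conj_class_count pi1_G1 pi1_G6))"
    by (simp only: ds_const_numeral_cancel)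
  \<comment> \<open>In \<open>1 + 3 * ds_pow 2\<close> the multiple of \<open>ds_pow 2\<close> is 2
    from \<open>ds_even 1\<close> plus 1 from \<open>ds_even 0\<close>.\<close>
  also have "\<dots> = ds_const (1/4) * ds_pow 4 * ds_zeta 0 * ds_zeta 1 *
      (ds_zeta 2 + 3 * (1 + 3 * ds_pow 2) * ds_zeta 0)"
    unfolding dgf_pi1_G1_classes ds_even_eq by (simp add: algebra_simps power2_eq_square power3_eq_cube)
  finally show "dgf (conj_class_count pi1_G1 pi1_G6) = ds_const (1/4) * ds_pow 4 * ds_zeta 0 * ds_zeta 1 *
      (ds_zeta 2 + 3 * (1 + 3 * ds_pow 2) * ds_zeta 0)" .
  show "dgf (subgroup_count pi1_G2 pi1_G6) =
      3 * ds_pow 2 * (1 - ds_pow 2) * ds_zeta 0 * ds_zeta 1 * ds_zeta 2"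
    unfolding dgf_pi1_G2_subgroups ds_odd_eq by (simp add: algebra_simps power2_eq_square power3_eq_cube)
  have "dgf (conj_class_count pi1_G2 pi1_G6) =
      ds_const (1/2) * (2 * dgf (conj_class_count pi1_G2 pi1_G6))"
    by (simp only: ds_const_numeral_cancel)
  \<comment> \<open>The fixed-point term carries three factors \<open>1 - ds_pow 2\<close>, one from
    each \<open>ds_odd 0\<close>. One of them is common to all terms and stands outside, which
    leaves the square.\<close>
  also have "\<dots> = 3 * (ds_const (1/2) * ds_pow 2) * (1 - ds_pow 2) * ds_zeta 0 ^ 2 *
      ((1 + 3 * ds_pow 2) * ds_zeta 1 +
       (1 - ds_pow 2) ^ 2 * (1 + 2 * ds_pow 2) * ds_zeta 0)"
    unfolding dgf_pi1_G2_classes ds_odd_eq ds_even_eq by (simp add: algebra_simps power2_eq_square power3_eq_cube)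
  finally show "dgf (conj_class_count pi1_G2 pi1_G6) =
      3 * (ds_const (1/2) * ds_pow 2) * (1 - ds_pow 2) * ds_zeta 0 ^ 2 *
      ((1 + 3 * ds_pow 2) * ds_zeta 1 +
       (1 - ds_pow 2) ^ 2 * (1 + 2 * ds_pow 2) * ds_zeta 0)" .
  show "dgf (subgroup_count pi1_G6 pi1_G6) = (1 - 2 * ds_pow 2) ^ 3 * ds_zeta 1 ^ 3"
    unfolding dgf_pi1_G6_subgroups ds_odd_eq by (simp add: algebra_simps power2_eq_square power3_eq_cube)
  show "dgf (conj_class_count pi1_G6 pi1_G6) = (1 - ds_pow 2) ^ 3 * ds_zeta 0 ^ 3"
    unfolding dgf_pi1_G6_classes ds_odd_eq by (simp add: algebra_simps power2_eq_square power3_eq_cube)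
qed

end
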